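(* Let $m\ge0$, $\mu,\kappa>0$. Let $V\in C^2(\mathbb{R})$ with $V(y)\to\infty$ as $|y|\to\infty$, and let $F=-V'$. Let $(u_0,u_1)\in\mathcal{H}$ and $y_1\in\mathbb{R}$. Then the Cauchy problem $$\mu\ddot u(x,t)=\kappa u''(x,t),\quad t\in\mathbb{R},\ x\in\mathbb{R}\setminus\{0\},$$ $$m\ddot y(t)=F(y(t))+\kappa[u'(0+,t)-u'(0-,t)],\quad y(t)=u(0-,t)=u(0+,t),\quad t\in\mathbb{R},$$ $$u|_{t=0}=u_0(x),\quad \dot u|_{t=0}=u_1(x),\ x\in\mathbb{R},\qquad \dot y|_{t=0}=y_1\ \text{(this last condition only if } m\neq0)$$ has a unique solution $u(x,t)\in\mathcal{E}$.
   Context: Notation: $\dot u=\partial u/\partial t$, $u'=\partial u/\partial x$, $a=\sqrt{\kappa/\mu}$. Class $\mathcal{E}$: $u\in\mathcal{E}$ iff $u\in C(\mathbb{R}^2)$ and $\dot u,u'\in L^2_{\rm loc}(\mathbb{R}^2)$ (distributional derivatives). Class $\mathcal{H}$: $(u_0,u_1)\in\mathcal{H}$ iff $u_0\in C(\mathbb{R})$ and $u_0',u_1\in L^2_{\rm loc}(\mathbb{R})$. Meaning of the system for $u\in\mathcal{E}$: the wave equation is understood in the sense of distributions in $\{x\ne0\}$; it is equivalent to the d'Alembert decomposition $u(x,t)=f_\pm(x-at)+g_\pm(x+at)$ for $\pm x>0$, $t\in\mathbb{R}$, with $f_\pm,g_\pm\in C(\mathbb{R})$ and $f_\pm',g_\pm'\in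 L^2_{\rm loc}(\mathbb{R})$. In the equation for $y$, $u'(0\pm,t):=f_\pm'(-at)+g_\pm'(at)\in L^2_{\rm loc}(\mathbb{R})$ and $\ddot y$ is understood in the sense of distributions; if $m\ne0$ this forces $\ddot y\in L^2_{\rm loc}(\mathbb{R})$ and $y\in C^1(\mathbb{R})$, so that $\dot y(0)$ makes sense. The initial conditions for $u$ are understood through the d'Alembert decomposition: $f_\pm(x)+g_\pm(x)=u_0(x)$ and $-af_\pm'(x)+ag_\pm'(x)=u_1(x)$ for $\pm x>0$. *)

theory Defs
  imports "HOL-Analysis.Analysis"
begin

definition dir_deriv :: "'a::euclidean_space \<Rightarrow> ('a \<Rightarrow> real) \<Rightarrow> 'a \<Rightarrow> real" where
  "dir_deriv b f x = frechet_derivative f (at x) b"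

text \<open>On \<open>real\<close> the only basis vector is 1, and \<open>dir_deriv 1\<close> is the usual derivative.\<close>

primrec Ck :: "nat \<Rightarrow> ('a::euclidean_space \<Rightarrow> real) \<Rightarrow> bool" where
  "Ck 0 f \<longleftrightarrow> continuous_on UNIV f"
| "Ck (Suc k) f \<longleftrightarrow> f differentiable_on UNIV \<and> (\<forall>b\<in>Basis. Ck k (dir_deriv b f))"

definition test_functions :: "'a::euclidean_space set \<Rightarrow> ('a \<Rightarrow> real) set" where
  "test_functions \<Omega> =
     {\<phi>. (\<forall>k. Ck k \<phi>) \<and> compact (closure {x. \<phi> x \<noteq> 0}) \<and> closure {x. \<phi> x \<noteq> 0} \<subseteq> \<Omega>}"

text \<open>Elements of \<open>L2_loc\<close> are representatives; statements about them below are insensitive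
  to changes on null sets.\<close>

definition L2_loc :: "('a::euclidean_space \<Rightarrow> real) set" where
  "L2_loc = {f. f \<in> borel_measurable lebesgue \<and>
     (\<forall>K. compact K \<longrightarrow> set_integrable lebesgue K (\<lambda>x. (f x)\<^sup>2))}"

definition has_weak_deriv ::
    "'a::euclidean_space \<Rightarrow> ('a \<Rightarrow> real) \<Rightarrow> ('a \<Rightarrow> real) \<Rightarrow> bool" where
  "has_weak_deriv b f g \<longleftrightarrow>
     (\<forall>\<phi>\<in>test_functions UNIV.
        (\<integral>x. f x * dir_deriv b \<phi> x \<partial>lebesgue) = - (\<integral>x. g x * \<phi> x \<partial>lebesgue))"

text \<open>Points of the plane are pairs \<open>(x, t)\<close>.\<close>

definition class_E :: "(real \<times> real \<Rightarrow> real) set" where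
  "class_E = {u. continuous_on UNIV u \<and>
     (\<exists>v\<in>L2_loc. has_weak_deriv (0, 1) u v) \<and>
     (\<exists>w\<in>L2_loc. has_weak_deriv (1, 0) u w)}"

definition class_H :: "((real \<Rightarrow> real) \<times> (real \<Rightarrow> real)) set" where
  "class_H = {(u0, u1). continuous_on UNIV u0 \<and>
     (\<exists>w\<in>L2_loc. has_weak_deriv 1 u0 w) \<and> u1 \<in> L2_loc}"

definition wave_eq :: "real \<Rightarrow> real \<Rightarrow> (real \<times> real \<Rightarrow> real) \<Rightarrow> bool" where
  "wave_eq \<mu> \<kappa> u \<longleftrightarrow>
     (\<forall>\<phi>\<in>test_functions {p. fst p \<noteq> 0}.
        (\<integral>p. u p * (\<mu> * dir_deriv (0, 1) (dir_deriv (0, 1) \<phi>) p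
                  - \<kappa> * dir_deriv (1, 0) (dir_deriv (1, 0) \<phi>) p) \<partial>lebesgue) = 0)"

definition dAlembert ::
    "real \<Rightarrow> real set \<Rightarrow> (real \<times> real \<Rightarrow> real) \<Rightarrow> (real \<Rightarrow> real) \<Rightarrow> (real \<Rightarrow> real) \<Rightarrow>
     (real \<Rightarrow> real) \<Rightarrow> (real \<Rightarrow> real) \<Rightarrow> bool" where
  "dAlembert a I u f g df dg \<longleftrightarrow>
     continuous_on UNIV f \<and> continuous_on UNIV g \<and>
     df \<in> L2_loc \<and> dg \<in> L2_loc \<and> has_weak_deriv 1 f df \<and> has_weak_deriv 1 g dg \<and>
     (\<forall>x\<in>I. \<forall>t. u (x, t) = f (x - a * t) + g (x + a * t))"

definition oscillator_eq ::
    "real \<Rightarrow> real \<Rightarrow> (real \<Rightarrow> real) \<Rightarrow> (real \<Rightarrow> real) \<Rightarrow> (real \<Rightarrow> real) \<Rightarrow> (real \<Rightarrow> real) \<Rightarrow> bool" where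
  "oscillator_eq m \<kappa> F y ux_plus ux_minus \<longleftrightarrow>
     (\<forall>\<phi>\<in>test_functions UNIV.
        m * (\<integral>t. y t * dir_deriv 1 (dir_deriv 1 \<phi>) t \<partial>lebesgue) =
        (\<integral>t. (F (y t) + \<kappa> * (ux_plus t - ux_minus t)) * \<phi> t \<partial>lebesgue))"

text \<open>The one-sided derivatives \<open>u'(0\<plusminus>, t)\<close> and the initial conditions have no meaning for
  \<open>u \<in> class_E\<close> alone; they are read off from a d'Alembert decomposition on each side of the
  origin. Such a decomposition is unique up to adding a constant to \<open>f\<close> and subtracting it
  from \<open>g\<close>, so the conditions do not depend on its choice.\<close>

definition lamb_solution ::
    "real \<Rightarrow> real \<Rightarrow> real \<Rightarrow> (real \<Rightarrow> real) \<Rightarrow> (real \<Rightarrow> real) \<Rightarrow> (real \<Rightarrow> real) \<Rightarrow> real \<Rightarrow>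
     (real \<times> real \<Rightarrow> real) \<Rightarrow> (real \<Rightarrow> real) \<Rightarrow> bool" where
  "lamb_solution m \<mu> \<kappa> F u0 u1 y1 u y \<longleftrightarrow>
     (let a = sqrt (\<kappa> / \<mu>) in
      wave_eq \<mu> \<kappa> u \<and>
      (\<forall>t. ((\<lambda>x. u (x, t)) \<longlongrightarrow> y t) (at_left 0) \<and> ((\<lambda>x. u (x, t)) \<longlongrightarrow> y t) (at_right 0)) \<and>
      (\<exists>f_plus g_plus df_plus dg_plus f_minus g_minus df_minus dg_minus.
         dAlembert a {0<..} u f_plus g_plus df_plus dg_plus \<and>
         dAlembert a {..<0} u f_minus g_minus df_minus dg_minus \<and>
         oscillator_eq m \<kappa> F y
           (\<lambda>t. df_plus (- a * t) + dg_plus (a * t))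
           (\<lambda>t. df_minus (- a * t) + dg_minus (a * t)) \<and>
         (\<forall>x>0. f_plus x + g_plus x = u0 x) \<and>
         (\<forall>x<0. f_minus x + g_minus x = u0 x) \<and>
         (AE x in lebesgue. x > 0 \<longrightarrow> - a * df_plus x + a * dg_plus x = u1 x) \<and>
         (AE x in lebesgue. x < 0 \<longrightarrow> - a * df_minus x + a * dg_minus x = u1 x)) \<and>
      (m \<noteq> 0 \<longrightarrow> (y has_real_derivative y1) (at 0)))"

end

theory Submission imports Defs begin

text \<open>Off the origin the wave equation is pure transport: \<open>u = f (x - a t) + g (x + a t)\<close> on each side. With
\<open>U' = u1\<close> and up to constants, the initial data determine \<open>f = (u0 - U / a) / 2\<close> and
\<open>g = (u0 + U / a) / 2\<close> on the half-line on which the decomposition is made. At times \<open>t \<ge> 0\<close> this settles the two waves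
that arrive at the origin, at times \<open>t \<le> 0\<close> the two waves that depart from it. The other two waves are then determined by the displacement
\<open>y\<close> of the oscillator.
Inserting them into the force balance at the origin leaves a single ordinary equation with radiation damping,
\<open>m y'' = F y - b * sgn t * (y' - D')\<close>, where \<open>b = 2 \<kappa> / a\<close> and \<open>D\<close> is the value at the origin of the
d'Alembert solution without the oscillator. So the theorem reduces to unique global solvability of this equation.

The equation is used in an integrated form (\<open>two_sided_sol\<close>), which covers \<open>m = 0\<close> and
\<open>m > 0\<close> together and does not involve second derivatives. Uniqueness is a Gronwall argument
(\<open>half_sol_unique\<close>). For existence the force is truncated, the truncated Volterra equation is solved by Picard iteration,
and the energy \<open>m y'\<^sup>2 / 2 + V y\<close>, whose growth is bounded by \<open>b / 4\<close> times the integral of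
\<open>D'\<^sup>2\<close>, shows that the truncation is never reached because \<open>V\<close> is confining
(\<open>half_sol_energy\<close>, \<open>half_sol_exists_on_interval\<close>). Square integrability of the derivatives of the data is
what makes this bound finite. Reversing time exchanges incoming and outgoing waves, so negative times reduce to positive ones.

The bridge between the distributional formulation and this equation consists of three facts. A continuous function with a
locally square integrable weak derivative is an indefinite integral (\<open>weak_deriv_imp_primitive\<close>), which is
expressed by the predicate \<open>primitive_on\<close>. A continuous function with vanishing weak second derivative is affine
(\<open>weak_second_deriv_zero_imp_affine\<close>), which integrates the oscillator equation. Finally, weak derivatives in the plane
may be computed line by line, and a travelling wave solves its transport equation
(\<open>fibrewise_primitive_imp_weak_deriv\<close>, \<open>transport_orthogonal\<close>), which shows that the
constructed \<open>u\<close> lies in the right class and solves the wave equation.\<close>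

section \<open>Smooth functions of one real variable\<close>

lemma dir_deriv_real_eq:
  fixes f :: "real \<Rightarrow> real"
  assumes "(f has_real_derivative d) (at x)"
  shows "dir_deriv 1 f x = d"
proof -
  have "(f has_derivative (\<lambda>h. d * h)) (at x)"
    using assms by (simp add: has_field_derivative_def)
  then have "frechet_derivative f (at x) = (\<lambda>h. d * h)"
    by (metis frechet_derivative_at)
  then show ?thesis by (simp add: dir_deriv_def)
qed

lemma Ck_SucD_real:
  fixes f :: "real \<Rightarrow> real"
  assumes "Ck (Suc k) f"
  shows "(f has_real_derivative dir_deriv 1 f x) (at x)" and "Ck k (dir_deriv 1 f)"
proof -
  have "f differentiable (at x)"
    using assms by (simp add: differentiable_on_def)
  then obtain d where "(f has_real_derivative d) (at x)"
    using real_differentiable_def by blast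
  then show "(f has_real_derivative dir_deriv 1 f x) (at x)"
    using dir_deriv_real_eq by metis
  show "Ck k (dir_deriv 1 f)" using assms by simp
qed

lemma Ck_SucI_real:
  fixes f :: "real \<Rightarrow> real"
  assumes "\<And>x. (f has_real_derivative f' x) (at x)" and "Ck k f'"
  shows "Ck (Suc k) f"
proof -
  have "dir_deriv 1 f = f'" using dir_deriv_real_eq[OF assms(1)] by auto
  moreover have "f differentiable_on UNIV"
    using assms(1) by (auto simp: differentiable_on_def real_differentiable_def)
  ultimately show ?thesis using assms(2) by simp
qed

lemma Ck_SucD:
  assumes "Ck (Suc k) f" shows "Ck k f"
  using assms
proof (induction k arbitrary: f)
  case 0
  then show ?case by (simp add: differentiable_imp_continuous_on)
next
  case (Suc k)
  then show ?case by (metis Ck.simps(2))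
qed

lemma Ck_const: "Ck k (\<lambda>x::real. c)"
proof (induction k arbitrary: c)
  case (Suc k)
  show ?case by (rule Ck_SucI_real[where f' = "\<lambda>x. 0"]) (auto intro: Suc)
qed simp

lemma Ck_add_real:
  fixes f g :: "real \<Rightarrow> real"
  assumes "Ck k f" "Ck k g" shows "Ck k (\<lambda>x. f x + g x)"
  using assms
proof (induction k arbitrary: f g)
  case 0 then show ?case by (auto intro: continuous_intros)
next
  case (Suc k)
  show ?case
    by (rule Ck_SucI_real[OF DERIV_add[OF Ck_SucD_real(1)[OF Suc.prems(1)] Ck_SucD_real(1)[OF Suc.prems(2)]]])
       (use Suc Ck_SucD_real(2) in blast)
qed

lemma Ck_mult_real:
  fixes f g :: "real \<Rightarrow> real"
  assumes "Ck k f" "Ck k g" shows "Ck k (\<lambda>x. f x * g x)"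
  using assms
proof (induction k arbitrary: f g)
  case 0 then show ?case by (auto intro: continuous_intros)
next
  case (Suc k)
  have "Ck k (\<lambda>x. dir_deriv 1 f x * g x + dir_deriv 1 g x * f x)"
    using Suc Ck_SucD_real(2) Ck_SucD by (intro Ck_add_real Suc.IH) blast+
  then show ?case
    by (rule Ck_SucI_real[OF DERIV_mult[OF Ck_SucD_real(1)[OF Suc.prems(1)] Ck_SucD_real(1)[OF Suc.prems(2)]]])
qed

lemma Ck_affine_real:
  fixes f :: "real \<Rightarrow> real"
  assumes "Ck k f" shows "Ck k (\<lambda>x. f (c + r * x))"
  using assms
proof (induction k arbitrary: f)
  case 0
  then have "continuous_on UNIV f" by simp
  then have "continuous_on UNIV (\<lambda>x. f (c + r * x))"
    by (rule continuous_on_compose2) (intro continuous_intros, simp)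
  then show ?case by simp
next
  case (Suc k)
  have d: "((\<lambda>x. f (c + r * x)) has_real_derivative dir_deriv 1 f (c + r * x) * r) (at x)" for x
    by (rule DERIV_chain2[OF Ck_SucD_real(1)[OF Suc.prems]]) (auto intro!: derivative_eq_intros)
  have "Ck k (\<lambda>x. dir_deriv 1 f (c + r * x) * r)"
    using Suc Ck_SucD_real(2) by (intro Ck_mult_real Ck_const) blast+
  then show ?case using d by (rule Ck_SucI_real[rotated])
qed

text \<open>The family is closed under differentiation up to linear combinations, so smoothness of
\<open>flat 0\<close>, which is \<open>exp (- 1 / x)\<close> extended by zero, follows by induction over the whole family.\<close>

definition flat :: "nat \<Rightarrow> real \<Rightarrow> real" where
  "flat n x = (if x > 0 then (1 / x) ^ n * exp (- (1 / x)) else 0)"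

lemma flat_tendsto_0: "(flat n \<longlongrightarrow> 0) (at 0)"
proof -
  have "((\<lambda>x::real. (inverse x) ^ n / exp (inverse x)) \<longlongrightarrow> 0) (at_right 0)"
    using filterlim_compose[OF tendsto_power_div_exp_0 filterlim_inverse_at_top_right] by simp
  then have r: "(flat n \<longlongrightarrow> 0) (at_right 0)"
    by (rule Lim_transform_eventually)
       (auto simp: eventually_at_right_field flat_def exp_minus divide_simps intro!: exI[of _ 1])
  have l: "(flat n \<longlongrightarrow> 0) (at_left 0)"
    by (rule Lim_transform_eventually[OF tendsto_const])
       (auto simp: eventually_at_left_field flat_def intro!: exI[of _ "-1"])
  show ?thesis using l r by (rule filterlim_split_at)
qed

lemma flat_has_derivative:
  "(flat n has_real_derivative (- real n * flat (Suc n) x + flat (n + 2) x)) (at x)"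
proof -
  consider "x > 0" | "x < 0" | "x = 0" by linarith
  then show ?thesis
  proof cases
    case 1
    have inv: "((\<lambda>x. 1 / x) has_real_derivative - ((1 / x)\<^sup>2)) (at x)"
      using 1 by (auto intro!: derivative_eq_intros simp: power2_eq_square)
    have pw: "((\<lambda>x. (1 / x) ^ n) has_real_derivative - real n * (1 / x) ^ Suc n) (at x)"
    proof (cases n)
      case (Suc k)
      show ?thesis
        by (rule DERIV_cong[OF DERIV_power[OF inv, of n]])
           (simp add: Suc power2_eq_square algebra_simps del: power_one_over times_divide_eq_left times_divide_eq_right)
    qed simp
    have ex: "((\<lambda>x. exp (- (1 / x))) has_real_derivative exp (- (1 / x)) * - (- ((1 / x)\<^sup>2))) (at x)"
      by (rule DERIV_chain2[OF DERIV_exp DERIV_minus[OF inv]])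
    have "- real n * flat (Suc n) x + flat (n + 2) x
        = - real n * (1 / x) ^ Suc n * exp (- (1 / x)) + exp (- (1 / x)) * - (- ((1 / x)\<^sup>2)) * (1 / x) ^ n"
      using 1 by (simp add: flat_def power_add power2_eq_square mult_ac)
    then have "((\<lambda>x. (1 / x) ^ n * exp (- (1 / x))) has_real_derivative
        (- real n * flat (Suc n) x + flat (n + 2) x)) (at x)"
      using DERIV_mult[OF pw ex] by (simp only:)
    then show ?thesis
      by (rule DERIV_cong_ev[THEN iffD1, rotated -1])
         (use 1 in \<open>auto simp: flat_def eventually_nhds intro!: exI[of _ "{0<..}"]\<close>)
  next
    case 2
    have "((\<lambda>x. 0) has_real_derivative (- real n * flat (Suc n) x + flat (n + 2) x)) (at x)"
      using 2 by (auto simp: flat_def)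
    then show ?thesis
      by (rule DERIV_cong_ev[THEN iffD1, rotated -1])
         (use 2 in \<open>auto simp: flat_def eventually_nhds intro!: exI[of _ "{..<0}"]\<close>)
  next
    case 3
    have "((\<lambda>h. (flat n (0 + h) - flat n 0) / h) \<longlongrightarrow> 0) (at 0)"
      by (rule Lim_transform_eventually[OF flat_tendsto_0[of "Suc n"]])
         (auto simp: flat_def eventually_at intro!: exI[of _ 1])
    then show ?thesis using 3 by (simp add: DERIV_def flat_def)
  qed
qed

lemma Ck_flat: "Ck k (flat n)"
proof (induction k arbitrary: n)
  case 0
  show ?case using flat_has_derivative by (auto intro!: continuous_at_imp_continuous_on DERIV_isCont)
next
  case (Suc k)
  have "Ck k (\<lambda>x. - real n * flat (Suc n) x + flat (n + 2) x)"
    by (intro Ck_add_real Ck_mult_real Ck_const Suc)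
  then show ?case by (rule Ck_SucI_real[OF flat_has_derivative])
qed

lemma bump_exists:
  "\<exists>\<eta> :: real \<Rightarrow> real. (\<forall>k. Ck k \<eta>) \<and> (\<forall>x. \<eta> x \<ge> 0) \<and> (\<forall>x. 1 \<le> \<bar>x\<bar> \<longrightarrow> \<eta> x = 0) \<and> \<eta> 0 > 0"
proof -
  let ?\<eta> = "\<lambda>x. flat 0 (1 + 1 * x) * flat 0 (1 + (-1) * x)"
  have "\<And>k. Ck k ?\<eta>" by (intro Ck_mult_real Ck_affine_real Ck_flat)
  then show ?thesis by (intro exI[of _ ?\<eta>]) (auto simp: flat_def)
qed

text \<open>The indefinite integral of a smooth bump. Differences of two translates of a rescaled step are test functions
whose derivatives are two bumps of opposite sign.\<close>

lemma smooth_step_exists: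
  "\<exists>(\<sigma> :: real \<Rightarrow> real) \<eta> c. (\<forall>k. Ck k \<eta>) \<and> (\<forall>x. (\<sigma> has_real_derivative \<eta> x) (at x)) \<and> (\<forall>x. \<eta> x \<ge> 0) \<and>
    (\<forall>x. 1 \<le> \<bar>x\<bar> \<longrightarrow> \<eta> x = 0) \<and> (\<forall>x\<le>-1. \<sigma> x = 0) \<and> (\<forall>x\<ge>1. \<sigma> x = c) \<and> c > 0"
proof -
  obtain \<eta> :: "real \<Rightarrow> real" where \<eta>: "\<And>k. Ck k \<eta>" "\<And>x. \<eta> x \<ge> 0" "\<And>x. 1 \<le> \<bar>x\<bar> \<Longrightarrow> \<eta> x = 0" "\<eta> 0 > 0"
    using bump_exists by blast
  have cont: "continuous_on UNIV \<eta>" using \<eta>(1)[of 0] by simp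
  have contS: "continuous_on S \<eta>" for S using cont continuous_on_subset by blast
  define \<sigma> where "\<sigma> x = (if x \<le> -1 then 0 else integral {-1..x} \<eta>)" for x
  define c where "c = integral {-1..1} \<eta>"
  have split: "integral {l..x} \<eta> = integral {-1..x} \<eta>" if "l \<le> -1" "-1 \<le> x" for l x
  proof -
    have "integral {l..-1} \<eta> + integral {-1..x} \<eta> = integral {l..x} \<eta>"
      using that contS by (intro Henstock_Kurzweil_Integration.integral_combine integrable_continuous_real) auto
    moreover have "integral {l..-1} \<eta> = integral {l..-1} (\<lambda>_. 0)"
      by (rule integral_cong) (auto simp: \<eta>)
    ultimately show ?thesis by simp
  qed
  have zero: "integral {l..x} \<eta> = 0" if "x \<le> -1" for l x
  proof -
    have "integral {l..x} \<eta> = integral {l..x} (\<lambda>_. 0)"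
      by (rule integral_cong) (use that in \<open>auto simp: \<eta>\<close>)
    then show ?thesis by simp
  qed
  have eq: "\<sigma> x = integral {l..x} \<eta>" if "l \<le> -1" for l x
    using split[of l x] zero[of x l] that by (auto simp: \<sigma>_def)
  have der: "(\<sigma> has_real_derivative \<eta> x) (at x)" for x
  proof -
    let ?l = "min (x - 1) (-1)"
    have "((\<lambda>u. integral {?l..u} \<eta>) has_real_derivative \<eta> x) (at x within {?l..x+1})"
      by (rule integral_has_real_derivative) (use contS in auto)
    then have "((\<lambda>u. integral {?l..u} \<eta>) has_real_derivative \<eta> x) (at x)"
      by (subst (asm) at_within_interior) (auto simp: interior_atLeastAtMost_real)
    moreover have "(\<lambda>u. integral {?l..u} \<eta>) = \<sigma>" using eq[of ?l] by auto
    ultimately show ?thesis by simp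
  qed
  have "c \<noteq> 0"
  proof
    assume "c = 0"
    have "\<eta> x = 0" if "x \<in> {-1..1}" for x
    proof -
      have "(\<eta> has_integral 0) (cbox (-1) 1)"
        using integrable_integral[OF integrable_continuous_real[OF contS[of "{-1..1}"]]] \<open>c = 0\<close>
        by (simp add: c_def)
      then show ?thesis
        using has_integral_0_cbox_imp_0[of "-1" 1 \<eta> x] contS \<eta>(2) that by (auto simp: box_real)
    qed
    then show False using \<eta>(4) by force
  qed
  moreover have "c \<ge> 0" unfolding c_def
    by (intro Henstock_Kurzweil_Integration.integral_nonneg integrable_continuous_real contS \<eta>)
  ultimately have "c > 0" by simp
  have "\<sigma> x = c" if "x \<ge> 1" for x
  proof -
    have "integral {-1..1} \<eta> + integral {1..x} \<eta> = integral {-1..x} \<eta>"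
      using that contS by (intro Henstock_Kurzweil_Integration.integral_combine integrable_continuous_real) auto
    moreover have "integral {1..x} \<eta> = integral {1..x} (\<lambda>_. 0)"
      by (rule integral_cong) (auto simp: \<eta>)
    ultimately show ?thesis using that by (simp add: \<sigma>_def c_def)
  qed
  then show ?thesis
    using \<eta> der \<open>c > 0\<close> by (intro exI[of _ \<sigma>] exI[of _ \<eta>] exI[of _ c]) (auto simp: \<sigma>_def)
qed

section \<open>Absolutely continuous functions and the chain rule\<close>

text \<open>Absolute continuity with a chosen density. The density is only determined up to null sets, and nothing is
said about pointwise derivatives; this is what a weak derivative of a function of one variable amounts to. The set
\<open>S\<close> is meant to be an interval.\<close>

definition primitive_on :: "real set \<Rightarrow> (real \<Rightarrow> real) \<Rightarrow> (real \<Rightarrow> real) \<Rightarrow> bool" where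
  "primitive_on S h d \<longleftrightarrow> (\<forall>s t. s \<le> t \<longrightarrow> {s..t} \<subseteq> S \<longrightarrow>
     d absolutely_integrable_on {s..t} \<and> integral {s..t} d = h t - h s)"

lemma primitive_onI:
  assumes "\<And>s t. s \<le> t \<Longrightarrow> {s..t} \<subseteq> S \<Longrightarrow> d absolutely_integrable_on {s..t}"
    and "\<And>s t. s \<le> t \<Longrightarrow> {s..t} \<subseteq> S \<Longrightarrow> integral {s..t} d = h t - h s"
  shows "primitive_on S h d"
  unfolding primitive_on_def by (intro allI impI conjI assms)

lemma primitive_onD:
  assumes "primitive_on S h d" "s \<le> t" "{s..t} \<subseteq> S"
  shows "d absolutely_integrable_on {s..t}" "d integrable_on {s..t}" "integral {s..t} d = h t - h s"
proof -
  show ai: "d absolutely_integrable_on {s..t}" and "integral {s..t} d = h t - h s"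
    using assms unfolding primitive_on_def by blast+
  show "d integrable_on {s..t}" by (rule set_lebesgue_integral_eq_integral(1)[OF ai])
qed

lemma primitive_on_subset: "primitive_on S h d \<Longrightarrow> T \<subseteq> S \<Longrightarrow> primitive_on T h d"
  unfolding primitive_on_def by blast

lemma primitive_on_continuous:
  assumes "primitive_on S h d" "{s..t} \<subseteq> S"
  shows "continuous_on {s..t} h"
proof (cases "s \<le> t")
  case True
  have "continuous_on {s..t} (\<lambda>x. h s + integral {s..x} d)"
    using primitive_onD[OF assms(1) True assms(2)]
    by (intro continuous_intros indefinite_integral_continuous_1)
  moreover have "h s + integral {s..x} d = h x" if "x \<in> {s..t}" for x
  proof -
    have "{s..x} \<subseteq> S" using that assms(2) by auto
    then show ?thesis using primitive_onD(3)[OF assms(1), of s x] that by simp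
  qed
  ultimately show ?thesis by (metis (no_types, lifting) continuous_on_cong)
qed simp

lemma primitive_on_UNIV_continuous:
  assumes "primitive_on UNIV h d" shows "continuous_on UNIV h"
proof -
  have "isCont h x" for x
  proof -
    have "continuous_on {x-1..x+1} h" using primitive_on_continuous[OF assms] by simp
    then show ?thesis
      by (rule continuous_on_interior) (simp add: interior_atLeastAtMost_real)
  qed
  then show ?thesis by (simp add: continuous_at_imp_continuous_on)
qed

lemma primitive_on_C1:
  assumes "\<And>x. x \<in> S \<Longrightarrow> (h has_real_derivative d x) (at x within S)" "continuous_on S d"
  shows "primitive_on S h d"
proof (rule primitive_onI)
  fix s t :: real assume st: "s \<le> t" "{s..t} \<subseteq> S"
  have c: "continuous_on {s..t} d" using assms(2) st continuous_on_subset by blast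
  then show "d absolutely_integrable_on {s..t}" by (rule absolutely_integrable_continuous_real)
  have "(d has_integral (h t - h s)) {s..t}"
  proof (rule fundamental_theorem_of_calculus[OF st(1)])
    fix x assume "x \<in> {s..t}"
    then have "(h has_real_derivative d x) (at x within {s..t})"
      using assms(1) st(2) DERIV_subset by blast
    then show "(h has_vector_derivative d x) (at x within {s..t})"
      by (simp add: has_real_derivative_iff_has_vector_derivative)
  qed
  then show "integral {s..t} d = h t - h s" by (rule integral_unique)
qed

lemma abs_integrable_cont_mult:
  fixes f g :: "real \<Rightarrow> real"
  assumes "continuous_on {s..t} f" "g absolutely_integrable_on {s..t}"
  shows "(\<lambda>x. f x * g x) absolutely_integrable_on {s..t}"
proof (rule absolutely_integrable_bounded_measurable_product_real[OF _ _ _ assms(2)])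
  show "f \<in> borel_measurable (lebesgue_on {s..t})"
    using assms(1) by (intro continuous_imp_measurable_on_sets_lebesgue) auto
  show "bounded (f ` {s..t})"
    using assms(1) compact_continuous_image compact_imp_bounded by blast
qed simp

lemma primitive_on_lin:
  assumes "primitive_on S h d" "primitive_on S k e"
  shows "primitive_on S (\<lambda>x. \<alpha> * h x + \<beta> * k x) (\<lambda>x. \<alpha> * d x + \<beta> * e x)"
proof (rule primitive_onI)
  fix s t :: real assume st: "s \<le> t" "{s..t} \<subseteq> S"
  note D = primitive_onD[OF assms(1) st] and E = primitive_onD[OF assms(2) st]
  show "(\<lambda>x. \<alpha> * d x + \<beta> * e x) absolutely_integrable_on {s..t}"
    using D E by (intro set_integral_add set_integrable_mult_right) auto
  have "integral {s..t} (\<lambda>x. \<alpha> * d x + \<beta> * e x) = \<alpha> * integral {s..t} d + \<beta> * integral {s..t} e"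
    using D E by (subst Henstock_Kurzweil_Integration.integral_add) (auto intro: integrable_on_mult_right)
  then show "integral {s..t} (\<lambda>x. \<alpha> * d x + \<beta> * e x) = \<alpha> * h t + \<beta> * k t - (\<alpha> * h s + \<beta> * k s)"
    using D E by (simp add: algebra_simps)
qed

lemma primitive_on_cong:
  assumes "primitive_on S h d" "\<And>x. x \<in> S \<Longrightarrow> h' x = h x" "\<And>x. x \<in> S \<Longrightarrow> d' x = d x"
  shows "primitive_on S h' d'"
proof (rule primitive_onI)
  fix s t :: real assume st: "s \<le> t" "{s..t} \<subseteq> S"
  note D = primitive_onD[OF assms(1) st]
  have eq: "d' x = d x" if "x \<in> {s..t}" for x using that st assms(3) by blast
  show "d' absolutely_integrable_on {s..t}"
    using D(1) eq by (metis (no_types, lifting) absolutely_integrable_spike DiffD1 negligible_empty)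
  have "h' t = h t" "h' s = h s" using st assms(2) by auto
  then show "integral {s..t} d' = h' t - h' s"
    using D(3) Henstock_Kurzweil_Integration.integral_cong[of "{s..t}" d' d, OF eq] by simp
qed

text \<open>On a short interval the mean value theorem for \<open>G\<close>, together with the intermediate value theorem for
\<open>h\<close>, writes the increment of \<open>G (h t)\<close> as the integral of \<open>g (h \<rho>) * d\<close> for a single
point \<open>\<rho>\<close>. Uniform continuity of \<open>g (h t)\<close> then bounds the error by a small multiple of the integral of
\<open>\<bar>d\<bar>\<close>. Such bounds are additive over adjacent intervals, so bisection extends them to \<open>{s..t}\<close>.\<close>

lemma primitive_on_chain_rule:
  assumes h: "primitive_on S h d"
    and G: "\<And>x. (G has_real_derivative g x) (at x)" and g: "continuous_on UNIV g"
  shows "primitive_on S (\<lambda>t. G (h t)) (\<lambda>t. g (h t) * d t)"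
proof (rule primitive_onI)
  fix s t :: real assume st: "s \<le> t" "{s..t} \<subseteq> S"
  have sub: "p \<le> q \<and> {p..q} \<subseteq> S" if "s \<le> p" "p \<le> q" "q \<le> t" for p q
    using that st by auto
  have ch: "continuous_on {s..t} h" using primitive_on_continuous[OF h st(2)] .
  have cg: "continuous_on {s..t} (\<lambda>x. g (h x))"
    by (rule continuous_on_compose2[OF g ch]) simp
  show ai: "(\<lambda>t. g (h t) * d t) absolutely_integrable_on {s..t}"
    by (rule abs_integrable_cont_mult[OF cg primitive_onD(1)[OF h st]])
  define W where "W p q = integral {p..q} (\<lambda>x. \<bar>d x\<bar>)" for p q
  define E where "E p q = G (h q) - G (h p) - integral {p..q} (\<lambda>t. g (h t) * d t)" for p q
  have intd: "(\<lambda>x. g (h x) * d x) integrable_on {p..q}" "(\<lambda>x. \<bar>d x\<bar>) integrable_on {p..q}"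
       "d integrable_on {p..q}"
    if "s \<le> p" "p \<le> q" "q \<le> t" for p q
  proof -
    show "(\<lambda>x. g (h x) * d x) integrable_on {p..q}"
      by (rule integrable_on_subinterval[OF set_lebesgue_integral_eq_integral(1)[OF ai]]) (use that in auto)
    show "d integrable_on {p..q}" using primitive_onD[OF h] sub[OF that] by blast
    have "d absolutely_integrable_on {p..q}" using primitive_onD[OF h] sub[OF that] by blast
    then show "(\<lambda>x. \<bar>d x\<bar>) integrable_on {p..q}"
      unfolding absolutely_integrable_on_def by simp
  qed
  have small: "\<bar>E s t\<bar> \<le> e * W s t" if e: "e > 0" for e
  proof -
    have "uniformly_continuous_on {s..t} (\<lambda>x. g (h x))"
      by (rule compact_uniformly_continuous[OF cg]) simp
    then obtain \<delta> where \<delta>: "\<delta> > 0"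
      "\<And>x x'. x \<in> {s..t} \<Longrightarrow> x' \<in> {s..t} \<Longrightarrow> dist x' x < \<delta> \<Longrightarrow> dist (g (h x')) (g (h x)) < e"
      using e unfolding uniformly_continuous_on_def by metis
    have "s \<le> s \<longrightarrow> t \<le> t \<longrightarrow> \<bar>E s t\<bar> \<le> e * W s t"
    proof (rule Bolzano[OF st(1), where P = "\<lambda>p q. s \<le> p \<longrightarrow> q \<le> t \<longrightarrow> \<bar>E p q\<bar> \<le> e * W p q"])
      fix p q r :: real
      assume 1: "s \<le> p \<longrightarrow> q \<le> t \<longrightarrow> \<bar>E p q\<bar> \<le> e * W p q"
        and 2: "s \<le> q \<longrightarrow> r \<le> t \<longrightarrow> \<bar>E q r\<bar> \<le> e * W q r" and pqr: "p \<le> q" "q \<le> r"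
      show "s \<le> p \<longrightarrow> r \<le> t \<longrightarrow> \<bar>E p r\<bar> \<le> e * W p r"
      proof (intro impI)
        assume b: "s \<le> p" "r \<le> t"
        have "W p r = W p q + W q r"
          unfolding W_def using intd(2)[of p r] pqr b
          by (intro Henstock_Kurzweil_Integration.integral_combine[symmetric]) auto
        moreover have "E p r = E p q + E q r"
          unfolding E_def
          using Henstock_Kurzweil_Integration.integral_combine[OF pqr intd(1)[of p r]] pqr b by auto
        ultimately show "\<bar>E p r\<bar> \<le> e * W p r"
          using 1 2 b pqr by (simp add: distrib_left)
      qed
    next
      fix x assume x: "s \<le> x" "x \<le> t"
      show "\<exists>\<delta>>0. \<forall>p q. p \<le> x \<and> x \<le> q \<and> q - p < \<delta> \<longrightarrow> s \<le> p \<longrightarrow> q \<le> t \<longrightarrow> \<bar>E p q\<bar> \<le> e * W p q"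
      proof (intro exI[of _ \<delta>] conjI allI impI)
        fix p q assume "p \<le> x \<and> x \<le> q \<and> q - p < \<delta>" and b: "s \<le> p" "q \<le> t"
        then have pq: "p \<le> q" "q - p < \<delta>" by auto
        have cpq: "continuous_on {p..q} h" using ch b continuous_on_subset by fastforce
        obtain \<rho> where \<rho>: "\<rho> \<in> {p..q}" "G (h q) - G (h p) = g (h \<rho>) * (h q - h p)"
        proof -
          have "\<exists>\<xi>. \<xi> \<in> closed_segment (h p) (h q) \<and> G (h q) - G (h p) = g \<xi> * (h q - h p)"
          proof (cases "h p" "h q" rule: linorder_cases)
            case less
            then obtain z where "h p < z" "z < h q" "G (h q) - G (h p) = (h q - h p) * g z"
              using MVT2[of "h p" "h q" G g] G by blast
            then show ?thesis
              by (intro exI[of _ z]) (auto simp: closed_segment_eq_real_ivl mult.commute)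
          next
            case greater
            then obtain z where "h q < z" "z < h p" "G (h p) - G (h q) = (h p - h q) * g z"
              using MVT2[of "h q" "h p" G g] G by blast
            then show ?thesis
              by (intro exI[of _ z]) (auto simp: closed_segment_eq_real_ivl algebra_simps)
          qed auto
          then obtain \<xi> where \<xi>: "\<xi> \<in> closed_segment (h p) (h q)" "G (h q) - G (h p) = g \<xi> * (h q - h p)"
            by blast
          have "convex (h ` {p..q})"
            using cpq connected_continuous_image convex_connected convex_real_interval(5)
            by (metis is_interval_connected_1 is_interval_convex_1)
          then have "closed_segment (h p) (h q) \<subseteq> h ` {p..q}"
            using pq by (intro closed_segment_subset) auto
          then show thesis using \<xi> that by blast
        qed
        have "E p q = g (h \<rho>) * integral {p..q} d - integral {p..q} (\<lambda>t. g (h t) * d t)"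
          using \<rho>(2) primitive_onD(3)[OF h] sub[OF b(1) pq(1) b(2)] by (simp add: E_def)
        also have "\<dots> = integral {p..q} (\<lambda>t. g (h \<rho>) * d t - g (h t) * d t)"
          using intd[OF b(1) pq(1) b(2)]
          by (subst Henstock_Kurzweil_Integration.integral_diff) (auto intro: integrable_on_mult_right)
        finally have "E p q = integral {p..q} (\<lambda>t. g (h \<rho>) * d t - g (h t) * d t)" .
        also have "norm \<dots> \<le> integral {p..q} (\<lambda>t. e * \<bar>d t\<bar>)"
        proof (rule integral_norm_bound_integral)
          fix r assume r: "r \<in> {p..q}"
          have "dist (g (h \<rho>)) (g (h r)) < e"
            using \<rho>(1) r pq b by (intro \<delta>(2)) (auto simp: dist_real_def)
          then have "\<bar>g (h \<rho>) - g (h r)\<bar> * \<bar>d r\<bar> \<le> e * \<bar>d r\<bar>"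
            by (intro mult_right_mono) (auto simp: dist_real_def)
          then show "norm (g (h \<rho>) * d r - g (h r) * d r) \<le> e * \<bar>d r\<bar>"
            by (simp add: abs_mult[symmetric] left_diff_distrib)
        qed (use intd[OF b(1) pq(1) b(2)] in \<open>auto intro!: integrable_on_mult_right Henstock_Kurzweil_Integration.integrable_diff\<close>)
        finally show "\<bar>E p q\<bar> \<le> e * W p q" by (simp add: W_def)
      qed (rule \<delta>(1))
    qed
    then show ?thesis by simp
  qed
  have W0: "W s t \<ge> 0"
    unfolding W_def using intd st by (intro Henstock_Kurzweil_Integration.integral_nonneg) auto
  have "\<bar>E s t\<bar> \<le> e" if "e > 0" for e
  proof -
    \<comment> \<open>Adding 1 avoids division by zero when the density vanishes almost everywhere on the interval.\<close>
    have "\<bar>E s t\<bar> \<le> e / (W s t + 1) * W s t" using W0 that by (intro small) auto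
    also have "\<dots> \<le> e" using W0 that by (simp add: field_simps)
    finally show ?thesis .
  qed
  then have "\<bar>E s t\<bar> \<le> 0 + e" if "e > 0" for e using that by (metis add_0)
  then have "\<bar>E s t\<bar> \<le> 0" by (rule field_le_epsilon)
  then have "E s t = 0" by simp
  then show "integral {s..t} (\<lambda>t. g (h t) * d t) = G (h t) - G (h s)" by (simp add: E_def)
qed

text \<open>Polarization: the chain rule is applied to the squares of \<open>h + k\<close> and \<open>h - k\<close>.\<close>

lemma primitive_on_mult:
  assumes "primitive_on S h d" "primitive_on S k e"
  shows "primitive_on S (\<lambda>t. h t * k t) (\<lambda>t. h t * e t + d t * k t)"
proof -
  have sq: "((\<lambda>x. x\<^sup>2) has_real_derivative 2 * x) (at x)" for x :: real
    by (auto intro!: derivative_eq_intros)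
  have c: "continuous_on UNIV (\<lambda>x::real. 2 * x)" by (intro continuous_intros)
  have 1: "primitive_on S (\<lambda>x. 1 * h x + 1 * k x) (\<lambda>x. 1 * d x + 1 * e x)"
    by (rule primitive_on_lin[OF assms])
  have 2: "primitive_on S (\<lambda>x. 1 * h x + (-1) * k x) (\<lambda>x. 1 * d x + (-1) * e x)"
    by (rule primitive_on_lin[OF assms])
  note 3 = primitive_on_lin[OF primitive_on_chain_rule[OF 1 sq c] primitive_on_chain_rule[OF 2 sq c], of "1/4" "-1/4"]
  show ?thesis by (rule primitive_on_cong[OF 3]) (auto simp: power2_eq_square field_simps)
qed

lemma lebesgue_integral_compact_support:
  fixes f :: "real \<Rightarrow> real"
  assumes "f absolutely_integrable_on {-R..R}" "\<And>x. x \<notin> {-R..R} \<Longrightarrow> f x = 0"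
  shows "integrable lebesgue f" "(\<integral>x. f x \<partial>lebesgue) = integral {-R..R} f"
proof -
  have "indicator {-R..R} x *\<^sub>R f x = f x" for x
    using assms(2)[of x] by (cases "x \<in> {-R..R}") simp_all
  then have eq: "(\<lambda>x. indicator {-R..R} x *\<^sub>R f x) = f" by (rule ext)
  show "integrable lebesgue f" using assms(1) unfolding set_integrable_def eq .
  show "(\<integral>x. f x \<partial>lebesgue) = integral {-R..R} f"
    using set_lebesgue_integral_eq_integral(2)[OF assms(1)] unfolding set_lebesgue_integral_def eq .
qed

text \<open>The product rule on an interval that contains the support, where the boundary terms vanish. It is
stated for continuously differentiable functions in order to cover sections of test functions of the plane and their products
with cutoffs.\<close>

lemma integration_by_parts_compact_support:
  assumes h: "primitive_on UNIV h d"
    and \<psi>: "\<And>x. (\<psi> has_real_derivative \<psi>' x) (at x)" "continuous_on UNIV \<psi>'"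
    and supp: "\<And>x. R \<le> \<bar>x\<bar> \<Longrightarrow> \<psi> x = 0" "\<And>x. R \<le> \<bar>x\<bar> \<Longrightarrow> \<psi>' x = 0"
  shows "(\<integral>x. h x * \<psi>' x \<partial>lebesgue) = - (\<integral>x. d x * \<psi> x \<partial>lebesgue)"
proof -
  define r where "r = \<bar>R\<bar>"
  have out: "\<psi> x = 0" "\<psi>' x = 0" if "x \<notin> {-r..r}" for x
    using that supp[of x] by (auto simp: r_def)
  have r0: "r \<ge> 0" "\<psi> r = 0" "\<psi> (-r) = 0" using supp by (auto simp: r_def)
  have P: "primitive_on UNIV \<psi> \<psi>'" using primitive_on_C1[of UNIV] \<psi> by simp
  have ch: "continuous_on {-r..r} h" using primitive_on_continuous[OF h] by simp
  have cp: "continuous_on {-r..r} \<psi>" "continuous_on {-r..r} \<psi>'"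
    using primitive_on_continuous[OF P] continuous_on_subset[OF \<psi>(2)] by simp_all
  have dd: "d absolutely_integrable_on {-r..r}" using primitive_onD(1)[OF h] r0 by simp
  have a1: "(\<lambda>x. h x * \<psi>' x) absolutely_integrable_on {-r..r}"
    by (intro absolutely_integrable_continuous_real continuous_intros ch cp)
  have a2: "(\<lambda>x. d x * \<psi> x) absolutely_integrable_on {-r..r}"
    using abs_integrable_cont_mult[OF cp(1) dd] by (simp add: mult.commute)
  have "integral {-r..r} (\<lambda>t. h t * \<psi>' t + d t * \<psi> t) = 0"
    using primitive_onD(3)[OF primitive_on_mult[OF h P], of "-r" r] r0 by simp
  moreover have "integral {-r..r} (\<lambda>t. h t * \<psi>' t + d t * \<psi> t)
      = integral {-r..r} (\<lambda>x. h x * \<psi>' x) + integral {-r..r} (\<lambda>x. d x * \<psi> x)"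
    using a1 a2 by (intro Henstock_Kurzweil_Integration.integral_add set_lebesgue_integral_eq_integral(1))
  moreover have "(\<integral>x. h x * \<psi>' x \<partial>lebesgue) = integral {-r..r} (\<lambda>x. h x * \<psi>' x)"
    by (rule lebesgue_integral_compact_support(2)[OF a1]) (simp add: out)
  moreover have "(\<integral>x. d x * \<psi> x \<partial>lebesgue) = integral {-r..r} (\<lambda>x. d x * \<psi> x)"
    by (rule lebesgue_integral_compact_support(2)[OF a2]) (simp add: out)
  ultimately show ?thesis by linarith
qed

lemma primitive_on_AE_cong:
  assumes "primitive_on S h d" "AE x in lebesgue. d' x = d x"
  shows "primitive_on S h d'"
proof (rule primitive_onI)
  fix s t :: real assume st: "s \<le> t" "{s..t} \<subseteq> S"
  note D = primitive_onD[OF assms(1) st]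
  obtain N where N: "N \<in> null_sets lebesgue" "\<And>x. x \<notin> N \<Longrightarrow> d' x = d x"
    using assms(2) unfolding completion.AE_iff_null_sets by auto
  have neg: "negligible N" using N(1) by (simp add: negligible_iff_null_sets)
  show "d' absolutely_integrable_on {s..t}"
    by (rule absolutely_integrable_spike[OF D(1) neg]) (simp add: N(2))
  have "integral {s..t} d' = integral {s..t} d"
    by (rule integral_spike[OF neg]) (simp add: N(2))
  then show "integral {s..t} d' = h t - h s" using D(3) by simp
qed

lemma primitive_on_halves:
  assumes "primitive_on {0..} h d" "primitive_on {..0} h d"
  shows "primitive_on UNIV h d"
proof (rule primitive_onI)
  fix s t :: real assume st: "s \<le> t"
  consider "s \<ge> 0" | "t \<le> 0" | "s < 0" "0 < t" by linarith
  then have "d absolutely_integrable_on {s..t} \<and> integral {s..t} d = h t - h s"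
  proof cases
    case 1
    then show ?thesis using primitive_onD[OF assms(1) st] by auto
  next
    case 2
    then show ?thesis using primitive_onD[OF assms(2) st] by auto
  next
    case 3
    have L: "d absolutely_integrable_on {s..0}" "d integrable_on {s..0}" "integral {s..0} d = h 0 - h s"
      using primitive_onD[OF assms(2), of s 0] 3 by auto
    have R: "d absolutely_integrable_on {0..t}" "d integrable_on {0..t}" "integral {0..t} d = h t - h 0"
      using primitive_onD[OF assms(1), of 0 t] 3 by auto
    have ai: "d absolutely_integrable_on {s..t}"
      by (rule absolutely_integrable_on_combine[OF L(1) R(1)]) (use 3 in auto)
    have "integral {s..0} d + integral {0..t} d = integral {s..t} d"
      by (rule Henstock_Kurzweil_Integration.integral_combine)
         (use 3 set_lebesgue_integral_eq_integral(1)[OF ai] in auto)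
    then show ?thesis using ai L R by simp
  qed
  then show "d absolutely_integrable_on {s..t}" "integral {s..t} d = h t - h s" by auto
qed

lemma primitive_on_glue:
  assumes "primitive_on {0..} h1 d1" "primitive_on {..0} h2 d2" "h1 0 = h2 0"
  shows "primitive_on UNIV (\<lambda>x. if 0 \<le> x then h1 x else h2 x) (\<lambda>x. if 0 \<le> x then d1 x else d2 x)"
proof (rule primitive_on_halves)
  show "primitive_on {0..} (\<lambda>x. if 0 \<le> x then h1 x else h2 x) (\<lambda>x. if 0 \<le> x then d1 x else d2 x)"
    by (rule primitive_on_cong[OF assms(1)]) auto
  have "{0::real} \<in> null_sets lebesgue" by (simp flip: negligible_iff_null_sets)
  then have "AE x in lebesgue. (if x = 0 then d1 0 else d2 x) = d2 x"
    by (rule AE_I') auto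
  from primitive_on_AE_cong[OF assms(2) this]
  show "primitive_on {..0} (\<lambda>x. if 0 \<le> x then h1 x else h2 x) (\<lambda>x. if 0 \<le> x then d1 x else d2 x)"
    by (rule primitive_on_cong) (use assms(3) in auto)
qed

lemma primitive_on_reflect:
  assumes "primitive_on S h d"
  shows "primitive_on {x. - x \<in> S} (\<lambda>x. h (- x)) (\<lambda>x. - d (- x))"
proof (rule primitive_onI)
  fix s t :: real assume st: "s \<le> t" "{s..t} \<subseteq> {x. - x \<in> S}"
  have sub: "{-t..-s} \<subseteq> S"
  proof
    fix x assume "x \<in> {-t..-s}"
    then have "-x \<in> {s..t}" by auto
    then show "x \<in> S" using st(2) by fastforce
  qed
  note D = primitive_onD[OF assms _ sub]
  have "(\<lambda>x. d (- x)) absolutely_integrable_on {- (-s).. - (-t)}"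
    by (subst absolutely_integrable_reflect_real) (use D(1) st in simp)
  then show "(\<lambda>x. - d (- x)) absolutely_integrable_on {s..t}"
    using set_integrable_mult_right[of "-1" lebesgue "{s..t}" "\<lambda>x. d (-x)"] by simp
  have "integral {- (-s).. - (-t)} (\<lambda>x. d (- x)) = integral {-t..-s} d"
    by (rule Henstock_Kurzweil_Integration.integral_reflect_real)
  then show "integral {s..t} (\<lambda>x. - d (- x)) = h (- t) - h (- s)"
    using D(3) st by simp
qed

text \<open>The factor \<open>r\<close> may have either sign; negative factors are reduced to positive ones by reflection.\<close>

lemma primitive_on_affine:
  assumes "primitive_on UNIV h d"
  shows "primitive_on UNIV (\<lambda>t. h (c + r * t)) (\<lambda>t. r * d (c + r * t))"
proof -
  have pos: "primitive_on UNIV (\<lambda>t. h (c + r * t)) (\<lambda>t. r * d (c + r * t))" if r: "r > 0" for r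
  proof (rule primitive_onI)
    fix s t :: real assume "s \<le> t"
    then have st: "c + r * s \<le> c + r * t" using r by simp
    note D = primitive_onD[OF assms st]
    have aff: "((\<lambda>x. f (c + r * x)) has_integral (integral {c + r * s..c + r * t} f / r)) {s..t}"
      if "f integrable_on {c + r * s..c + r * t}" for f :: "real \<Rightarrow> real"
    proof -
      have eqs: "(c + r * s - c) /\<^sub>R r = s" "(c + r * t - c) /\<^sub>R r = t" using r by auto
      have "((\<lambda>x. f (r *\<^sub>R x + c)) has_integral (integral {c + r * s..c + r * t} f /\<^sub>R r ^ DIM(real)))
           (cbox ((c + r * s - c) /\<^sub>R r) ((c + r * t - c) /\<^sub>R r))"
        by (rule has_integral_affinity'[OF _ r]) (use that in \<open>simp add: integrable_integral\<close>)
      from this[unfolded eqs] show ?thesis by (simp add: add.commute divide_inverse mult.commute)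
    qed
    have "(\<lambda>x. d (c + r * x)) absolutely_integrable_on {s..t}"
      using aff[of d] aff[of "\<lambda>x. norm (d x)"] D(1,2)
      unfolding absolutely_integrable_on_def by (auto simp: integrable_on_def)
    then show "(\<lambda>t. r * d (c + r * t)) absolutely_integrable_on {s..t}"
      by (rule set_integrable_mult_right)
    show "integral {s..t} (\<lambda>t. r * d (c + r * t)) = h (c + r * t) - h (c + r * s)"
      using integral_unique[OF aff[of d]] D r by simp
  qed
  consider "r > 0" | "r = 0" | "r < 0" by linarith
  then show ?thesis
  proof cases
    case 1
    then show ?thesis by (rule pos)
  next
    case 2
    then show ?thesis by (intro primitive_onI) auto
  next
    case 3
    have "primitive_on UNIV (\<lambda>t. h (c + (-r) * (-t))) (\<lambda>t. - ((-r) * d (c + (-r) * (-t))))"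
      using primitive_on_reflect[OF pos[of "-r"]] 3 by simp
    then show ?thesis by simp
  qed
qed

lemma primitive_exists:
  assumes d: "\<And>s t. d absolutely_integrable_on {s..t}"
  shows "\<exists>h. primitive_on UNIV h d \<and> h 0 = 0"
proof -
  define h where "h t = (if 0 \<le> t then integral {0..t} d else - integral {t..0} d)" for t
  have int: "d integrable_on {s..t}" for s t
    by (rule set_lebesgue_integral_eq_integral(1)[OF d])
  have "primitive_on UNIV h d"
  proof (rule primitive_on_halves; rule primitive_onI)
    fix s t :: real assume st: "s \<le> t" "{s..t} \<subseteq> {0..}"
    then have "integral {0..s} d + integral {s..t} d = integral {0..t} d"
      by (intro Henstock_Kurzweil_Integration.integral_combine int) auto
    then show "integral {s..t} d = h t - h s" using st by (auto simp: h_def)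
  next
    fix s t :: real assume st: "s \<le> t" "{s..t} \<subseteq> {..0}"
    then have "integral {s..t} d + integral {t..0} d = integral {s..0} d"
      by (intro Henstock_Kurzweil_Integration.integral_combine int) auto
    then show "integral {s..t} d = h t - h s" using st by (auto simp: h_def)
  qed (rule d)+
  then show ?thesis by (intro exI[of _ h]) (auto simp: h_def)
qed

section \<open>Locally square integrable functions\<close>

lemma L2_loc_dominated:
  fixes f g h :: "'a::euclidean_space \<Rightarrow> real"
  assumes "f \<in> L2_loc" "g \<in> L2_loc" "h \<in> borel_measurable lebesgue"
    and bd: "\<And>x. (h x)\<^sup>2 \<le> C * ((f x)\<^sup>2 + (g x)\<^sup>2)"
  shows "h \<in> L2_loc"
proof -
  have "set_integrable lebesgue K (\<lambda>x. (h x)\<^sup>2)" if K: "compact K" for K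
  proof (rule set_integrable_bound)
    show "set_integrable lebesgue K (\<lambda>x. C * ((f x)\<^sup>2 + (g x)\<^sup>2))"
      using assms(1,2) K by (intro set_integrable_mult_right set_integral_add) (auto simp: L2_loc_def)
    have "K \<in> sets lebesgue" using K by (simp add: compact_imp_closed)
    then show "set_borel_measurable lebesgue K (\<lambda>x. (h x)\<^sup>2)"
      unfolding set_borel_measurable_def
      by (intro borel_measurable_scaleR borel_measurable_indicator borel_measurable_power assms(3))
    show "AE x in lebesgue. x \<in> K \<longrightarrow> norm ((h x)\<^sup>2) \<le> norm (C * ((f x)\<^sup>2 + (g x)\<^sup>2))"
    proof (intro AE_I2 impI)
      fix x
      have "norm ((h x)\<^sup>2) = (h x)\<^sup>2" by simp
      also have "\<dots> \<le> norm (C * ((f x)\<^sup>2 + (g x)\<^sup>2))"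
        by (rule order_trans[OF bd]) simp
      finally show "norm ((h x)\<^sup>2) \<le> norm (C * ((f x)\<^sup>2 + (g x)\<^sup>2))" .
    qed
  qed
  then show ?thesis using assms(3) by (simp add: L2_loc_def)
qed

lemma L2_loc_continuous:
  fixes f :: "'a::euclidean_space \<Rightarrow> real"
  assumes "continuous_on UNIV f" shows "f \<in> L2_loc"
proof -
  have "f \<in> borel_measurable lebesgue"
    by (rule measurable_completion) (simp add: borel_measurable_continuous_onI[OF assms])
  moreover have "set_integrable lebesgue K (\<lambda>x. (f x)\<^sup>2)" if K: "compact K" for K
  proof -
    have "bounded ((\<lambda>x. (f x)\<^sup>2) ` K)"
      using K by (intro compact_imp_bounded compact_continuous_image continuous_intros continuous_on_subset[OF assms]) auto
    then obtain M where M: "\<And>x. x \<in> K \<Longrightarrow> norm ((f x)\<^sup>2) \<le> M" by (auto simp: bounded_iff)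
    have Km: "K \<in> lmeasurable" by (rule lmeasurable_compact[OF K])
    show ?thesis
    proof (rule set_integrable_bound[where f = "\<lambda>x. M"])
      show "set_integrable lebesgue K (\<lambda>x. M)"
        unfolding set_integrable_def using Km by (auto simp: lmeasurable_iff_integrable)
      show "set_borel_measurable lebesgue K (\<lambda>x. (f x)\<^sup>2)"
        unfolding set_borel_measurable_def using Km \<open>f \<in> borel_measurable lebesgue\<close>
        by (intro borel_measurable_scaleR borel_measurable_indicator borel_measurable_power) auto
      show "AE x in lebesgue. x \<in> K \<longrightarrow> norm ((f x)\<^sup>2) \<le> norm M"
        using M by (intro AE_I2) force
    qed
  qed
  ultimately show ?thesis by (simp add: L2_loc_def)
qed

lemma L2_loc_lin:
  fixes f g :: "'a::euclidean_space \<Rightarrow> real"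
  assumes "f \<in> L2_loc" "g \<in> L2_loc"
  shows "(\<lambda>x. \<alpha> * f x + \<beta> * g x) \<in> L2_loc"
proof (rule L2_loc_dominated[OF assms, where C = "\<alpha>\<^sup>2 + \<beta>\<^sup>2"])
  have "f \<in> borel_measurable lebesgue" "g \<in> borel_measurable lebesgue"
    using assms by (simp_all add: L2_loc_def)
  then show "(\<lambda>x. \<alpha> * f x + \<beta> * g x) \<in> borel_measurable lebesgue" by measurable
  fix x
  have "0 \<le> (\<alpha> * g x - \<beta> * f x)\<^sup>2" by simp
  then show "(\<alpha> * f x + \<beta> * g x)\<^sup>2 \<le> (\<alpha>\<^sup>2 + \<beta>\<^sup>2) * ((f x)\<^sup>2 + (g x)\<^sup>2)"
    by (simp add: power2_eq_square algebra_simps)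
qed

lemma L2_loc_cmult:
  fixes f :: "real \<Rightarrow> real"
  assumes "f \<in> L2_loc" shows "(\<lambda>x. c * f x) \<in> L2_loc"
  using L2_loc_lin[OF assms assms, of c 0] by simp

lemma L2_loc_If:
  fixes f g :: "'a::euclidean_space \<Rightarrow> real"
  assumes "f \<in> L2_loc" "g \<in> L2_loc" "{x. P x} \<in> sets lebesgue"
  shows "(\<lambda>x. if P x then f x else g x) \<in> L2_loc"
proof (rule L2_loc_dominated[OF assms(1,2), where C = 1])
  show "(\<lambda>x. if P x then f x else g x) \<in> borel_measurable lebesgue"
    by (rule measurable_If) (use assms in \<open>simp_all add: L2_loc_def\<close>)
qed auto

lemma L2_loc_glue:
  fixes f g :: "real \<Rightarrow> real"
  assumes "f \<in> L2_loc" "g \<in> L2_loc"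
  shows "(\<lambda>x. if 0 \<le> x then f x else g x) \<in> L2_loc"
proof (rule L2_loc_If[OF assms])
  have "{x::real. 0 \<le> x} = {0..}" by auto
  then show "{x::real. 0 \<le> x} \<in> sets lebesgue" by simp
qed

lemma L2_loc_realI:
  fixes f :: "real \<Rightarrow> real"
  assumes "f \<in> borel_measurable lebesgue" "\<And>R. (\<lambda>x. (f x)\<^sup>2) absolutely_integrable_on {-R..R}"
  shows "f \<in> L2_loc"
proof -
  have "(\<lambda>x. (f x)\<^sup>2) absolutely_integrable_on K" if K: "compact K" for K
  proof -
    obtain R where "K \<subseteq> cball 0 R" using compact_imp_bounded[OF K] by (auto simp: bounded_iff subset_iff)
    then have "K \<subseteq> {-R..R}" by (simp add: cball_eq_atLeastAtMost)
    then show ?thesis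
      by (rule set_integrable_subset[OF assms(2), rotated]) (use K in \<open>auto simp: compact_imp_closed\<close>)
  qed
  then show ?thesis using assms(1) by (simp add: L2_loc_def)
qed

lemma L2_locD:
  fixes f :: "real \<Rightarrow> real"
  assumes "f \<in> L2_loc"
  shows "f \<in> borel_measurable lebesgue" "(\<lambda>x. (f x)\<^sup>2) absolutely_integrable_on {s..t}"
    "f \<in> borel_measurable (lebesgue_on S)"
proof -
  show m: "f \<in> borel_measurable lebesgue" using assms by (simp add: L2_loc_def)
  show "(\<lambda>x. (f x)\<^sup>2) absolutely_integrable_on {s..t}" using assms by (simp add: L2_loc_def)
  show "f \<in> borel_measurable (lebesgue_on S)" by (rule measurable_restrict_space1[OF m])
qed

lemma L2_loc_mult_integrable:
  fixes f g :: "real \<Rightarrow> real"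
  assumes "f \<in> L2_loc" "g \<in> L2_loc"
  shows "(\<lambda>x. f x * g x) absolutely_integrable_on {s..t}"
proof (rule measurable_bounded_by_integrable_imp_absolutely_integrable)
  show "(\<lambda>x. f x * g x) \<in> borel_measurable (lebesgue_on {s..t})"
    using L2_locD(3)[OF assms(1)] L2_locD(3)[OF assms(2)] by measurable
  show "(\<lambda>x. (f x)\<^sup>2 + (g x)\<^sup>2) integrable_on {s..t}"
    using L2_locD(2)[OF assms(1)] L2_locD(2)[OF assms(2)]
    by (intro Henstock_Kurzweil_Integration.integrable_add set_lebesgue_integral_eq_integral(1))
  show "norm (f x * g x) \<le> (f x)\<^sup>2 + (g x)\<^sup>2" for x
  proof -
    have "2 * \<bar>f x\<bar> * \<bar>g x\<bar> \<le> (f x)\<^sup>2 + (g x)\<^sup>2"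
      using sum_squares_bound[of "\<bar>f x\<bar>" "\<bar>g x\<bar>"] by simp
    moreover have "0 \<le> \<bar>f x\<bar> * \<bar>g x\<bar>" by simp
    ultimately show ?thesis unfolding real_norm_def abs_mult by linarith
  qed
qed auto

lemma L2_loc_integrable:
  fixes f :: "real \<Rightarrow> real"
  assumes "f \<in> L2_loc" shows "f absolutely_integrable_on {s..t}"
  using L2_loc_mult_integrable[OF assms L2_loc_continuous[of "\<lambda>x. 1"]] by simp

lemma L2_loc_affine:
  fixes f :: "real \<Rightarrow> real"
  assumes "f \<in> L2_loc" "r \<noteq> 0"
  shows "(\<lambda>x. f (c + r * x)) \<in> L2_loc"
proof (rule L2_loc_realI)
  show "(\<lambda>x. f (c + r * x)) \<in> borel_measurable lebesgue"
    using borel_measurable_affine[OF L2_locD(1)[OF assms(1)] assms(2)] by simp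
  obtain h where h: "primitive_on UNIV h (\<lambda>x. (f x)\<^sup>2)"
    using primitive_exists[of "\<lambda>x. (f x)\<^sup>2"] L2_locD(2)[OF assms(1)] by blast
  fix R :: real
  have "(\<lambda>x. r * (f (c + r * x))\<^sup>2) absolutely_integrable_on {-R..R}"
  proof (cases "R \<ge> 0")
    case True
    then show ?thesis using primitive_onD(1)[OF primitive_on_affine[OF h, of c r], of "-R" R] by simp
  qed (simp add: set_integrable_def)
  then have "(\<lambda>x. (1/r) * (r * (f (c + r * x))\<^sup>2)) absolutely_integrable_on {-R..R}"
    by (rule set_integrable_mult_right)
  then show "(\<lambda>x. (f (c + r * x))\<^sup>2) absolutely_integrable_on {-R..R}"
    using assms(2) by simp
qed

text \<open>Composition of a merely Lebesgue measurable density with a map from the plane to the line raises measurability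
questions, which a Borel representative avoids.\<close>

lemma primitive_borel_representative:
  assumes "primitive_on UNIV h d" "d \<in> L2_loc"
  obtains e where "primitive_on UNIV h e" "e \<in> L2_loc" "e \<in> borel_measurable borel"
proof -
  obtain e where e: "e \<in> borel_measurable lborel" "AE x in lborel. d x = e x"
    using completion_ex_borel_measurable_real[OF L2_locD(1)[OF assms(2)]] by blast
  have ae: "AE x in lebesgue. e x = d x"
    using AE_completion[OF e(2)] by eventually_elim simp
  have p: "primitive_on UNIV h e" by (rule primitive_on_AE_cong[OF assms(1) ae])
  have "e \<in> L2_loc"
  proof (rule L2_loc_realI)
    show m[measurable]: "e \<in> borel_measurable lebesgue" using e(1) by (rule measurable_completion)
    show "(\<lambda>x. (e x)\<^sup>2) absolutely_integrable_on {-R..R}" for R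
      using L2_locD(2)[OF assms(2), of "-R" R] unfolding set_integrable_def
    proof (rule integrable_cong_AE_imp)
      show "AE x in lebesgue. indicator {-R..R} x *\<^sub>R (d x)\<^sup>2 = indicator {-R..R} x *\<^sub>R (e x)\<^sup>2"
        using ae by eventually_elim simp
      show "(\<lambda>x. indicator {-R..R} x *\<^sub>R (e x)\<^sup>2) \<in> borel_measurable lebesgue"
        by (intro borel_measurable_scaleR borel_measurable_indicator borel_measurable_power m) simp
    qed
  qed
  then show thesis using that p e(1) by simp
qed

lemma primitive_of_L2_exists:
  assumes "d \<in> L2_loc" shows "\<exists>h. primitive_on UNIV h d \<and> h 0 = 0"
  by (rule primitive_exists[OF L2_loc_integrable[OF assms]])

section \<open>Weak derivatives on the line\<close>

lemma primitive_on_DERIV_within: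
  assumes "primitive_on S h d" "{a..b} \<subseteq> S" "continuous_on {a..b} d" "t \<in> {a..b}"
  shows "(h has_real_derivative d t) (at t within {a..b})"
proof -
  have "((\<lambda>x. integral {a..x} d) has_real_derivative d t) (at t within {a..b})"
    by (rule integral_has_real_derivative[OF assms(3,4)])
  then have "((\<lambda>x. h a + integral {a..x} d) has_real_derivative d t) (at t within {a..b})"
    by (auto intro!: derivative_eq_intros)
  then show ?thesis
  proof (rule has_field_derivative_transform_within[where d = 1])
    show "h a + integral {a..x} d = h x" if "x \<in> {a..b}" for x
    proof -
      have "{a..x} \<subseteq> S" using that assms(2) by auto
      then show ?thesis using primitive_onD(3)[OF assms(1), of a x] that by simp
    qed
  qed (use assms(4) in simp_all)
qed

lemma primitive_on_DERIV:
  assumes "primitive_on UNIV h d" "continuous_on UNIV d"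
  shows "(h has_real_derivative d t) (at t)"
proof -
  have "(h has_real_derivative d t) (at t within {t-1..t+1})"
    by (rule primitive_on_DERIV_within[OF assms(1)]) (use continuous_on_subset[OF assms(2)] in auto)
  then show ?thesis
    by (subst (asm) at_within_interior) (auto simp: interior_atLeastAtMost_real)
qed

lemma test_functions_realI:
  fixes \<phi> :: "real \<Rightarrow> real"
  assumes "\<And>k. Ck k \<phi>" "\<And>x. R \<le> \<bar>x\<bar> \<Longrightarrow> \<phi> x = 0"
  shows "\<phi> \<in> test_functions UNIV"
proof -
  have "{x. \<phi> x \<noteq> 0} \<subseteq> cball 0 R"
    using assms(2) by (force simp: dist_real_def)
  then have "bounded {x. \<phi> x \<noteq> 0}" using bounded_cball bounded_subset by blast
  then have "compact (closure {x. \<phi> x \<noteq> 0})" by (simp add: compact_closure)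
  then show ?thesis using assms(1) by (simp add: test_functions_def)
qed

lemma test_function_bounded_support:
  assumes "\<phi> \<in> test_functions \<Omega>"
  shows "\<exists>R. \<forall>x. R \<le> norm x \<longrightarrow> \<phi> x = 0"
proof -
  have "bounded {x. \<phi> x \<noteq> 0}"
    using assms by (simp add: test_functions_def compact_closure)
  then obtain R where "\<And>x. \<phi> x \<noteq> 0 \<Longrightarrow> norm x \<le> R" by (auto simp: bounded_iff)
  then show ?thesis by (intro exI[of _ "R + 1"]) force
qed

lemma dir_deriv_outside_support:
  assumes "x \<notin> closure {x. \<phi> x \<noteq> 0}"
  shows "dir_deriv b \<phi> x = 0"
proof -
  have "(\<phi> has_derivative (\<lambda>h. 0)) (at x)"
  proof (rule has_derivative_transform_within_open)
    show "((\<lambda>x. 0) has_derivative (\<lambda>h. 0)) (at x)" by simp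
    show "open (- closure {x. \<phi> x \<noteq> 0})" by (simp add: open_Compl)
    show "x \<in> - closure {x. \<phi> x \<noteq> 0}" using assms by simp
    show "0 = \<phi> y" if "y \<in> - closure {x. \<phi> x \<noteq> 0}" for y
      using that closure_subset[of "{x. \<phi> x \<noteq> 0}"] by auto
  qed
  then have "frechet_derivative \<phi> (at x) = (\<lambda>h. 0)" by (metis frechet_derivative_at)
  then show ?thesis by (simp add: dir_deriv_def)
qed

lemma dir_deriv_test_function:
  assumes \<phi>: "\<phi> \<in> test_functions \<Omega>" and b: "b \<in> Basis"
  shows "dir_deriv b \<phi> \<in> test_functions \<Omega>"
proof -
  have "Ck k (dir_deriv b \<phi>)" for k
    using \<phi> b by (simp add: test_functions_def) (metis Ck.simps(2))
  moreover have "{x. dir_deriv b \<phi> x \<noteq> 0} \<subseteq> closure {x. \<phi> x \<noteq> 0}"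
    using dir_deriv_outside_support by blast
  then have "closure {x. dir_deriv b \<phi> x \<noteq> 0} \<subseteq> closure {x. \<phi> x \<noteq> 0}"
    by (simp add: closure_minimal)
  moreover from this have "compact (closure {x. dir_deriv b \<phi> x \<noteq> 0})"
    using \<phi> compact_Int_closed[of "closure {x. \<phi> x \<noteq> 0}" "closure {x. dir_deriv b \<phi> x \<noteq> 0}"]
    by (simp add: test_functions_def Int_absorb1)
  ultimately show ?thesis using \<phi> by (auto simp: test_functions_def)
qed

lemma test_function_real:
  fixes \<phi> :: "real \<Rightarrow> real"
  assumes "\<phi> \<in> test_functions UNIV"
  shows "(\<phi> has_real_derivative dir_deriv 1 \<phi> x) (at x)" and "continuous_on S (dir_deriv 1 \<phi>)"
    and "\<exists>R\<ge>0. \<forall>x. R \<le> \<bar>x\<bar> \<longrightarrow> \<phi> x = 0 \<and> dir_deriv 1 \<phi> x = 0"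
proof -
  have ck: "Ck k \<phi>" for k using assms by (simp add: test_functions_def)
  have t': "dir_deriv 1 \<phi> \<in> test_functions UNIV" by (rule dir_deriv_test_function[OF assms]) simp
  obtain R1 where R1: "\<forall>x. R1 \<le> norm x \<longrightarrow> \<phi> x = 0" using test_function_bounded_support[OF assms] by blast
  obtain R2 where R2: "\<forall>x. R2 \<le> norm x \<longrightarrow> dir_deriv 1 \<phi> x = 0" using test_function_bounded_support[OF t'] by blast
  have "continuous_on UNIV (dir_deriv 1 \<phi>)" using Ck_SucD_real(2)[OF ck[of "Suc 0"]] by simp
  then show "continuous_on S (dir_deriv 1 \<phi>)" using continuous_on_subset by blast
  show "(\<phi> has_real_derivative dir_deriv 1 \<phi> x) (at x)" by (rule Ck_SucD_real(1)[OF ck])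
  show "\<exists>R\<ge>0. \<forall>x. R \<le> \<bar>x\<bar> \<longrightarrow> \<phi> x = 0 \<and> dir_deriv 1 \<phi> x = 0"
    using R1 R2 by (intro exI[of _ "max 0 (max R1 R2)"]) simp
qed

lemma primitive_imp_weak_deriv:
  assumes "primitive_on UNIV h d" shows "has_weak_deriv 1 h d"
  unfolding has_weak_deriv_def
proof
  fix \<phi> :: "real \<Rightarrow> real" assume \<phi>: "\<phi> \<in> test_functions UNIV"
  obtain R where "\<forall>x. R \<le> \<bar>x\<bar> \<longrightarrow> \<phi> x = 0 \<and> dir_deriv 1 \<phi> x = 0"
    using test_function_real(3)[OF \<phi>] by blast
  then show "(\<integral>x. h x * dir_deriv 1 \<phi> x \<partial>lebesgue) = - (\<integral>x. d x * \<phi> x \<partial>lebesgue)"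
    by (intro integration_by_parts_compact_support[OF assms test_function_real(1,2)[OF \<phi>], of R]) auto
qed

text \<open>The lemma of du Bois-Reymond. If \<open>k p < k q\<close>, take as test function a step near \<open>p\<close> minus
a step near \<open>q\<close>. Its derivative is a bump at \<open>p\<close> minus a bump at \<open>q\<close> of the same mass, and the
integral of \<open>k\<close> against it is negative.\<close>

lemma weak_deriv_zero_imp_constant:
  fixes k :: "real \<Rightarrow> real"
  assumes k: "continuous_on UNIV k"
    and z: "\<And>\<phi>. \<phi> \<in> test_functions UNIV \<Longrightarrow> (\<integral>x. k x * dir_deriv 1 \<phi> x \<partial>lebesgue) = 0"
  shows "k p = k q"
proof -
  have False if lt: "k p < k q" for p q
  proof -
    \<comment> \<open>With this margin \<open>k p + e < k q - e\<close>, and the difference is \<open>e\<close>.\<close>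
    define e where "e = (k q - k p) / 3"
    have e: "e > 0" using lt by (simp add: e_def)
    have c: "\<exists>d>0. \<forall>x. dist x r < d \<longrightarrow> dist (k x) (k r) < e" for r
      using k e unfolding continuous_on_iff by simp
    obtain d1 where d1: "d1 > 0" "\<And>x. dist x p < d1 \<Longrightarrow> dist (k x) (k p) < e" using c[of p] by blast
    obtain d2 where d2: "d2 > 0" "\<And>x. dist x q < d2 \<Longrightarrow> dist (k x) (k q) < e" using c[of q] by blast
    define d where "d = min d1 d2"
    have d: "d > 0" using d1 d2 by (simp add: d_def)
    obtain \<sigma> \<eta> :: "real \<Rightarrow> real" and c where
      "(\<forall>k. Ck k \<eta>) \<and> (\<forall>x. (\<sigma> has_real_derivative \<eta> x) (at x)) \<and> (\<forall>x. \<eta> x \<ge> 0) \<and>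
       (\<forall>x. 1 \<le> \<bar>x\<bar> \<longrightarrow> \<eta> x = 0) \<and> (\<forall>x\<le>-1. \<sigma> x = 0) \<and> (\<forall>x\<ge>1. \<sigma> x = c) \<and> c > 0"
      using smooth_step_exists by (elim exE)
    then have \<sigma>: "\<And>k. Ck k \<eta>" "\<And>x. (\<sigma> has_real_derivative \<eta> x) (at x)" "\<And>x. \<eta> x \<ge> 0"
      "\<And>x. 1 \<le> \<bar>x\<bar> \<Longrightarrow> \<eta> x = 0" "\<And>x. x \<le> -1 \<Longrightarrow> \<sigma> x = 0" "\<And>x. x \<ge> 1 \<Longrightarrow> \<sigma> x = c" "c > 0"
      by simp_all
    \<comment> \<open>A smooth step at \<open>r\<close> of width \<open>d\<close>; the bump \<open>N r\<close> is its derivative.\<close>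
    define S where "S r x = \<sigma> (- r / d + (1 / d) * x)" for r x
    define N where "N r x = (1 / d) * \<eta> (- r / d + (1 / d) * x)" for r x
    have SN: "(S r has_real_derivative N r x) (at x)" for r x
    proof -
      have "((\<lambda>x. - r / d + (1 / d) * x) has_real_derivative 1 / d) (at x)"
        using d by (auto intro!: derivative_eq_intros)
      from DERIV_chain2[OF \<sigma>(2) this] show ?thesis by (simp add: S_def[abs_def] N_def mult.commute)
    qed
    have CkN: "Ck j (N r)" for j r
      unfolding N_def by (intro Ck_mult_real Ck_const Ck_affine_real \<sigma>(1))
    have CkS: "Ck j (S r)" for j r
      by (rule Ck_SucD[OF Ck_SucI_real[OF SN CkN]])
    have arg: "- r / d + (1 / d) * x = (x - r) / d" for r x by (simp add: field_simps diff_divide_distrib)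
    have N0: "N r x \<ge> 0" for r x using \<sigma>(3) d by (simp add: N_def)
    have Nz: "N r x = 0" if "d \<le> \<bar>x - r\<bar>" for r x
      unfolding N_def arg using \<sigma>(4) that d by (simp add: le_divide_eq)
    have S0: "S r x = 0" if "x \<le> r - d" for r x
      unfolding S_def arg using \<sigma>(5) that d by (simp add: field_simps)
    have S1: "S r x = c" if "x \<ge> r + d" for r x
      unfolding S_def arg using \<sigma>(6) that d by (simp add: field_simps)
    define R where "R = \<bar>p\<bar> + \<bar>q\<bar> + d"
    have R: "R \<ge> 0" "p + d \<le> R" "q + d \<le> R" "-R \<le> p - d" "-R \<le> q - d" using d by (auto simp: R_def)
    define \<phi> where "\<phi> x = S p x + (-1) * S q x" for x
    have test: "\<phi> \<in> test_functions UNIV"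
    proof (rule test_functions_realI)
      show "Ck j \<phi>" for j unfolding \<phi>_def by (intro Ck_add_real Ck_mult_real Ck_const CkS)
      show "\<phi> x = 0" if "R \<le> \<bar>x\<bar>" for x
        using that R S0[of x p] S0[of x q] S1[of p x] S1[of q x]
        by (cases "x \<ge> 0") (auto simp: \<phi>_def)
    qed
    have der: "(\<phi> has_real_derivative (N p x - N q x)) (at x)" for x
      unfolding \<phi>_def by (rule DERIV_cong[OF DERIV_add[OF SN DERIV_cmult[OF SN]]]) simp
    have dd: "dir_deriv 1 \<phi> x = N p x - N q x" for x by (rule dir_deriv_real_eq[OF der])
    have cN: "continuous_on A (N r)" for A r using CkN[of 0 r] continuous_on_subset by auto
    have ck: "continuous_on A k" for A using k continuous_on_subset by blast
    have iN: "integral {-R..R} (N r) = c" if "r \<in> {p, q}" for r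
    proof -
      have "primitive_on UNIV (S r) (N r)" by (rule primitive_on_C1) (use SN cN in auto)
      then have "integral {-R..R} (N r) = S r R - S r (-R)" using primitive_onD(3) R by simp
      then show ?thesis using S1[of r R] S0[of "-R" r] that R by auto
    qed
    have "0 = (\<integral>x. k x * (N p x - N q x) \<partial>lebesgue)" using z[OF test] by (simp add: dd)
    also have "\<dots> = integral {-R..R} (\<lambda>x. k x * (N p x - N q x))"
    proof (rule lebesgue_integral_compact_support)
      show "(\<lambda>x. k x * (N p x - N q x)) absolutely_integrable_on {-R..R}"
        by (intro absolutely_integrable_continuous_real continuous_intros ck cN)
      show "k x * (N p x - N q x) = 0" if "x \<notin> {-R..R}" for x
        using that R Nz[of x p] Nz[of x q] by auto
    qed
    also have "\<dots> \<le> integral {-R..R} (\<lambda>x. (k p + e) * N p x - (k q - e) * N q x)"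
    proof (rule integral_le)
      show "k x * (N p x - N q x) \<le> (k p + e) * N p x - (k q - e) * N q x" for x
      proof -
        have "k x * N p x \<le> (k p + e) * N p x"
        proof (cases "\<bar>x - p\<bar> < d")
          case True
          then have "k x \<le> k p + e" using d1(2)[of x] by (simp add: d_def dist_real_def)
          then show ?thesis using N0 mult_right_mono by blast
        qed (simp add: Nz)
        moreover have "(k q - e) * N q x \<le> k x * N q x"
        proof (cases "\<bar>x - q\<bar> < d")
          case True
          then have "k q - e \<le> k x" using d2(2)[of x] by (simp add: d_def dist_real_def)
          then show ?thesis using N0 mult_right_mono by blast
        qed (simp add: Nz)
        ultimately show ?thesis by (simp add: right_diff_distrib)
      qed
    qed (intro integrable_continuous_real continuous_intros ck cN)+
    also have "\<dots> = (k p + e) * c - (k q - e) * c"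
      by (subst Henstock_Kurzweil_Integration.integral_diff)
         (auto intro!: integrable_continuous_real continuous_intros cN simp: iN)
    also have "\<dots> = - e * c" by (simp add: e_def field_simps)
    finally show False using mult_pos_pos[OF e \<sigma>(7)] by simp
  qed
  from this[of p q] this[of q p] show ?thesis by (cases "k p" "k q" rule: linorder_cases) auto
qed

text \<open>The difference between \<open>h\<close> and an indefinite integral of \<open>d\<close> is continuous and has weak
derivative zero.\<close>

lemma weak_deriv_imp_primitive:
  assumes h: "continuous_on UNIV h" and d: "d \<in> L2_loc" and w: "has_weak_deriv 1 h d"
  shows "primitive_on UNIV h d"
proof -
  obtain H where H: "primitive_on UNIV H d" using primitive_of_L2_exists[OF d] by blast
  have cH: "continuous_on UNIV H" by (rule primitive_on_UNIV_continuous[OF H])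
  have const: "h p - H p = h q - H q" for p q
  proof (rule weak_deriv_zero_imp_constant[where k = "\<lambda>x. h x - H x"])
    show "continuous_on UNIV (\<lambda>x. h x - H x)" by (intro continuous_intros h cH)
    fix \<phi> :: "real \<Rightarrow> real" assume \<phi>: "\<phi> \<in> test_functions UNIV"
    obtain R where R: "\<forall>x. R \<le> \<bar>x\<bar> \<longrightarrow> \<phi> x = 0 \<and> dir_deriv 1 \<phi> x = 0"
      using test_function_real(3)[OF \<phi>] by blast
    have i: "integrable lebesgue (\<lambda>x. f x * dir_deriv 1 \<phi> x)" if "continuous_on UNIV f" for f :: "real \<Rightarrow> real"
    proof (rule lebesgue_integral_compact_support)
      show "(\<lambda>x. f x * dir_deriv 1 \<phi> x) absolutely_integrable_on {-\<bar>R\<bar>..\<bar>R\<bar>}"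
        by (intro absolutely_integrable_continuous_real continuous_intros
            continuous_on_subset[OF that] test_function_real(2)[OF \<phi>]) auto
      show "f x * dir_deriv 1 \<phi> x = 0" if "x \<notin> {-\<bar>R\<bar>..\<bar>R\<bar>}" for x
        using R that by auto
    qed
    have "(\<integral>x. (h x - H x) * dir_deriv 1 \<phi> x \<partial>lebesgue)
        = (\<integral>x. h x * dir_deriv 1 \<phi> x \<partial>lebesgue) - (\<integral>x. H x * dir_deriv 1 \<phi> x \<partial>lebesgue)"
      using i[OF h] i[OF cH] by (simp add: left_diff_distrib)
    also have "\<dots> = 0"
      using w primitive_imp_weak_deriv[OF H] \<phi> by (simp add: has_weak_deriv_def)
    finally show "(\<integral>x. (h x - H x) * dir_deriv 1 \<phi> x \<partial>lebesgue) = 0" .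
  qed
  show ?thesis
  proof (rule primitive_onI)
    fix s t :: real assume st: "s \<le> t"
    show "d absolutely_integrable_on {s..t}" using primitive_onD(1)[OF H st] by simp
    show "integral {s..t} d = h t - h s" using primitive_onD(3)[OF H st] const[of s t] by simp
  qed
qed

text \<open>For fixed \<open>h\<close>, the increment \<open>k (t + h) - k t\<close> tested against \<open>\<phi>'\<close> equals
\<open>k\<close> tested against the second derivative of the integral of \<open>\<phi>\<close> over \<open>{t..t - h}\<close>, which is again
a test function. So the increment does not depend on \<open>t\<close>. Averaging over \<open>t\<close> expresses \<open>k\<close> through its
own antiderivative, hence \<open>k\<close> is differentiable, and its derivative is constant.\<close>

lemma weak_second_deriv_zero_imp_affine:
  fixes k :: "real \<Rightarrow> real"
  assumes k: "continuous_on UNIV k"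
    and z: "\<And>\<phi>. \<phi> \<in> test_functions UNIV \<Longrightarrow> (\<integral>x. k x * dir_deriv 1 (dir_deriv 1 \<phi>) x \<partial>lebesgue) = 0"
  obtains \<alpha> \<beta> where "\<And>t. k t = \<alpha> + \<beta> * t"
proof -
  have add: "k (t + h) - k t = k h - k 0" for t h
  proof -
    have "k (t + h) - k t = k (0 + h) - k 0"
    proof (rule weak_deriv_zero_imp_constant[where k = "\<lambda>t. k (t + h) - k t"])
      have ckh: "continuous_on UNIV (\<lambda>t. k (t + h))"
        by (rule continuous_on_compose2[OF k]) (auto intro!: continuous_intros)
      then show "continuous_on UNIV (\<lambda>t. k (t + h) - k t)" by (intro continuous_intros k)
      fix \<phi> :: "real \<Rightarrow> real" assume \<phi>: "\<phi> \<in> test_functions UNIV"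
      obtain R where "R \<ge> 0" "\<forall>x. R \<le> \<bar>x\<bar> \<longrightarrow> \<phi> x = 0 \<and> dir_deriv 1 \<phi> x = 0"
        using test_function_real(3)[OF \<phi>] by blast
      then have R: "\<And>x. R \<le> \<bar>x\<bar> \<Longrightarrow> \<phi> x = 0" "\<And>x. R \<le> \<bar>x\<bar> \<Longrightarrow> dir_deriv 1 \<phi> x = 0" by auto
      have ck\<phi>: "Ck j \<phi>" for j using \<phi> by (simp add: test_functions_def)
      have c\<phi>: "continuous_on UNIV \<phi>" using ck\<phi>[of 0] by simp
      obtain \<Phi> where \<Phi>: "primitive_on UNIV \<Phi> \<phi>"
        using primitive_of_L2_exists[OF L2_loc_continuous[OF c\<phi>]] by blast
      have D\<Phi>: "(\<Phi> has_real_derivative \<phi> x) (at x)" for x by (rule primitive_on_DERIV[OF \<Phi> c\<phi>])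
      have Ck\<Phi>: "Ck j \<Phi>" for j by (rule Ck_SucD[OF Ck_SucI_real[OF D\<Phi> ck\<phi>]])
      \<comment> \<open>\<open>\<Phi>\<close> is constant on each side of the support of \<open>\<phi>\<close>, so \<open>\<zeta>\<close> has compact support.\<close>
      define \<zeta> where "\<zeta> t = \<Phi> (- h + 1 * t) + (-1) * \<Phi> t" for t
      have flat: "\<Phi> s = \<Phi> t" if st: "s \<le> t" "R \<le> s \<or> t \<le> -R" for s t
      proof -
        have "integral {s..t} \<phi> = integral {s..t} (\<lambda>_. 0)"
          by (rule Henstock_Kurzweil_Integration.integral_cong) (use st R(1) in auto)
        then show ?thesis using primitive_onD(3)[OF \<Phi> st(1)] by simp
      qed
      have \<zeta>: "\<zeta> \<in> test_functions UNIV"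
      proof (rule test_functions_realI)
        show "Ck j \<zeta>" for j unfolding \<zeta>_def by (intro Ck_add_real Ck_mult_real Ck_const Ck\<Phi> Ck_affine_real)
        show "\<zeta> t = 0" if "R + \<bar>h\<bar> \<le> \<bar>t\<bar>" for t
        proof -
          have "\<Phi> (t - h) = \<Phi> t"
          proof (cases "h \<ge> 0")
            case True
            show ?thesis
              by (rule flat) (use that \<open>R \<ge> 0\<close> True in \<open>auto simp: abs_real_def split: if_splits\<close>)
          next
            case False
            show ?thesis
              by (rule flat[symmetric]) (use that \<open>R \<ge> 0\<close> False in \<open>auto simp: abs_real_def split: if_splits\<close>)
          qed
          then show ?thesis by (simp add: \<zeta>_def)
        qed
      qed
      have \<zeta>1: "dir_deriv 1 \<zeta> = (\<lambda>t. \<phi> (- h + 1 * t) + (-1) * \<phi> t)"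
      proof
        fix t
        have "((\<lambda>t. \<Phi> (- h + 1 * t)) has_real_derivative \<phi> (- h + 1 * t) * 1) (at t)"
          by (rule DERIV_chain2[OF D\<Phi>]) (auto intro!: derivative_eq_intros)
        from DERIV_add[OF this DERIV_cmult[OF D\<Phi>[of t], of "-1"]]
        show "dir_deriv 1 \<zeta> t = \<phi> (- h + 1 * t) + (-1) * \<phi> t"
          unfolding \<zeta>_def by (intro dir_deriv_real_eq) simp
      qed
      have \<zeta>2: "dir_deriv 1 (dir_deriv 1 \<zeta>) = (\<lambda>t. dir_deriv 1 \<phi> (t - h) - dir_deriv 1 \<phi> t)"
      proof
        fix t
        have "((\<lambda>t. \<phi> (- h + 1 * t)) has_real_derivative dir_deriv 1 \<phi> (- h + 1 * t) * 1) (at t)"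
          by (rule DERIV_chain2[OF test_function_real(1)[OF \<phi>]]) (auto intro!: derivative_eq_intros)
        from DERIV_add[OF this DERIV_cmult[OF test_function_real(1)[OF \<phi>, of t], of "-1"]]
        show "dir_deriv 1 (dir_deriv 1 \<zeta>) t = dir_deriv 1 \<phi> (t - h) - dir_deriv 1 \<phi> t"
          unfolding \<zeta>1 by (intro dir_deriv_real_eq) simp
      qed
      define \<psi> where "\<psi> = dir_deriv 1 \<phi>"
      define r where "r = R + \<bar>h\<bar>"
      have c\<psi>: "continuous_on A \<psi>" for A unfolding \<psi>_def by (rule test_function_real(2)[OF \<phi>])
      have \<psi>0: "\<psi> x = 0" if "R \<le> \<bar>x\<bar>" for x using R(2)[OF that] by (simp add: \<psi>_def)
      have i: "integrable lebesgue (\<lambda>x. f x * \<psi> x)" if "continuous_on UNIV f" for f :: "real \<Rightarrow> real"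
      proof (rule lebesgue_integral_compact_support)
        show "(\<lambda>x. f x * \<psi> x) absolutely_integrable_on {-R..R}"
          by (intro absolutely_integrable_continuous_real continuous_intros
              continuous_on_subset[OF that] c\<psi>) auto
        show "f x * \<psi> x = 0" if "x \<notin> {-R..R}" for x
        proof -
          have "R \<le> \<bar>x\<bar>" using that by (auto simp: abs_real_def)
          then show ?thesis by (simp add: \<psi>0)
        qed
      qed
      have i2: "integrable lebesgue (\<lambda>x. k x * \<psi> (x - h))"
        using lebesgue_integrable_real_affine[OF i[OF ckh], of 1 "-h"] by simp
      have shift: "(\<integral>x. k (x + h) * \<psi> x \<partial>lebesgue) = (\<integral>x. k x * \<psi> (x - h) \<partial>lebesgue)"
        using lebesgue_integral_real_affine[of 1 "\<lambda>x. k (x + h) * \<psi> x" "-h"] by simp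
      have "0 = (\<integral>x. k x * (\<psi> (x - h) - \<psi> x) \<partial>lebesgue)"
        using z[OF \<zeta>] by (simp add: \<zeta>2 \<psi>_def)
      also have "\<dots> = (\<integral>x. k x * \<psi> (x - h) \<partial>lebesgue) - (\<integral>x. k x * \<psi> x \<partial>lebesgue)"
        using i2 i[OF k] by (simp add: right_diff_distrib)
      also have "\<dots> = (\<integral>x. (k (x + h) - k x) * \<psi> x \<partial>lebesgue)"
        using i[OF ckh] i[OF k] by (simp add: left_diff_distrib flip: shift)
      finally show "(\<integral>x. (k (x + h) - k x) * dir_deriv 1 \<phi> x \<partial>lebesgue) = 0" by (simp add: \<psi>_def)
    qed
    then show ?thesis by simp
  qed
  obtain K where K: "primitive_on UNIV K k"
    using primitive_of_L2_exists[OF L2_loc_continuous[OF k]] by blast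
  have DK: "(K has_real_derivative k t) (at t)" for t by (rule primitive_on_DERIV[OF K k])
  \<comment> \<open>The mean of \<open>k\<close> over \<open>{t..t + 1}\<close> differs from the mean over \<open>{0..1}\<close> by \<open>k t - k 0\<close>.\<close>
  have rep: "k t = k 0 + (K (1 + t) - K t) - (K 1 - K 0)" for t
  proof -
    have "integral {t..t+1} k = integral {0..1} (\<lambda>x. k (x + t))"
      using integral_shift[of 0 t 1 k] continuous_on_subset[OF k] by (simp add: add.commute o_def)
    also have "\<dots> = integral {0..1} (\<lambda>x. k x + (k t - k 0))"
      using add by (intro Henstock_Kurzweil_Integration.integral_cong) (smt (verit))
    also have "\<dots> = integral {0..1} k + (k t - k 0)"
      by (subst Henstock_Kurzweil_Integration.integral_add)
         (auto intro!: integrable_continuous_real continuous_on_subset[OF k])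
    finally show ?thesis
      using primitive_onD(3)[OF K, of t "t + 1"] primitive_onD(3)[OF K, of 0 1] by (simp add: add.commute)
  qed
  have "((\<lambda>t. k t - (k 1 - k 0) * t) has_real_derivative 0) (at t)" for t
  proof -
    have "((\<lambda>t. K (1 + t)) has_real_derivative k (1 + t) * 1) (at t)"
      by (rule DERIV_chain2[OF DK]) (auto intro!: derivative_eq_intros)
    then have "((\<lambda>t. k 0 + (K (1 + t) - K t) - (K 1 - K 0)) has_real_derivative (k (1 + t) - k t)) (at t)"
      by (auto intro!: derivative_eq_intros DK)
    moreover have "(\<lambda>t. k 0 + (K (1 + t) - K t) - (K 1 - K 0)) = k" by (rule ext) (rule rep[symmetric])
    ultimately have "(k has_real_derivative (k (1 + t) - k t)) (at t)" by (simp only:)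
    then show ?thesis using add[of t 1] by (auto intro!: derivative_eq_intros simp: add.commute)
  qed
  then have "k t - (k 1 - k 0) * t = k 0 - (k 1 - k 0) * 0" for t
    by (rule DERIV_isconst_all[OF allI])
  then show thesis by (intro that[of "k 0" "k 1 - k 0"]) (simp add: algebra_simps)
qed

section \<open>Weak derivatives in the plane\<close>

lemma L2_loc_mult_test_integrable:
  fixes f g :: "'a::euclidean_space \<Rightarrow> real"
  assumes f: "f \<in> L2_loc" and g: "continuous_on UNIV g" and R: "\<And>x. R \<le> norm x \<Longrightarrow> g x = 0"
  shows "integrable lebesgue (\<lambda>x. f x * g x)"
proof -
  let ?K = "cball (0::'a) R"
  have "bounded (g ` ?K)"
    by (intro compact_imp_bounded compact_continuous_image continuous_on_subset[OF g]) auto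
  then obtain M where "\<forall>y\<in>g ` ?K. norm y \<le> M" unfolding bounded_iff by blast
  then have M: "\<bar>g x\<bar> \<le> M" if "x \<in> ?K" for x using that by fastforce
  have fm: "f \<in> borel_measurable lebesgue" using f by (simp add: L2_loc_def)
  have gm: "g \<in> borel_measurable lebesgue"
    by (rule measurable_completion) (simp add: borel_measurable_continuous_onI[OF g])
  show ?thesis
  proof (rule Bochner_Integration.integrable_bound)
    have "set_integrable lebesgue ?K (\<lambda>x. 1::real)"
      unfolding set_integrable_def using lmeasurable_cball[of "0::'a" R] by (simp add: lmeasurable_iff_integrable)
    moreover have "set_integrable lebesgue ?K (\<lambda>x. (f x)\<^sup>2)" using f by (simp add: L2_loc_def)
    ultimately have "set_integrable lebesgue ?K (\<lambda>x. M * (1 + (f x)\<^sup>2))"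
      by (intro set_integrable_mult_right set_integral_add)
    then show "integrable lebesgue (\<lambda>x. indicator ?K x *\<^sub>R (M * (1 + (f x)\<^sup>2)))"
      unfolding set_integrable_def .
    show "(\<lambda>x. f x * g x) \<in> borel_measurable lebesgue" using fm gm by measurable
    show "AE x in lebesgue. norm (f x * g x) \<le> norm (indicator ?K x *\<^sub>R (M * (1 + (f x)\<^sup>2)))"
    proof (intro AE_I2)
      fix x
      show "norm (f x * g x) \<le> norm (indicator ?K x *\<^sub>R (M * (1 + (f x)\<^sup>2)))"
      proof (cases "x \<in> ?K")
        case True
        have "\<bar>f x\<bar> \<le> 1 + (f x)\<^sup>2"
          using sum_squares_bound[of 1 "\<bar>f x\<bar>"] by (simp add: power2_eq_square)
        then have "\<bar>f x\<bar> * \<bar>g x\<bar> \<le> (1 + (f x)\<^sup>2) * M"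
          using M[OF True] by (intro mult_mono) auto
        moreover have "0 \<le> M" using M[OF True] by linarith
        ultimately show ?thesis using True by (simp add: abs_mult mult.commute)
      next
        case False
        then show ?thesis using R[of x] by simp
      qed
    qed
  qed
qed

text \<open>For fixed \<open>t\<close> the substitution \<open>x + c t\<close> bounds the integral over a horizontal section of
\<open>K\<close> by one and the same integral of \<open>d\<^sup>2\<close> over a larger interval; Tonelli does the rest.\<close>

lemma L2_loc_plane_wave:
  fixes d :: "real \<Rightarrow> real"
  assumes d: "d \<in> L2_loc" and [measurable]: "d \<in> borel_measurable borel"
  shows "(\<lambda>p::real \<times> real. d (fst p + c * snd p)) \<in> L2_loc"
proof -
  let ?w = "\<lambda>p::real \<times> real. d (fst p + c * snd p)"
  have wm: "?w \<in> borel_measurable borel"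
    by (intro measurable_compose[OF _ assms(2)] borel_measurable_continuous_onI continuous_intros)
  have "set_integrable lebesgue K (\<lambda>p. (?w p)\<^sup>2)" if K: "compact K" for K
  proof -
    obtain R where R: "\<And>p. p \<in> K \<Longrightarrow> norm p \<le> R" "R \<ge> 0"
      using compact_imp_bounded[OF K] by (auto simp: bounded_pos intro: less_imp_le)
    \<comment> \<open>\<open>\<bar>x + c t\<bar> \<le> r\<close> whenever \<open>\<bar>x\<bar> \<le> R\<close> and \<open>\<bar>t\<bar> \<le> R\<close>.\<close>
    define r where "r = R + \<bar>c\<bar> * R"
    define C where "C = (\<integral>\<^sup>+x. indicator {-r..r} x * ennreal ((d x)\<^sup>2) \<partial>lborel)"
    have "C < \<infinity>"
    proof -
      have "set_integrable lebesgue {-r..r} (\<lambda>x. (d x)\<^sup>2)" by (rule L2_locD(2)[OF d])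
      then have "integrable lborel (\<lambda>x. indicator {-r..r} x *\<^sub>R (d x)\<^sup>2)"
        unfolding set_integrable_def by (subst (asm) integrable_completion) auto
      then have "(\<integral>\<^sup>+x. ennreal (norm (indicator {-r..r} x *\<^sub>R (d x)\<^sup>2)) \<partial>lborel) < \<infinity>"
        by (simp add: integrable_iff_bounded)
      moreover have "ennreal (norm (indicator {-r..r} x *\<^sub>R (d x)\<^sup>2)) = indicator {-r..r} x * ennreal ((d x)\<^sup>2)" for x
        by (simp add: indicator_def)
      ultimately show ?thesis by (simp add: C_def)
    qed
    define W where "W p = indicator K p *\<^sub>R (?w p)\<^sup>2" for p
    have [measurable]: "K \<in> sets borel" using K by (simp add: compact_imp_closed borel_closed)
    have Wm[measurable]: "W \<in> borel_measurable borel" unfolding W_def using wm by measurable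
    have Wm': "W \<in> borel_measurable (lborel \<Otimes>\<^sub>M lborel)"
      using Wm by (simp add: lborel_prod)
    have "(\<integral>\<^sup>+p. ennreal (norm (W p)) \<partial>lborel) = (\<integral>\<^sup>+p. ennreal (norm (W p)) \<partial>(lborel \<Otimes>\<^sub>M lborel))"
      by (simp add: lborel_prod)
    also have "\<dots> = (\<integral>\<^sup>+t. (\<integral>\<^sup>+x. ennreal (norm (W (x, t))) \<partial>lborel) \<partial>lborel)"
      by (rule lborel_pair.nn_integral_snd[symmetric]) (use Wm' in measurable)
    also have "\<dots> \<le> (\<integral>\<^sup>+t. indicator {-R..R} t * C \<partial>lborel)"
    proof (rule nn_integral_mono)
      fix t :: real
      show "(\<integral>\<^sup>+x. ennreal (norm (W (x, t))) \<partial>lborel) \<le> indicator {-R..R} t * C"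
      proof (cases "\<bar>t\<bar> \<le> R")
        case True
        have "(\<integral>\<^sup>+x. ennreal (norm (W (x, t))) \<partial>lborel)
            \<le> (\<integral>\<^sup>+x. indicator {-r..r} (c * t + 1 * x) * ennreal ((d (c * t + 1 * x))\<^sup>2) \<partial>lborel)"
        proof (rule nn_integral_mono)
          fix x :: real
          show "ennreal (norm (W (x, t))) \<le> indicator {-r..r} (c * t + 1 * x) * ennreal ((d (c * t + 1 * x))\<^sup>2)"
          proof (cases "(x, t) \<in> K")
            case 1: True
            have "\<bar>x\<bar> \<le> R" using R(1)[OF 1] norm_fst_le[of x t] by simp
            moreover have "\<bar>c * t\<bar> \<le> \<bar>c\<bar> * R" using True by (simp add: abs_mult mult_left_mono)
            ultimately have "c * t + x \<in> {-r..r}" unfolding r_def by (auto simp: abs_le_iff)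
            then show ?thesis using 1 by (simp add: W_def add.commute)
          qed (simp add: W_def)
        qed
        also have "\<dots> = C" unfolding C_def
          by (subst (2) nn_integral_real_affine[of _ 1 "c * t"]) auto
        finally show ?thesis using True by (simp add: indicator_def abs_le_iff)
      next
        case False
        have "W (x, t) = 0" for x
        proof -
          have "(x, t) \<notin> K" using R(1)[of "(x, t)"] norm_snd_le[of t x] False by force
          then show ?thesis by (simp add: W_def)
        qed
        then show ?thesis by simp
      qed
    qed
    also have "\<dots> = emeasure lborel {-R..R} * C"
      by (subst nn_integral_multc) auto
    also have "\<dots> < \<infinity>" using \<open>C < \<infinity>\<close> by (simp add: ennreal_mult_less_top emeasure_lborel_Icc_eq)
    finally have "integrable lborel W" using Wm by (simp add: integrable_iff_bounded)
    then have "integrable lebesgue W" using Wm by (subst integrable_completion) auto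
    then show ?thesis unfolding set_integrable_def W_def .
  qed
  moreover have "?w \<in> borel_measurable lebesgue"
    using wm by (intro measurable_completion) simp
  ultimately show ?thesis by (simp add: L2_loc_def)
qed

lemma test_function_plane:
  fixes \<phi> :: "real \<times> real \<Rightarrow> real"
  assumes "\<phi> \<in> test_functions \<Omega>"
  shows "(\<phi> has_derivative (\<lambda>h. fst h * dir_deriv (1, 0) \<phi> p + snd h * dir_deriv (0, 1) \<phi> p)) (at p)"
    and "dir_deriv (1, 0) \<phi> \<in> test_functions \<Omega>" and "dir_deriv (0, 1) \<phi> \<in> test_functions \<Omega>"
    and "continuous_on S \<phi>"
proof -
  have ck: "Ck k \<phi>" for k using assms by (simp add: test_functions_def)
  have "\<phi> differentiable (at p)" using ck[of "Suc 0"] unfolding Ck.simps differentiable_on_def by (metis UNIV_I)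
  then have D: "(\<phi> has_derivative frechet_derivative \<phi> (at p)) (at p)" by (simp add: frechet_derivative_works)
  interpret linear "frechet_derivative \<phi> (at p)" using D by (rule has_derivative_linear)
  have "frechet_derivative \<phi> (at p) h = fst h * dir_deriv (1, 0) \<phi> p + snd h * dir_deriv (0, 1) \<phi> p" for h
  proof -
    have "h = fst h *\<^sub>R (1, 0) + snd h *\<^sub>R (0, 1)" by (cases h) simp
    then have "frechet_derivative \<phi> (at p) h = frechet_derivative \<phi> (at p) (fst h *\<^sub>R (1, 0) + snd h *\<^sub>R (0, 1))" by simp
    then show ?thesis by (simp only: add scale dir_deriv_def real_scaleR_def)
  qed
  then have "frechet_derivative \<phi> (at p) = (\<lambda>h. fst h * dir_deriv (1, 0) \<phi> p + snd h * dir_deriv (0, 1) \<phi> p)"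
    by (rule ext)
  with D show "(\<phi> has_derivative (\<lambda>h. fst h * dir_deriv (1, 0) \<phi> p + snd h * dir_deriv (0, 1) \<phi> p)) (at p)"
    by (simp only:)
  show "dir_deriv (1, 0) \<phi> \<in> test_functions \<Omega>" "dir_deriv (0, 1) \<phi> \<in> test_functions \<Omega>"
    by (rule dir_deriv_test_function[OF assms]; simp add: Basis_prod_def)+
  show "continuous_on S \<phi>" using ck[of 0] continuous_on_subset by auto
qed

lemma test_functions_mono: "\<phi> \<in> test_functions \<Omega> \<Longrightarrow> \<phi> \<in> test_functions UNIV"
  by (simp add: test_functions_def)

lemma lebesgue_integral_plane:
  fixes f :: "real \<times> real \<Rightarrow> real"
  assumes f: "integrable lebesgue f" "f \<in> borel_measurable borel"
  shows "(\<integral>p. f p \<partial>lebesgue) = (\<integral>t. (\<integral>x. f (x, t) \<partial>lebesgue) \<partial>lborel)"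
    and "(\<integral>p. f p \<partial>lebesgue) = (\<integral>x. (\<integral>t. f (x, t) \<partial>lebesgue) \<partial>lborel)"
proof -
  have m: "f \<in> borel_measurable lborel" using f(2) by simp
  have i: "integrable (lborel \<Otimes>\<^sub>M lborel) (case_prod (\<lambda>x t. f (x, t)))"
    using f(1) integrable_completion[OF m] by (simp add: lborel_prod)
  have e: "(\<integral>p. f p \<partial>lebesgue) = (\<integral>(x, t). f (x, t) \<partial>(lborel \<Otimes>\<^sub>M lborel))"
    using integral_completion[OF m] by (simp add: lborel_prod)
  have s: "(\<lambda>x. f (x, t)) \<in> borel_measurable lborel" "(\<lambda>t. f (x, t)) \<in> borel_measurable lborel" for x t
    using f(2) by measurable
  show "(\<integral>p. f p \<partial>lebesgue) = (\<integral>t. (\<integral>x. f (x, t) \<partial>lebesgue) \<partial>lborel)"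
    unfolding e integral_completion[OF s(1)] using lborel_pair.integral_snd[OF i] by simp
  show "(\<integral>p. f p \<partial>lebesgue) = (\<integral>x. (\<integral>t. f (x, t) \<partial>lebesgue) \<partial>lborel)"
    unfolding e integral_completion[OF s(2)] using lborel_pair.integral_fst[OF i] by simp
qed

text \<open>The curve \<open>e\<close> is a line in direction \<open>b\<close>, and \<open>\<bar>s\<bar> \<le> norm (e s)\<close> keeps the
support of \<open>\<phi>\<close> on it bounded.\<close>

lemma integration_by_parts_along_line:
  fixes \<phi> :: "'a::euclidean_space \<Rightarrow> real" and e :: "real \<Rightarrow> 'a"
  assumes \<phi>: "\<phi> \<in> test_functions UNIV" and b: "b \<in> Basis"
    and e: "\<And>s. (e has_derivative (\<lambda>h. h *\<^sub>R b)) (at s)" "\<And>s. \<bar>s\<bar> \<le> norm (e s)"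
    and P: "primitive_on UNIV (\<lambda>s. u (e s)) (\<lambda>s. w (e s))"
  shows "(\<integral>s. u (e s) * dir_deriv b \<phi> (e s) \<partial>lebesgue) = - (\<integral>s. w (e s) * \<phi> (e s) \<partial>lebesgue)"
proof -
  have \<psi>: "dir_deriv b \<phi> \<in> test_functions UNIV" by (rule dir_deriv_test_function[OF \<phi> b])
  obtain R1 where R1: "\<forall>x. R1 \<le> norm x \<longrightarrow> \<phi> x = 0" using test_function_bounded_support[OF \<phi>] by blast
  obtain R2 where R2: "\<forall>x. R2 \<le> norm x \<longrightarrow> dir_deriv b \<phi> x = 0" using test_function_bounded_support[OF \<psi>] by blast
  show ?thesis
  proof (rule integration_by_parts_compact_support[OF P, where R = "max R1 R2"])
    show "((\<lambda>s. \<phi> (e s)) has_real_derivative dir_deriv b \<phi> (e s)) (at s)" for s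
    proof -
      have "Ck (Suc 0) \<phi>" using \<phi> by (simp add: test_functions_def)
      then have "\<phi> differentiable (at (e s))" unfolding Ck.simps differentiable_on_def by (metis UNIV_I)
      then have D: "(\<phi> has_derivative frechet_derivative \<phi> (at (e s))) (at (e s))"
        by (simp add: frechet_derivative_works)
      have "frechet_derivative \<phi> (at (e s)) (h *\<^sub>R b) = h * dir_deriv b \<phi> (e s)" for h
        using linear_scale[OF has_derivative_linear[OF D], of h b] by (simp add: dir_deriv_def)
      with has_derivative_compose[OF e(1) D] show ?thesis
        by (intro has_derivative_imp_has_field_derivative) auto
    qed
    have ce: "continuous_on UNIV e" by (intro continuous_at_imp_continuous_on ballI has_derivative_continuous[OF e(1)])
    have cd: "continuous_on UNIV (dir_deriv b \<phi>)" using \<psi> by (metis (mono_tags, lifting) Ck.simps(1) mem_Collect_eq test_functions_def)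
    show "continuous_on UNIV (\<lambda>s. dir_deriv b \<phi> (e s))"
      by (rule continuous_on_compose2[OF cd ce]) simp
    fix s :: real assume "max R1 R2 \<le> \<bar>s\<bar>"
    with e(2)[of s] have "R1 \<le> norm (e s)" "R2 \<le> norm (e s)" by linarith+
    then show "\<phi> (e s) = 0" "dir_deriv b \<phi> (e s) = 0" using R1 R2 by blast+
  qed
qed

text \<open>Fubini reduces both sides to integrals over lines, on which one-dimensional integration by parts
applies.\<close>

lemma fibrewise_primitive_imp_weak_deriv:
  fixes u w :: "real \<times> real \<Rightarrow> real"
  assumes u: "continuous_on UNIV u" and w: "w \<in> L2_loc" "w \<in> borel_measurable borel"
  shows "(\<And>t. primitive_on UNIV (\<lambda>x. u (x, t)) (\<lambda>x. w (x, t))) \<Longrightarrow> has_weak_deriv (1, 0) u w"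
    and "(\<And>x. primitive_on UNIV (\<lambda>t. u (x, t)) (\<lambda>t. w (x, t))) \<Longrightarrow> has_weak_deriv (0, 1) u w"
proof -
  have um: "u \<in> borel_measurable borel" by (rule borel_measurable_continuous_onI[OF u])
  have gen: "integrable lebesgue (\<lambda>p. v p * \<psi> p) \<and> (\<lambda>p. v p * \<psi> p) \<in> borel_measurable borel"
    if \<psi>: "\<psi> \<in> test_functions UNIV" and v: "v \<in> L2_loc" "v \<in> borel_measurable borel" for v \<psi> :: "real \<times> real \<Rightarrow> real"
  proof -
    obtain R where "\<forall>x. R \<le> norm x \<longrightarrow> \<psi> x = 0" using test_function_bounded_support[OF \<psi>] by blast
    moreover have c: "continuous_on UNIV \<psi>" by (rule test_function_plane(4)[OF \<psi>])
    moreover have "\<psi> \<in> borel_measurable borel" by (rule borel_measurable_continuous_onI[OF c])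
    ultimately show ?thesis
      using L2_loc_mult_test_integrable[OF v(1) c, of R] v(2) by auto
  qed
  note uL = L2_loc_continuous[OF u]
  show "has_weak_deriv (1, 0) u w" if P: "\<And>t. primitive_on UNIV (\<lambda>x. u (x, t)) (\<lambda>x. w (x, t))"
    unfolding has_weak_deriv_def
  proof
    fix \<phi> :: "real \<times> real \<Rightarrow> real" assume \<phi>: "\<phi> \<in> test_functions UNIV"
    note \<psi> = test_function_plane(2)[OF \<phi>]
    have le: "\<bar>x\<bar> \<le> norm (x, t)" for x t :: real using norm_fst_le[of x t] by simp
    have sec: "(\<integral>x. u (x, t) * dir_deriv (1, 0) \<phi> (x, t) \<partial>lebesgue) = - (\<integral>x. w (x, t) * \<phi> (x, t) \<partial>lebesgue)" for t
      by (rule integration_by_parts_along_line[OF \<phi> _ _ _ P])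
         (use le in \<open>auto intro!: derivative_eq_intros simp: Basis_prod_def\<close>)
    have "(\<integral>p. u p * dir_deriv (1, 0) \<phi> p \<partial>lebesgue)
        = (\<integral>t. (\<integral>x. u (x, t) * dir_deriv (1, 0) \<phi> (x, t) \<partial>lebesgue) \<partial>lborel)"
      using gen[OF \<psi> uL um] by (intro lebesgue_integral_plane(1)) auto
    also have "\<dots> = - (\<integral>t. (\<integral>x. w (x, t) * \<phi> (x, t) \<partial>lebesgue) \<partial>lborel)" unfolding sec by simp
    also have "(\<integral>t. (\<integral>x. w (x, t) * \<phi> (x, t) \<partial>lebesgue) \<partial>lborel) = (\<integral>p. w p * \<phi> p \<partial>lebesgue)"
      using gen[OF \<phi> w] by (intro lebesgue_integral_plane(1)[symmetric]) auto
    finally show "(\<integral>p. u p * dir_deriv (1, 0) \<phi> p \<partial>lebesgue) = - (\<integral>p. w p * \<phi> p \<partial>lebesgue)" .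
  qed
  show "has_weak_deriv (0, 1) u w" if P: "\<And>x. primitive_on UNIV (\<lambda>t. u (x, t)) (\<lambda>t. w (x, t))"
    unfolding has_weak_deriv_def
  proof
    fix \<phi> :: "real \<times> real \<Rightarrow> real" assume \<phi>: "\<phi> \<in> test_functions UNIV"
    note \<psi> = test_function_plane(3)[OF \<phi>]
    have le: "\<bar>t\<bar> \<le> norm (x, t)" for x t :: real using norm_snd_le[of t x] by simp
    have sec: "(\<integral>t. u (x, t) * dir_deriv (0, 1) \<phi> (x, t) \<partial>lebesgue) = - (\<integral>t. w (x, t) * \<phi> (x, t) \<partial>lebesgue)" for x
      by (rule integration_by_parts_along_line[OF \<phi> _ _ _ P])
         (use le in \<open>auto intro!: derivative_eq_intros simp: Basis_prod_def\<close>)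
    have "(\<integral>p. u p * dir_deriv (0, 1) \<phi> p \<partial>lebesgue)
        = (\<integral>x. (\<integral>t. u (x, t) * dir_deriv (0, 1) \<phi> (x, t) \<partial>lebesgue) \<partial>lborel)"
      using gen[OF \<psi> uL um] by (intro lebesgue_integral_plane(2)) auto
    also have "\<dots> = - (\<integral>x. (\<integral>t. w (x, t) * \<phi> (x, t) \<partial>lebesgue) \<partial>lborel)" unfolding sec by simp
    also have "(\<integral>x. (\<integral>t. w (x, t) * \<phi> (x, t) \<partial>lebesgue) \<partial>lborel) = (\<integral>p. w p * \<phi> p \<partial>lebesgue)"
      using gen[OF \<phi> w] by (intro lebesgue_integral_plane(2)[symmetric]) auto
    finally show "(\<integral>p. u p * dir_deriv (0, 1) \<phi> p \<partial>lebesgue) = - (\<integral>p. w p * \<phi> p \<partial>lebesgue)" .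
  qed
qed

section \<open>Travelling waves and the wave equation off the origin\<close>

lemma plane_bounded_support:
  fixes \<psi> :: "real \<times> real \<Rightarrow> real"
  assumes "\<psi> \<in> test_functions \<Omega>"
  shows "\<exists>R\<ge>0. \<forall>x t. R \<le> \<bar>x\<bar> \<or> R \<le> \<bar>t\<bar> \<longrightarrow> \<psi> (x, t) = 0"
proof -
  obtain R where R: "\<forall>x. R \<le> norm x \<longrightarrow> \<psi> x = 0" using test_function_bounded_support[OF assms] by blast
  have "\<psi> (x, t) = 0" if "R \<le> \<bar>x\<bar> \<or> R \<le> \<bar>t\<bar>" for x t
    using R norm_fst_le[of x t] norm_snd_le[of t x] that by fastforce
  then show ?thesis by (intro exI[of _ "max R 0"]) auto
qed

text \<open>The support of \<open>\<phi>\<close> stays away from the line \<open>x = 0\<close>, so a factor that is locally constant off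
the origin behaves like a constant.\<close>

lemma cutoff_test_function:
  fixes \<phi> :: "real \<times> real \<Rightarrow> real"
  assumes \<phi>: "\<phi> \<in> test_functions {p. fst p \<noteq> 0}"
    and \<chi>: "\<forall>x. x \<noteq> 0 \<longrightarrow> (\<exists>S. open S \<and> x \<in> S \<and> (\<forall>y\<in>S. c y = c x))"
  shows "((\<lambda>p. c (fst p) * \<phi> p) has_derivative
      (\<lambda>h. fst h * (c (fst p) * dir_deriv (1, 0) \<phi> p) + snd h * (c (fst p) * dir_deriv (0, 1) \<phi> p))) (at p)"
    and "isCont (\<lambda>p. c (fst p) * \<phi> p) p"
proof -
  show D: "((\<lambda>p. c (fst p) * \<phi> p) has_derivative
      (\<lambda>h. fst h * (c (fst p) * dir_deriv (1, 0) \<phi> p) + snd h * (c (fst p) * dir_deriv (0, 1) \<phi> p))) (at p)"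
  proof (cases "fst p = 0")
    case False
    then obtain S where "open S \<and> fst p \<in> S \<and> (\<forall>y\<in>S. c y = c (fst p))"
      using \<chi>[rule_format, OF False] by (elim exE)
    note SS = this
    have S: "open S" "fst p \<in> S" and Sc: "\<forall>y\<in>S. c y = c (fst p)"
      using SS[THEN conjunct1] SS[THEN conjunct2, THEN conjunct1] SS[THEN conjunct2, THEN conjunct2] .
    have o: "open (fst -` S :: (real \<times> real) set)" by (rule open_vimage_fst[OF S(1)])
    have "((\<lambda>q. c (fst p) * \<phi> q) has_derivative
        (\<lambda>h. c (fst p) * (fst h * dir_deriv (1, 0) \<phi> p + snd h * dir_deriv (0, 1) \<phi> p))) (at p)"
      by (rule has_derivative_mult_right[OF test_function_plane(1)[OF \<phi>]])
    then have "((\<lambda>q. c (fst p) * \<phi> q) has_derivative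
        (\<lambda>h. fst h * (c (fst p) * dir_deriv (1, 0) \<phi> p) + snd h * (c (fst p) * dir_deriv (0, 1) \<phi> p))) (at p)"
      by (simp add: algebra_simps)
    then show ?thesis
    proof (rule has_derivative_transform_within_open[OF _ o])
      show "p \<in> fst -` S" using S(2) by simp
      show "c (fst p) * \<phi> q = c (fst q) * \<phi> q" if "q \<in> fst -` S" for q
        using bspec[OF Sc, of "fst q"] that by (simp only: vimage_eq)
    qed
  next
    case True
    then have out: "p \<notin> closure {x. \<phi> x \<noteq> 0}" using \<phi> by (auto simp: test_functions_def)
    have z: "\<phi> y = 0" if "y \<in> - closure {x. \<phi> x \<noteq> 0}" for y
      using that closure_subset[of "{x. \<phi> x \<noteq> 0}"] by auto
    have "((\<lambda>q. c (fst q) * \<phi> q) has_derivative (\<lambda>h. 0)) (at p)"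
    proof (rule has_derivative_transform_within_open)
      show "((\<lambda>x. 0) has_derivative (\<lambda>h. 0)) (at p)" by simp
      show "open (- closure {x. \<phi> x \<noteq> 0})" by (simp add: open_Compl)
      show "p \<in> - closure {x. \<phi> x \<noteq> 0}" using out by simp
      show "0 = c (fst y) * \<phi> y" if "y \<in> - closure {x. \<phi> x \<noteq> 0}" for y
        using z[OF that] by simp
    qed
    then show ?thesis by (simp add: dir_deriv_outside_support[OF out])
  qed
  show "isCont (\<lambda>p. c (fst p) * \<phi> p) p" by (rule has_derivative_continuous[OF D])
qed

text \<open>The function \<open>\<Psi>\<close> is the derivative of \<open>c \<phi>\<close> along the characteristics
\<open>x = \<xi> + v t\<close>. In the coordinates \<open>(\<xi>, t)\<close> the factor \<open>d\<close> depends on \<open>\<xi>\<close>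
only, and the integral over \<open>t\<close> of the derivative of a compactly supported function vanishes.\<close>

lemma transport_orthogonal:
  fixes d c :: "real \<Rightarrow> real" and \<phi> :: "real \<times> real \<Rightarrow> real" and v :: real
  assumes d: "d \<in> L2_loc" "d \<in> borel_measurable borel"
    and \<phi>: "\<phi> \<in> test_functions {p. fst p \<noteq> 0}"
    and \<chi>: "\<forall>x. x \<noteq> 0 \<longrightarrow> (\<exists>S. open S \<and> x \<in> S \<and> (\<forall>y\<in>S. c y = c x))"
  defines "\<Psi> \<equiv> \<lambda>p. c (fst p) * (dir_deriv (0, 1) \<phi> p + v * dir_deriv (1, 0) \<phi> p)"
  shows "integrable lebesgue (\<lambda>p. d (fst p + (- v) * snd p) * \<Psi> p)"
    and "(\<integral>p. d (fst p + (- v) * snd p) * \<Psi> p \<partial>lebesgue) = 0"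
proof -
  let ?\<phi>x = "dir_deriv (1, 0) \<phi>" and ?\<phi>t = "dir_deriv (0, 1) \<phi>"
  have tx: "?\<phi>x \<in> test_functions {p. fst p \<noteq> 0}" and tt: "?\<phi>t \<in> test_functions {p. fst p \<noteq> 0}"
    using test_function_plane(2,3)[OF \<phi>] .
  obtain R0 where R0: "R0 \<ge> 0" "\<forall>x t. R0 \<le> \<bar>x\<bar> \<or> R0 \<le> \<bar>t\<bar> \<longrightarrow> \<phi> (x, t) = 0" using plane_bounded_support[OF \<phi>] by blast
  obtain R1 where R1: "R1 \<ge> 0" "\<forall>x t. R1 \<le> \<bar>x\<bar> \<or> R1 \<le> \<bar>t\<bar> \<longrightarrow> ?\<phi>x (x, t) = 0" using plane_bounded_support[OF tx] by blast
  obtain R2 where R2: "R2 \<ge> 0" "\<forall>x t. R2 \<le> \<bar>x\<bar> \<or> R2 \<le> \<bar>t\<bar> \<longrightarrow> ?\<phi>t (x, t) = 0" using plane_bounded_support[OF tt] by blast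
  define R where "R = max R0 (max R1 R2)"
  have supp: "\<phi> (x, t) = 0" "\<Psi> (x, t) = 0" if "R \<le> \<bar>x\<bar> \<or> R \<le> \<bar>t\<bar>" for x t
    using that R0 R1 R2 by (auto simp: R_def \<Psi>_def)
  have c\<Psi>: "continuous_on UNIV \<Psi>"
  proof (rule continuous_at_imp_continuous_on, rule ballI)
    fix p
    have "isCont (\<lambda>p. c (fst p) * ?\<phi>t p + v * (c (fst p) * ?\<phi>x p)) p"
      by (intro continuous_intros cutoff_test_function(2)[OF tt \<chi>] cutoff_test_function(2)[OF tx \<chi>])
    then show "isCont \<Psi> p" by (simp add: \<Psi>_def algebra_simps)
  qed
  have big: "r \<le> \<bar>x\<bar> \<or> r \<le> \<bar>t\<bar>" if "2 * r \<le> norm (x, t)" for x t r :: real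
  proof -
    have "norm (x, t) \<le> \<bar>x\<bar> + \<bar>t\<bar>" using norm_Pair_le[of x t] by simp
    then show ?thesis using that by linarith
  qed
  have b\<Psi>: "\<Psi> p = 0" if "2 * R \<le> norm p" for p
    using supp(2) big[of R "fst p" "snd p"] that by (cases p) auto
  have wL: "(\<lambda>p::real \<times> real. d (fst p + (- v) * snd p)) \<in> L2_loc" by (rule L2_loc_plane_wave[OF d])
  show i: "integrable lebesgue (\<lambda>p. d (fst p + (- v) * snd p) * \<Psi> p)"
    by (rule L2_loc_mult_test_integrable[OF wL c\<Psi> b\<Psi>])
  have dm: "(\<lambda>p::real \<times> real. d (fst p + (- v) * snd p)) \<in> borel_measurable borel"
    by (intro measurable_compose[OF _ d(2)] borel_measurable_continuous_onI continuous_intros)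
  \<comment> \<open>\<open>\<Psi>\<close> in the coordinates \<open>(\<xi>, t)\<close> with \<open>\<xi> = x - v t\<close>.\<close>
  define \<Theta> where "\<Theta> p = \<Psi> (fst p + v * snd p, snd p)" for p
  have c\<Theta>: "continuous_on UNIV \<Theta>" unfolding \<Theta>_def
    by (rule continuous_on_compose2[OF c\<Psi>]) (auto intro!: continuous_intros)
  define r where "r = R + \<bar>v\<bar> * R"
  have R: "R \<ge> 0" "R \<le> r" using R0 by (auto simp: R_def r_def)
  have b\<Theta>: "\<Theta> p = 0" if "2 * r \<le> norm p" for p
  proof -
    have "r \<le> \<bar>fst p\<bar> \<or> r \<le> \<bar>snd p\<bar>" using big[of r "fst p" "snd p"] that by simp
    then have "R \<le> \<bar>snd p\<bar> \<or> R \<le> \<bar>fst p + v * snd p\<bar>"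
    proof (cases "R \<le> \<bar>snd p\<bar>")
      case False
      then have "\<bar>v * snd p\<bar> \<le> \<bar>v\<bar> * R" by (simp add: abs_mult mult_left_mono)
      moreover assume "r \<le> \<bar>fst p\<bar> \<or> r \<le> \<bar>snd p\<bar>"
      ultimately show ?thesis using False R unfolding r_def by linarith
    qed simp
    then show ?thesis unfolding \<Theta>_def using supp(2) by blast
  qed
  have dL: "(\<lambda>p::real \<times> real. d (fst p + 0 * snd p)) \<in> L2_loc" by (rule L2_loc_plane_wave[OF d])
  have i': "integrable lebesgue (\<lambda>p. d (fst p) * \<Theta> p)"
    using L2_loc_mult_test_integrable[OF dL c\<Theta> b\<Theta>] by simp
  have "(\<lambda>p::real \<times> real. d (fst p)) \<in> borel_measurable borel"
    by (intro measurable_compose[OF _ d(2)] borel_measurable_continuous_onI continuous_intros)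
  then have m': "(\<lambda>p. d (fst p) * \<Theta> p) \<in> borel_measurable borel"
    using borel_measurable_continuous_onI[OF c\<Theta>] by (intro borel_measurable_times)
  have "(\<integral>p. d (fst p + (- v) * snd p) * \<Psi> p \<partial>lebesgue)
      = (\<integral>t. (\<integral>x. d (x + (- v) * t) * \<Psi> (x, t) \<partial>lebesgue) \<partial>lborel)"
    using lebesgue_integral_plane(1)[OF i] dm borel_measurable_continuous_onI[OF c\<Psi>] by simp
  also have "(\<lambda>t. (\<integral>x. d (x + (- v) * t) * \<Psi> (x, t) \<partial>lebesgue)) = (\<lambda>t. (\<integral>x. d x * \<Theta> (x, t) \<partial>lebesgue))"
  proof
    fix t
    show "(\<integral>x. d (x + (- v) * t) * \<Psi> (x, t) \<partial>lebesgue) = (\<integral>x. d x * \<Theta> (x, t) \<partial>lebesgue)"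
      by (subst lebesgue_integral_real_affine[of 1 _ "v * t"]) (simp_all add: \<Theta>_def add.commute)
  qed
  also have "(\<integral>t. (\<integral>x. d x * \<Theta> (x, t) \<partial>lebesgue) \<partial>lborel) = (\<integral>p. d (fst p) * \<Theta> p \<partial>lebesgue)"
    using lebesgue_integral_plane(1)[OF i' m'] by simp
  also have "\<dots> = (\<integral>x. (\<integral>t. d x * \<Theta> (x, t) \<partial>lebesgue) \<partial>lborel)"
    using lebesgue_integral_plane(2)[OF i' m'] by simp
  also have "(\<lambda>x. (\<integral>t. d x * \<Theta> (x, t) \<partial>lebesgue)) = (\<lambda>x. 0)"
  proof
    fix x
    have one: "primitive_on UNIV (\<lambda>t. d x) (\<lambda>t. 0)" by (rule primitive_onI) simp_all
    have "(\<integral>t. d x * \<Theta> (x, t) \<partial>lebesgue) = - (\<integral>t. 0 * (c (x + v * t) * \<phi> (x + v * t, t)) \<partial>lebesgue)"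
    proof (rule integration_by_parts_compact_support[OF one, where R = R])
      show "((\<lambda>t. c (x + v * t) * \<phi> (x + v * t, t)) has_real_derivative \<Theta> (x, t)) (at t)" for t
      proof -
        have "((\<lambda>t. (x + v * t, t)) has_derivative (\<lambda>h. (v * h, h))) (at t)"
          by (auto intro!: derivative_eq_intros)
        from has_derivative_compose[OF this cutoff_test_function(1)[OF \<phi> \<chi>]]
        have "((\<lambda>t. c (x + v * t) * \<phi> (x + v * t, t)) has_derivative
            (\<lambda>h. v * h * (c (x + v * t) * ?\<phi>x (x + v * t, t)) + h * (c (x + v * t) * ?\<phi>t (x + v * t, t)))) (at t)"
          by simp
        then show ?thesis
          by (rule has_derivative_imp_has_field_derivative) (simp add: \<Theta>_def \<Psi>_def algebra_simps)
      qed
      show "continuous_on UNIV (\<lambda>t. \<Theta> (x, t))"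
        by (rule continuous_on_compose2[OF c\<Theta>]) (auto intro!: continuous_intros)
    qed (use supp in \<open>auto simp: \<Theta>_def\<close>)
    then show "(\<integral>t. d x * \<Theta> (x, t) \<partial>lebesgue) = 0" by simp
  qed
  finally show "(\<integral>p. d (fst p + (- v) * snd p) * \<Psi> p \<partial>lebesgue) = 0" by simp
qed

text \<open>Since the two sides agree on \<open>x = 0\<close>, the function is absolutely continuous on every horizontal and every
vertical line, and its weak derivatives are the glued ones. In the wave equation one derivative is moved back from the test
function to \<open>u\<close>; what remains is a sum of four transport terms, two for each side, and each of them vanishes.\<close>

lemma dAlembert_glued:
  fixes fp gp fm gm dfp dgp dfm dgm :: "real \<Rightarrow> real" and a \<mu> \<kappa> :: real
  assumes P: "primitive_on UNIV fp dfp" "primitive_on UNIV gp dgp" "primitive_on UNIV fm dfm" "primitive_on UNIV gm dgm"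
    and L: "dfp \<in> L2_loc" "dgp \<in> L2_loc" "dfm \<in> L2_loc" "dgm \<in> L2_loc"
    and match: "\<And>t. fp (- a * t) + gp (a * t) = fm (- a * t) + gm (a * t)"
    and \<kappa>: "\<kappa> = \<mu> * a\<^sup>2"
  defines "u \<equiv> \<lambda>p. if 0 \<le> fst p then fp (fst p - a * snd p) + gp (fst p + a * snd p)
                   else fm (fst p - a * snd p) + gm (fst p + a * snd p)"
  shows "u \<in> class_E" and "wave_eq \<mu> \<kappa> u"
proof -
  obtain bfp where bfp: "primitive_on UNIV fp bfp" "bfp \<in> L2_loc" "bfp \<in> borel_measurable borel"
    by (rule primitive_borel_representative[OF P(1) L(1)])
  obtain bgp where bgp: "primitive_on UNIV gp bgp" "bgp \<in> L2_loc" "bgp \<in> borel_measurable borel"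
    by (rule primitive_borel_representative[OF P(2) L(2)])
  obtain bfm where bfm: "primitive_on UNIV fm bfm" "bfm \<in> L2_loc" "bfm \<in> borel_measurable borel"
    by (rule primitive_borel_representative[OF P(3) L(3)])
  obtain bgm where bgm: "primitive_on UNIV gm bgm" "bgm \<in> L2_loc" "bgm \<in> borel_measurable borel"
    by (rule primitive_borel_representative[OF P(4) L(4)])
  \<comment> \<open>\<open>w 1 1\<close> will be the derivative in \<open>x\<close>, and \<open>w (-a) a\<close> the derivative in \<open>t\<close>.\<close>
  define w where "w \<alpha> \<beta> p = (if 0 \<le> fst p
      then \<alpha> * bfp (fst p + (-a) * snd p) + \<beta> * bgp (fst p + a * snd p)
      else \<alpha> * bfm (fst p + (-a) * snd p) + \<beta> * bgm (fst p + a * snd p))" for \<alpha> \<beta> and p :: "real \<times> real"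
  have comp: "(\<lambda>p::real \<times> real. e (fst p + s * snd p)) \<in> borel_measurable borel"
    if "e \<in> borel_measurable borel" for e :: "real \<Rightarrow> real" and s
    by (intro measurable_compose[OF _ that] borel_measurable_continuous_onI continuous_intros)
  have half: "{p::real \<times> real. 0 \<le> fst p} \<in> sets borel"
    by (intro borel_closed closed_Collect_le continuous_intros)
  have wL: "w \<alpha> \<beta> \<in> L2_loc" for \<alpha> \<beta>
    unfolding w_def using half
    by (intro L2_loc_If L2_loc_lin L2_loc_plane_wave bfp bgp bfm bgm) simp
  have wm: "w \<alpha> \<beta> \<in> borel_measurable borel" for \<alpha> \<beta>
    unfolding w_def
    by (intro measurable_If borel_measurable_add borel_measurable_times borel_measurable_const
        comp bfp(3) bgp(3) bfm(3) bgm(3)) (use half in simp)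
  have cont: "continuous_on UNIV fp" "continuous_on UNIV gp" "continuous_on UNIV fm" "continuous_on UNIV gm"
    using P primitive_on_UNIV_continuous by blast+
  have cu: "continuous_on UNIV u"
  proof -
    have c: "continuous_on S (\<lambda>p::real \<times> real. e (fst p + s * snd p))" if "continuous_on UNIV e" for e :: "real \<Rightarrow> real" and s S
      by (rule continuous_on_compose2[OF that]) (auto intro!: continuous_intros)
    have c': "continuous_on S (\<lambda>p::real \<times> real. e (fst p - s * snd p))" if "continuous_on UNIV e" for e :: "real \<Rightarrow> real" and s S
      using c[OF that, of S "-s"] by simp
    have "continuous_on UNIV (\<lambda>p. if fst p \<le> 0 then fm (fst p + (-a) * snd p) + gm (fst p + a * snd p)
                   else fp (fst p + (-a) * snd p) + gp (fst p + a * snd p))"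
      by (rule continuous_on_cases_le[where h = fst and a = 0])
         (use match in \<open>auto intro!: continuous_intros c c' cont\<close>)
    moreover have "(\<lambda>p. if fst p \<le> 0 then fm (fst p + (-a) * snd p) + gm (fst p + a * snd p)
                   else fp (fst p + (-a) * snd p) + gp (fst p + a * snd p)) = u"
      using match by (auto simp: u_def fun_eq_iff)
    ultimately show ?thesis by (simp only:)
  qed
  have ux: "has_weak_deriv (1, 0) u (w 1 1)"
  proof (rule fibrewise_primitive_imp_weak_deriv(1)[OF cu wL wm])
    fix t
    have p: "primitive_on S (\<lambda>x. 1 * f (- a * t + 1 * x) + 1 * g (a * t + 1 * x)) (\<lambda>x. 1 * (1 * df (- a * t + 1 * x)) + 1 * (1 * dg (a * t + 1 * x)))"
      if "primitive_on UNIV f df" "primitive_on UNIV g dg" for f g df dg S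
      by (rule primitive_on_subset[OF primitive_on_lin[OF primitive_on_affine[OF that(1)] primitive_on_affine[OF that(2)]]]) simp
    show "primitive_on UNIV (\<lambda>x. u (x, t)) (\<lambda>x. w 1 1 (x, t))"
      by (rule primitive_on_cong[OF primitive_on_glue[OF p[OF bfp(1) bgp(1)] p[OF bfm(1) bgm(1)]]])
         (use match in \<open>auto simp: u_def w_def add.commute\<close>)
  qed
  have ut: "has_weak_deriv (0, 1) u (w (-a) a)"
  proof (rule fibrewise_primitive_imp_weak_deriv(2)[OF cu wL wm])
    fix x
    have p: "primitive_on UNIV (\<lambda>t. 1 * f (x + (-a) * t) + 1 * g (x + a * t)) (\<lambda>t. 1 * ((-a) * df (x + (-a) * t)) + 1 * (a * dg (x + a * t)))"
      if "primitive_on UNIV f df" "primitive_on UNIV g dg" for f g df dg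
      by (rule primitive_on_lin[OF primitive_on_affine[OF that(1)] primitive_on_affine[OF that(2)]])
    show "primitive_on UNIV (\<lambda>t. u (x, t)) (\<lambda>t. w (-a) a (x, t))"
    proof (cases "0 \<le> x")
      case True
      show ?thesis by (rule primitive_on_cong[OF p[OF bfp(1) bgp(1)]]) (use True in \<open>auto simp: u_def w_def\<close>)
    next
      case False
      show ?thesis by (rule primitive_on_cong[OF p[OF bfm(1) bgm(1)]]) (use False in \<open>auto simp: u_def w_def\<close>)
    qed
  qed
  show "u \<in> class_E" unfolding class_E_def using cu ux ut wL by blast
  show "wave_eq \<mu> \<kappa> u" unfolding wave_eq_def
  proof
    fix \<phi> :: "real \<times> real \<Rightarrow> real" assume \<phi>: "\<phi> \<in> test_functions {p. fst p \<noteq> 0}"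
    let ?\<phi>x = "dir_deriv (1, 0) \<phi>" and ?\<phi>t = "dir_deriv (0, 1) \<phi>"
    have tx: "?\<phi>x \<in> test_functions {p. fst p \<noteq> 0}" and tt: "?\<phi>t \<in> test_functions {p. fst p \<noteq> 0}"
      using test_function_plane(2,3)[OF \<phi>] .
    have txx: "dir_deriv (1, 0) ?\<phi>x \<in> test_functions {p. fst p \<noteq> 0}" using test_function_plane(2)[OF tx] .
    have ttt: "dir_deriv (0, 1) ?\<phi>t \<in> test_functions {p. fst p \<noteq> 0}" using test_function_plane(3)[OF tt] .
    have int: "integrable lebesgue (\<lambda>p. h p * \<psi> p)" if h: "h \<in> L2_loc" and \<psi>: "\<psi> \<in> test_functions {p. fst p \<noteq> 0}"
      for h \<psi> :: "real \<times> real \<Rightarrow> real"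
    proof -
      obtain R where "\<forall>x. R \<le> norm x \<longrightarrow> \<psi> x = 0" using test_function_bounded_support[OF \<psi>] by blast
      then show ?thesis
        by (intro L2_loc_mult_test_integrable[OF h test_function_plane(4)[OF \<psi>], of R]) auto
    qed
    note uL = L2_loc_continuous[OF cu]
    \<comment> \<open>Cutoffs to the right and to the left half-plane.\<close>
    let ?P = "\<lambda>x::real. if 0 \<le> x then 1 else 0 :: real" and ?M = "\<lambda>x::real. if 0 \<le> x then 0 else 1 :: real"
    have loc: "\<exists>S. open S \<and> x \<in> S \<and> (\<forall>y\<in>S. (0 \<le> y) = (0 \<le> x))" if "x \<noteq> 0" for x :: real
      using that by (cases "x > 0") (auto intro: exI[of _ "{0<..}"] exI[of _ "{..<0}"])
    have lP: "\<forall>x. x \<noteq> 0 \<longrightarrow> (\<exists>S. open S \<and> x \<in> S \<and> (\<forall>y\<in>S. ?P y = ?P x))"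
      using loc by metis
    have lM: "\<forall>x. x \<noteq> 0 \<longrightarrow> (\<exists>S. open S \<and> x \<in> S \<and> (\<forall>y\<in>S. ?M y = ?M x))"
      using loc by metis
    define T where "T e c v p = e (fst p + (- v) * snd p) * (c (fst p) * (?\<phi>t p + v * ?\<phi>x p))"
      for e c :: "real \<Rightarrow> real" and v p
    have T1: "integrable lebesgue (\<lambda>p. T bfp ?P a p)" "(\<integral>p. T bfp ?P a p \<partial>lebesgue) = 0"
      unfolding T_def[abs_def] by (rule transport_orthogonal[OF bfp(2,3) \<phi> lP])+
    have T2: "integrable lebesgue (\<lambda>p. T bfm ?M a p)" "(\<integral>p. T bfm ?M a p \<partial>lebesgue) = 0"
      unfolding T_def[abs_def] by (rule transport_orthogonal[OF bfm(2,3) \<phi> lM])+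
    have T3: "integrable lebesgue (\<lambda>p. T bgp ?P (-a) p)" "(\<integral>p. T bgp ?P (-a) p \<partial>lebesgue) = 0"
      unfolding T_def[abs_def] by (rule transport_orthogonal[OF bgp(2,3) \<phi> lP])+
    have T4: "integrable lebesgue (\<lambda>p. T bgm ?M (-a) p)" "(\<integral>p. T bgm ?M (-a) p \<partial>lebesgue) = 0"
      unfolding T_def[abs_def] by (rule transport_orthogonal[OF bgm(2,3) \<phi> lM])+
    have pt: "\<kappa> * (w 1 1 p * ?\<phi>x p) - \<mu> * (w (-a) a p * ?\<phi>t p)
        = \<mu> * a * (T bfp ?P a p + T bfm ?M a p - T bgp ?P (-a) p - T bgm ?M (-a) p)" for p
      unfolding T_def w_def \<kappa> by (cases "0 \<le> fst p") (simp_all add: algebra_simps power2_eq_square)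
    have "(\<integral>p. u p * (\<mu> * dir_deriv (0, 1) ?\<phi>t p - \<kappa> * dir_deriv (1, 0) ?\<phi>x p) \<partial>lebesgue)
       = (\<integral>p. \<mu> * (u p * dir_deriv (0, 1) ?\<phi>t p) - \<kappa> * (u p * dir_deriv (1, 0) ?\<phi>x p) \<partial>lebesgue)"
      by (simp add: algebra_simps)
    also have "\<dots> = \<mu> * (\<integral>p. u p * dir_deriv (0, 1) ?\<phi>t p \<partial>lebesgue) - \<kappa> * (\<integral>p. u p * dir_deriv (1, 0) ?\<phi>x p \<partial>lebesgue)"
      using int[OF uL ttt] int[OF uL txx] by simp
    also have "\<dots> = \<kappa> * (\<integral>p. w 1 1 p * ?\<phi>x p \<partial>lebesgue) - \<mu> * (\<integral>p. w (-a) a p * ?\<phi>t p \<partial>lebesgue)"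
      using ux ut test_functions_mono[OF tx] test_functions_mono[OF tt] by (simp add: has_weak_deriv_def)
    also have "\<dots> = (\<integral>p. \<kappa> * (w 1 1 p * ?\<phi>x p) - \<mu> * (w (-a) a p * ?\<phi>t p) \<partial>lebesgue)"
      using int[OF wL tx] int[OF wL tt] by simp
    also have "\<dots> = (\<integral>p. \<mu> * a * (T bfp ?P a p + T bfm ?M a p - T bgp ?P (-a) p - T bgm ?M (-a) p) \<partial>lebesgue)"
      unfolding pt ..
    also have "\<dots> = 0" using T1 T2 T3 T4 by simp
    finally show "(\<integral>p. u p * (\<mu> * dir_deriv (0, 1) ?\<phi>t p - \<kappa> * dir_deriv (1, 0) ?\<phi>x p) \<partial>lebesgue) = 0" .
  qed
qed

section \<open>Volterra equations and the oscillator for positive times\<close>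

text \<open>One Picard step raises the power and the factorial by one; both uniqueness and existence below rest on the summability
of these bounds.\<close>

lemma volterra_iterate_bound:
  fixes g :: "real \<Rightarrow> real"
  assumes g: "continuous_on {0..T} g" "\<And>s. s \<in> {0..T} \<Longrightarrow> \<bar>g s\<bar> \<le> A * (C * s) ^ n / fact n"
    and C: "C \<ge> 0" and t: "t \<in> {0..T}"
  shows "C * integral {0..t} (\<lambda>s. \<bar>g s\<bar>) \<le> A * (C * t) ^ Suc n / fact (Suc n)"
proof -
  let ?P = "\<lambda>s. A * C ^ n * s ^ Suc n / fact (Suc n)"
  have "((\<lambda>s. A * (C * s) ^ n / fact n) has_integral (?P t - ?P 0)) {0..t}"
  proof (rule fundamental_theorem_of_calculus)
    fix x :: real
    have "(?P has_real_derivative (A * C ^ n * (real (Suc n) * x ^ n) / fact (Suc n))) (at x within {0..t})"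
      by (intro derivative_eq_intros | simp)+
    moreover have "A * C ^ n * (real (Suc n) * x ^ n) / fact (Suc n) = A * (C * x) ^ n / fact n"
      by (simp add: power_mult_distrib fact_Suc del: of_nat_Suc)
    ultimately show "(?P has_vector_derivative A * (C * x) ^ n / fact n) (at x within {0..t})"
      by (simp only: has_real_derivative_iff_has_vector_derivative)
  qed (use t in simp)
  then have H: "((\<lambda>s. A * (C * s) ^ n / fact n) has_integral ?P t) {0..t}" by simp
  note I = has_integral_integrable[OF H] integral_unique[OF H]
  have "integral {0..t} (\<lambda>s. \<bar>g s\<bar>) \<le> ?P t"
    unfolding I(2)[symmetric]
  proof (rule integral_le)
    show "(\<lambda>s. \<bar>g s\<bar>) integrable_on {0..t}"
      using t by (intro integrable_continuous_real continuous_intros continuous_on_subset[OF g(1)]) auto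
  qed (use I g t in auto)
  then have "C * integral {0..t} (\<lambda>s. \<bar>g s\<bar>) \<le> C * ?P t" using C by (rule mult_left_mono)
  also have "C * ?P t = A * (C * t) ^ Suc n / fact (Suc n)" by (simp add: power_mult_distrib field_simps)
  finally show ?thesis .
qed

lemma gronwall_zero:
  fixes g :: "real \<Rightarrow> real"
  assumes g: "continuous_on {0..T} g" and C: "C \<ge> 0"
    and bd: "\<And>t. t \<in> {0..T} \<Longrightarrow> \<bar>g t\<bar> \<le> C * integral {0..t} (\<lambda>s. \<bar>g s\<bar>)"
    and t: "t \<in> {0..T}"
  shows "g t = 0"
proof -
  have "bounded (g ` {0..T})" using g compact_continuous_image compact_imp_bounded by blast
  then obtain A where "\<forall>y\<in>g ` {0..T}. norm y \<le> A" unfolding bounded_iff by blast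
  then have A: "\<bar>g s\<bar> \<le> A" if "s \<in> {0..T}" for s using that by fastforce
  have it: "\<forall>s\<in>{0..T}. \<bar>g s\<bar> \<le> A * (C * s) ^ n / fact n" for n
  proof (induction n)
    case 0 then show ?case using A by simp
  next
    case (Suc n)
    show ?case
    proof
      fix s assume s: "s \<in> {0..T}"
      have "\<bar>g s\<bar> \<le> C * integral {0..s} (\<lambda>s. \<bar>g s\<bar>)" by (rule bd[OF s])
      also have "\<dots> \<le> A * (C * s) ^ Suc n / fact (Suc n)"
        by (rule volterra_iterate_bound[OF g _ C s]) (use Suc in blast)
      finally show "\<bar>g s\<bar> \<le> A * (C * s) ^ Suc n / fact (Suc n)" .
    qed
  qed
  have "(\<lambda>n. A * (inverse (fact n) * (C * t) ^ n)) \<longlonglongrightarrow> A * 0"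
    by (intro tendsto_mult tendsto_const summable_LIMSEQ_zero summable_exp)
  then have "(\<lambda>n. A * (C * t) ^ n / fact n) \<longlonglongrightarrow> 0" by (simp add: field_simps)
  then have "\<bar>g t\<bar> \<le> 0" by (rule LIMSEQ_le_const) (use it t in blast)
  then show ?thesis by simp
qed

lemma volterra_fixed_point:
  fixes K :: "(real \<Rightarrow> real) \<Rightarrow> real \<Rightarrow> real"
  assumes L: "L \<ge> 0"
    and cK: "\<And>y. continuous_on {0..T} y \<Longrightarrow> continuous_on {0..T} (K y)"
    and lip: "\<And>y z t. continuous_on {0..T} y \<Longrightarrow> continuous_on {0..T} z \<Longrightarrow> t \<in> {0..T} \<Longrightarrow>
        \<bar>K y t - K z t\<bar> \<le> L * integral {0..t} (\<lambda>s. \<bar>y s - z s\<bar>)"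
  shows "\<exists>y. continuous_on {0..T} y \<and> (\<forall>t\<in>{0..T}. y t = K y t)"
proof -
  define Y where "Y n = (K ^^ n) (\<lambda>_. 0)" for n
  have Y0: "Y 0 = (\<lambda>_. 0)" and YS: "Y (Suc n) = K (Y n)" for n by (simp_all add: Y_def)
  have cY: "continuous_on {0..T} (Y n)" for n by (induction n) (auto simp: Y0 YS intro: cK)
  have "bounded (Y 1 ` {0..T})" using cY compact_continuous_image compact_imp_bounded by blast
  then obtain A where "\<forall>y\<in>Y 1 ` {0..T}. norm y \<le> A" unfolding bounded_iff by blast
  then have A: "\<bar>Y 1 s\<bar> \<le> A" if "s \<in> {0..T}" for s using that by fastforce
  have it: "\<forall>s\<in>{0..T}. \<bar>Y (Suc n) s - Y n s\<bar> \<le> A * (L * s) ^ n / fact n" for n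
  proof (induction n)
    case 0 then show ?case using A by (simp add: Y0)
  next
    case (Suc n)
    show ?case
    proof
      fix s assume s: "s \<in> {0..T}"
      have "\<bar>Y (Suc (Suc n)) s - Y (Suc n) s\<bar> \<le> L * integral {0..s} (\<lambda>r. \<bar>Y (Suc n) r - Y n r\<bar>)"
        unfolding YS[of "Suc n"] YS[of n] using lip[OF cY[of "Suc n"] cY[of n] s] by (simp add: YS)
      also have "\<dots> \<le> A * (L * s) ^ Suc n / fact (Suc n)"
        by (rule volterra_iterate_bound[OF _ _ L s]) (use Suc in \<open>auto intro!: continuous_intros cY\<close>)
      finally show "\<bar>Y (Suc (Suc n)) s - Y (Suc n) s\<bar> \<le> A * (L * s) ^ Suc n / fact (Suc n)" .
    qed
  qed
  have bd: "norm (Y (Suc n) s - Y n s) \<le> \<bar>A\<bar> * (inverse (fact n) * (L * T) ^ n)" if s: "s \<in> {0..T}" for n s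
  proof -
    have "(L * s) ^ n \<le> (L * T) ^ n" using s L by (intro power_mono mult_left_mono) auto
    then have "A * (L * s) ^ n / fact n \<le> \<bar>A\<bar> * (L * T) ^ n / fact n"
      using s L by (intro divide_right_mono mult_mono) auto
    then show ?thesis using it[of n] s by (force simp: field_simps)
  qed
  have sm: "summable (\<lambda>n. \<bar>A\<bar> * (inverse (fact n) * (L * T) ^ n))"
    by (intro summable_mult summable_exp)
  define y where "y s = (\<Sum>n. Y (Suc n) s - Y n s)" for s
  have "uniform_limit {0..T} (\<lambda>n s. \<Sum>i<n. Y (Suc i) s - Y i s) y sequentially"
    unfolding y_def by (rule Weierstrass_m_test[OF bd sm])
  moreover have "(\<Sum>i<n. Y (Suc i) s - Y i s) = Y n s" for n s
    by (simp add: sum_lessThan_telescope[of "\<lambda>i. Y i s"] Y0)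
  ultimately have ul: "uniform_limit {0..T} Y y sequentially" by (simp add: fun_eq_iff)
  have cy: "continuous_on {0..T} y"
    by (rule uniform_limit_theorem[OF _ ul]) (auto simp: cY)
  have "y t = K y t" if t: "t \<in> {0..T}" for t
  proof -
    have "\<bar>K y t - y t\<bar> \<le> (L * T + 1) * e" if e: "e > 0" for e
    proof -
      obtain N where N: "\<And>n s. n \<ge> N \<Longrightarrow> s \<in> {0..T} \<Longrightarrow> dist (Y n s) (y s) < e"
        using ul e unfolding uniform_limit_sequentially_iff by blast
      have "\<bar>K y t - K (Y N) t\<bar> \<le> L * integral {0..t} (\<lambda>s. \<bar>y s - Y N s\<bar>)" by (rule lip[OF cy cY t])
      also have "integral {0..t} (\<lambda>s. \<bar>y s - Y N s\<bar>) \<le> integral {0..t} (\<lambda>s. e)"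
      proof (rule integral_le)
        show "(\<lambda>s. \<bar>y s - Y N s\<bar>) integrable_on {0..t}"
          using t by (intro integrable_continuous_real continuous_intros continuous_on_subset[OF cy] continuous_on_subset[OF cY]) auto
        show "\<bar>y s - Y N s\<bar> \<le> e" if "s \<in> {0..t}" for s
          using N[of N s] that t by (simp add: dist_real_def abs_minus_commute)
        show "(\<lambda>s. e) integrable_on {0..t}" by (intro integrable_continuous_real continuous_intros)
      qed
      also have "integral {0..t} (\<lambda>s. e) \<le> T * e" using t e by (simp add: mult_right_mono)
      finally have "\<bar>K y t - K (Y N) t\<bar> \<le> L * (T * e)" using L by (simp add: mult_left_mono)
      moreover have "\<bar>K (Y N) t - y t\<bar> < e" using N[of "Suc N" t] t by (simp add: YS dist_real_def)
      ultimately have "\<bar>K y t - y t\<bar> \<le> L * (T * e) + e" by linarith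
      then show ?thesis by (simp add: algebra_simps)
    qed
    note small = this
    have T: "L * T + 1 > 0" using L t by (simp add: add_nonneg_pos)
    have "\<bar>K y t - y t\<bar> \<le> 0 + e" if "e > 0" for e
      using small[of "e / (L * T + 1)"] that T by simp
    then have "\<bar>K y t - y t\<bar> \<le> 0" by (rule field_le_epsilon)
    then show ?thesis by simp
  qed
  with cy show ?thesis by blast
qed

lemma primitive_on_indefinite_integral:
  assumes f: "continuous_on {0..T} f" and h: "\<And>t. t \<in> {0..T} \<Longrightarrow> h t = c + integral {0..t} f"
  shows "primitive_on {0..T} h f"
proof (rule primitive_onI)
  fix s t :: real assume st: "s \<le> t" "{s..t} \<subseteq> {0..T}"
  then have st': "s \<in> {0..T}" "t \<in> {0..T}" by auto
  show "f absolutely_integrable_on {s..t}"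
    by (rule absolutely_integrable_continuous_real[OF continuous_on_subset[OF f st(2)]])
  have "integral {0..s} f + integral {s..t} f = integral {0..t} f"
    using st st' by (intro Henstock_Kurzweil_Integration.integral_combine integrable_continuous_real continuous_on_subset[OF f]) auto
  then show "integral {s..t} f = h t - h s" using h[OF st'(1)] h[OF st'(2)] by simp
qed

text \<open>The momentum \<open>m y'\<close> obtained by integrating the force balance once for positive times: the damping force
\<open>- b (y' - D')\<close> integrates to \<open>- b (y - D)\<close> because \<open>y 0 = D 0\<close>.\<close>

definition momentum :: "real \<Rightarrow> real \<Rightarrow> (real \<Rightarrow> real) \<Rightarrow> (real \<Rightarrow> real) \<Rightarrow> real \<Rightarrow> (real \<Rightarrow> real) \<Rightarrow> real \<Rightarrow> real" where
  "momentum m b F D y1 y t = m * y1 + integral {0..t} (\<lambda>s. F (y s)) - b * (y t - D t)"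

text \<open>The force balance integrated twice, on \<open>{0..T}\<close>. For \<open>m = 0\<close> the balance is of first order and says
that the momentum vanishes, which is recorded as a separate clause.\<close>

definition half_sol :: "real \<Rightarrow> real \<Rightarrow> (real \<Rightarrow> real) \<Rightarrow> (real \<Rightarrow> real) \<Rightarrow> real \<Rightarrow> real \<Rightarrow> (real \<Rightarrow> real) \<Rightarrow> bool" where
  "half_sol m b F D y1 T y \<longleftrightarrow> continuous_on {0..T} y \<and> y 0 = D 0 \<and>
     (\<forall>t\<in>{0..T}. m * (y t - D 0) = integral {0..t} (momentum m b F D y1 y)) \<and>
     (m = 0 \<longrightarrow> (\<forall>t\<in>{0..T}. momentum m b F D y1 y t = 0))"

lemma momentum_continuous:
  assumes "continuous_on {0..T} y" "continuous_on {0..T} (\<lambda>t. F (y t))" "continuous_on UNIV D"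
  shows "continuous_on {0..T} (momentum m b F D y1 y)"
proof -
  have "continuous_on {0..T} (\<lambda>t. integral {0..t} (\<lambda>s. F (y s)))"
    by (intro indefinite_integral_continuous_1 integrable_continuous_real assms(2))
  then show ?thesis
    unfolding momentum_def[abs_def] by (intro continuous_intros assms(1) continuous_on_subset[OF assms(3)]) auto
qed

lemma momentum_difference:
  assumes y: "continuous_on {0..T} y" "continuous_on {0..T} (\<lambda>t. F (y t))"
    and z: "continuous_on {0..T} z" "continuous_on {0..T} (\<lambda>t. F (z t))"
    and D: "continuous_on UNIV D" and b: "b \<ge> 0" and \<Lambda>: "\<Lambda> \<ge> 0"
    and lip: "\<And>s. s \<in> {0..T} \<Longrightarrow> \<bar>F (y s) - F (z s)\<bar> \<le> \<Lambda> * \<bar>y s - z s\<bar>" and t: "t \<in> {0..T}"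
  shows "\<bar>integral {0..t} (\<lambda>s. F (y s)) - integral {0..t} (\<lambda>s. F (z s))\<bar> \<le> \<Lambda> * integral {0..t} (\<lambda>s. \<bar>y s - z s\<bar>)" (is ?one)
    and "\<bar>integral {0..t} (momentum m b F D y1 y) - integral {0..t} (momentum m b F D y1 z)\<bar>
      \<le> (\<Lambda> * T + b) * integral {0..t} (\<lambda>s. \<bar>y s - z s\<bar>)"
proof -
  have sub: "{0..s} \<subseteq> {0..T}" if "s \<in> {0..T}" for s using that by auto
  have int: "f integrable_on {0..s}" if "continuous_on {0..T} f" "s \<in> {0..T}" for f :: "real \<Rightarrow> real" and s
    by (rule integrable_continuous_real[OF continuous_on_subset[OF that(1) sub[OF that(2)]]])
  have cd: "continuous_on {0..T} (\<lambda>s. \<bar>y s - z s\<bar>)" by (intro continuous_intros y z)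
  have one: "\<bar>integral {0..t} (\<lambda>s. F (y s)) - integral {0..t} (\<lambda>s. F (z s))\<bar> \<le> \<Lambda> * integral {0..t} (\<lambda>s. \<bar>y s - z s\<bar>)"
    if t: "t \<in> {0..T}" for t
  proof -
    have "integral {0..t} (\<lambda>s. F (y s)) - integral {0..t} (\<lambda>s. F (z s)) = integral {0..t} (\<lambda>s. F (y s) - F (z s))"
      by (rule Henstock_Kurzweil_Integration.integral_diff[symmetric]) (intro int y z t)+
    also have "norm \<dots> \<le> integral {0..t} (\<lambda>s. \<Lambda> * \<bar>y s - z s\<bar>)"
    proof (rule integral_norm_bound_integral)
      show "(\<lambda>s. F (y s) - F (z s)) integrable_on {0..t}" by (intro int continuous_intros y z t)
      show "(\<lambda>s. \<Lambda> * \<bar>y s - z s\<bar>) integrable_on {0..t}" by (intro int continuous_intros y z t)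
      show "norm (F (y s) - F (z s)) \<le> \<Lambda> * \<bar>y s - z s\<bar>" if "s \<in> {0..t}" for s
        using lip[of s] sub[OF t] that by auto
    qed
    finally show ?thesis by simp
  qed
  show ?one by (rule one[OF t])
  have cM: "continuous_on {0..T} (momentum m b F D y1 y)" "continuous_on {0..T} (momentum m b F D y1 z)"
    using momentum_continuous y z D by blast+
  define J where "J = integral {0..t} (\<lambda>s. \<bar>y s - z s\<bar>)"
  have eq: "integral {0..t} (momentum m b F D y1 y) - integral {0..t} (momentum m b F D y1 z)
      = integral {0..t} (\<lambda>s. momentum m b F D y1 y s - momentum m b F D y1 z s)"
    by (rule Henstock_Kurzweil_Integration.integral_diff[symmetric]) (intro int cM t)+
  have le: "norm (integral {0..t} (\<lambda>s. momentum m b F D y1 y s - momentum m b F D y1 z s))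
      \<le> integral {0..t} (\<lambda>s. \<Lambda> * J + b * \<bar>y s - z s\<bar>)"
  proof (rule integral_norm_bound_integral)
    show "(\<lambda>s. momentum m b F D y1 y s - momentum m b F D y1 z s) integrable_on {0..t}"
      by (intro int continuous_intros cM t)
    show "(\<lambda>s. \<Lambda> * J + b * \<bar>y s - z s\<bar>) integrable_on {0..t}" by (intro int continuous_intros y z t)
    fix s assume s: "s \<in> {0..t}"
    then have sT: "s \<in> {0..T}" using t by auto
    have "integral {0..s} (\<lambda>s. \<bar>y s - z s\<bar>) \<le> J"
      unfolding J_def using s t sT by (intro integral_subset_le int cd) auto
    then have "\<Lambda> * integral {0..s} (\<lambda>s. \<bar>y s - z s\<bar>) \<le> \<Lambda> * J" using \<Lambda> by (rule mult_left_mono)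
    then have 1: "\<bar>integral {0..s} (\<lambda>s. F (y s)) - integral {0..s} (\<lambda>s. F (z s))\<bar> \<le> \<Lambda> * J"
      using one[OF sT] by linarith
    have 2: "\<bar>b * (y s - z s)\<bar> = b * \<bar>y s - z s\<bar>" using b by (simp add: abs_mult)
    have "momentum m b F D y1 y s - momentum m b F D y1 z s
        = (integral {0..s} (\<lambda>s. F (y s)) - integral {0..s} (\<lambda>s. F (z s))) - b * (y s - z s)"
      by (simp add: momentum_def algebra_simps)
    then show "norm (momentum m b F D y1 y s - momentum m b F D y1 z s) \<le> \<Lambda> * J + b * \<bar>y s - z s\<bar>"
      using 1 2 unfolding real_norm_def by linarith
  qed
  have "integral {0..t} (\<lambda>s. \<Lambda> * J + b * \<bar>y s - z s\<bar>)
      = integral {0..t} (\<lambda>s. \<Lambda> * J) + integral {0..t} (\<lambda>s. b * \<bar>y s - z s\<bar>)"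
  proof (rule Henstock_Kurzweil_Integration.integral_add)
    show "(\<lambda>s. \<Lambda> * J) integrable_on {0..t}" by (rule integrable_const_ivl)
    show "(\<lambda>s. b * \<bar>y s - z s\<bar>) integrable_on {0..t}" by (rule integrable_on_mult_right[OF int[OF cd t]])
  qed
  also have "\<dots> = \<Lambda> * J * t + b * J"
  proof -
    have "integral {0..t} (\<lambda>s. \<Lambda> * J) = \<Lambda> * J * t" using t by (simp add: mult.commute)
    moreover have "integral {0..t} (\<lambda>s. b * \<bar>y s - z s\<bar>) = b * J" by (simp add: J_def)
    ultimately show ?thesis by (rule arg_cong2)
  qed
  also have "\<dots> \<le> \<Lambda> * J * T + b * J"
  proof -
    have "J \<ge> 0" unfolding J_def by (intro Henstock_Kurzweil_Integration.integral_nonneg int cd t) auto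
    then have "\<Lambda> * J * t \<le> \<Lambda> * J * T" using t \<Lambda> by (intro mult_left_mono) auto
    then show ?thesis by (rule add_right_mono)
  qed
  finally have "integral {0..t} (\<lambda>s. \<Lambda> * J + b * \<bar>y s - z s\<bar>) \<le> (\<Lambda> * T + b) * J"
    by (simp add: algebra_simps)
  with le show "\<bar>integral {0..t} (momentum m b F D y1 y) - integral {0..t} (momentum m b F D y1 z)\<bar>
      \<le> (\<Lambda> * T + b) * integral {0..t} (\<lambda>s. \<bar>y s - z s\<bar>)"
    unfolding eq J_def real_norm_def by (rule order_trans)
qed

lemma half_sol_unique:
  assumes y: "half_sol m b F D y1 T y" and z: "half_sol m b F D y1 T z"
    and F: "continuous_on UNIV F" and D: "continuous_on UNIV D" and b: "b > 0" and m: "m \<ge> 0"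
    and lip: "\<And>R. \<exists>\<Lambda>\<ge>0. \<forall>x\<in>{-R..R}. \<forall>y\<in>{-R..R}. \<bar>F x - F y\<bar> \<le> \<Lambda> * \<bar>x - y\<bar>"
    and t: "t \<in> {0..T}"
  shows "y t = z t"
proof -
  have cy: "continuous_on {0..T} y" and cz: "continuous_on {0..T} z" using y z by (auto simp: half_sol_def)
  have cFy: "continuous_on {0..T} (\<lambda>t. F (y t))" and cFz: "continuous_on {0..T} (\<lambda>t. F (z t))"
    by (rule continuous_on_compose2[OF F cy], simp, rule continuous_on_compose2[OF F cz], simp)
  have "bounded (y ` {0..T} \<union> z ` {0..T})"
    unfolding bounded_Un using cy cz compact_continuous_image compact_imp_bounded by blast
  then obtain R where R: "\<forall>x\<in>y ` {0..T} \<union> z ` {0..T}. norm x \<le> R" unfolding bounded_iff by blast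
  obtain \<Lambda> where \<Lambda>: "\<Lambda> \<ge> 0" "\<forall>x\<in>{-R..R}. \<forall>y\<in>{-R..R}. \<bar>F x - F y\<bar> \<le> \<Lambda> * \<bar>x - y\<bar>" using lip[of R] by blast
  have L: "\<bar>F (y s) - F (z s)\<bar> \<le> \<Lambda> * \<bar>y s - z s\<bar>" if s: "s \<in> {0..T}" for s
  proof -
    have "norm (y s) \<le> R" "norm (z s) \<le> R" using R s by auto
    then have "y s \<in> {-R..R}" "z s \<in> {-R..R}" by (auto simp: abs_le_iff)
    then show ?thesis using \<Lambda>(2) by blast
  qed
  note MD = momentum_difference[OF cy cFy cz cFz D less_imp_le[OF b] \<Lambda>(1) L]
  define C where "C = (if m = 0 then \<Lambda> / b else (\<Lambda> * T + b) / m)"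
  have T0: "T \<ge> 0" using t by simp
  have "y t - z t = 0"
  proof (rule gronwall_zero[OF _ _ _ t, of "\<lambda>t. y t - z t" C])
    show "continuous_on {0..T} (\<lambda>t. y t - z t)" by (intro continuous_intros cy cz)
    show "C \<ge> 0" using \<Lambda> b m T0 by (auto simp: C_def)
    fix s assume s: "s \<in> {0..T}"
    show "\<bar>y s - z s\<bar> \<le> C * integral {0..s} (\<lambda>s. \<bar>y s - z s\<bar>)"
    proof (cases "m = 0")
      case True
      then have "momentum m b F D y1 y s = 0" "momentum m b F D y1 z s = 0" using y z s by (auto simp: half_sol_def)
      then have "b * (y s - z s) = integral {0..s} (\<lambda>s. F (y s)) - integral {0..s} (\<lambda>s. F (z s))"
        unfolding momentum_def by (simp add: algebra_simps)
      then have "\<bar>b * (y s - z s)\<bar> \<le> \<Lambda> * integral {0..s} (\<lambda>s. \<bar>y s - z s\<bar>)" using MD(1)[OF _ s] by simp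
      moreover have "\<bar>b * (y s - z s)\<bar> = b * \<bar>y s - z s\<bar>" using b by (simp add: abs_mult)
      ultimately show ?thesis using True b by (simp add: C_def le_divide_eq mult.commute)
    next
      case False
      then have mp: "m > 0" using m by simp
      have "m * (y s - D 0) = integral {0..s} (momentum m b F D y1 y)"
        "m * (z s - D 0) = integral {0..s} (momentum m b F D y1 z)" using y z s by (auto simp: half_sol_def)
      then have "m * (y s - z s) = integral {0..s} (momentum m b F D y1 y) - integral {0..s} (momentum m b F D y1 z)"
        by (simp add: algebra_simps)
      then have "\<bar>m * (y s - z s)\<bar> \<le> (\<Lambda> * T + b) * integral {0..s} (\<lambda>s. \<bar>y s - z s\<bar>)"
        using MD(2)[OF _ s, of m y1] by simp
      moreover have "\<bar>m * (y s - z s)\<bar> = m * \<bar>y s - z s\<bar>" using mp by (simp add: abs_mult)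
      ultimately show ?thesis using mp by (simp add: C_def le_divide_eq mult.commute)
    qed
  qed
  then show ?thesis by simp
qed

lemma half_sol_exists_lipschitz:
  assumes D: "continuous_on UNIV D" and b: "b > 0" and m: "m \<ge> 0" and T: "T \<ge> 0"
    and \<Lambda>: "\<Lambda> \<ge> 0" and lip: "\<And>x y. \<bar>F x - F y\<bar> \<le> \<Lambda> * \<bar>x - y\<bar>"
  shows "\<exists>y. half_sol m b F D y1 T y"
proof -
  have F: "continuous_on UNIV F"
  proof -
    have "\<Lambda>-lipschitz_on UNIV F" using lip \<Lambda> by (intro lipschitz_onI) (auto simp: dist_real_def)
    then show ?thesis by (rule lipschitz_on_continuous_on)
  qed
  have cF: "continuous_on {0..T} (\<lambda>t. F (y t))" if "continuous_on {0..T} y" for y :: "real \<Rightarrow> real"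
    by (rule continuous_on_compose2[OF F that]) simp
  have cD: "continuous_on {0..T} D" using D continuous_on_subset by blast
  have MD: "\<bar>integral {0..t} (\<lambda>s. F (y s)) - integral {0..t} (\<lambda>s. F (z s))\<bar> \<le> \<Lambda> * integral {0..t} (\<lambda>s. \<bar>y s - z s\<bar>)"
    "\<bar>integral {0..t} (momentum m b F D y1 y) - integral {0..t} (momentum m b F D y1 z)\<bar>
      \<le> (\<Lambda> * T + b) * integral {0..t} (\<lambda>s. \<bar>y s - z s\<bar>)"
    if "continuous_on {0..T} y" "continuous_on {0..T} z" "t \<in> {0..T}" for y z t
    by (rule momentum_difference[OF that(1) cF[OF that(1)] that(2) cF[OF that(2)] D less_imp_le[OF b] \<Lambda> lip that(3)])+
  define K where "K y t = (if m = 0 then D t + integral {0..t} (\<lambda>s. F (y s)) / b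
      else D 0 + integral {0..t} (momentum m b F D y1 y) / m)" for y t
  have "\<exists>y. continuous_on {0..T} y \<and> (\<forall>t\<in>{0..T}. y t = K y t)"
  proof (rule volterra_fixed_point[of "if m = 0 then \<Lambda> / b else (\<Lambda> * T + b) / m"])
    show "continuous_on {0..T} (K y)" if y: "continuous_on {0..T} y" for y
    proof (cases "m = 0")
      case True
      have "continuous_on {0..T} (\<lambda>t. integral {0..t} (\<lambda>s. F (y s)))"
        by (intro indefinite_integral_continuous_1 integrable_continuous_real cF y)
      then show ?thesis unfolding K_def using True b by (auto intro!: continuous_intros cD)
    next
      case False
      have "continuous_on {0..T} (\<lambda>t. integral {0..t} (momentum m b F D y1 y))"
        by (intro indefinite_integral_continuous_1 integrable_continuous_real momentum_continuous cF y D)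
      then show ?thesis unfolding K_def using False by (auto intro!: continuous_intros)
    qed
    show "\<bar>K y t - K z t\<bar> \<le> (if m = 0 then \<Lambda> / b else (\<Lambda> * T + b) / m) * integral {0..t} (\<lambda>s. \<bar>y s - z s\<bar>)"
      if yz: "continuous_on {0..T} y" "continuous_on {0..T} z" "t \<in> {0..T}" for y z t
    proof -
      have "K y t - K z t = (if m = 0 then (integral {0..t} (\<lambda>s. F (y s)) - integral {0..t} (\<lambda>s. F (z s))) / b
          else (integral {0..t} (momentum m b F D y1 y) - integral {0..t} (momentum m b F D y1 z)) / m)"
        by (simp add: K_def diff_divide_distrib)
      then show ?thesis using MD[OF yz] b m by (simp add: abs_divide divide_right_mono)
    qed
  qed (use \<Lambda> b m T in auto)
  then obtain y where y: "continuous_on {0..T} y" "\<And>t. t \<in> {0..T} \<Longrightarrow> y t = K y t" by blast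
  have M0: "momentum m b F D y1 y t = 0" if "m = 0" "t \<in> {0..T}" for t
    using y(2)[OF that(2)] that(1) b by (simp add: momentum_def K_def)
  have "m * (y t - D 0) = integral {0..t} (momentum m b F D y1 y)" if t: "t \<in> {0..T}" for t
  proof (cases "m = 0")
    case True
    have "integral {0..t} (momentum m b F D y1 y) = integral {0..t} (\<lambda>_. 0)"
      by (rule Henstock_Kurzweil_Integration.integral_cong) (use M0[OF True] t in auto)
    then show ?thesis using True by simp
  next
    case False
    then show ?thesis using y(2)[OF t] by (simp add: K_def)
  qed
  moreover have "y 0 = D 0" using y(2)[of 0] T by (simp add: K_def)
  ultimately show ?thesis unfolding half_sol_def using y(1) M0 by blast
qed

section \<open>Energy estimate and global existence\<close>

lemma half_sol_restrict:
  assumes "half_sol m b F D y1 T y" "S \<le> T"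
  shows "half_sol m b F D y1 S y"
proof -
  have "{0..S} \<subseteq> {0..T}" using assms(2) by auto
  then show ?thesis using assms(1) unfolding half_sol_def by (meson continuous_on_subset subsetD)
qed

lemma momentum_cong:
  assumes "\<And>s. s \<in> {0..t} \<Longrightarrow> F (y s) = G (z s)" "y t = z t"
  shows "momentum m b F D y1 y t = momentum m b G D y1 z t"
proof -
  have "integral {0..t} (\<lambda>s. F (y s)) = integral {0..t} (\<lambda>s. G (z s))"
    by (rule Henstock_Kurzweil_Integration.integral_cong) (rule assms(1))
  then show ?thesis using assms(2) by (simp add: momentum_def)
qed

lemma half_sol_cong:
  assumes h: "half_sol m b F D y1 T y" and T: "T \<ge> 0"
    and eq: "\<And>s. s \<in> {0..T} \<Longrightarrow> z s = y s" and F: "\<And>s. s \<in> {0..T} \<Longrightarrow> G (y s) = F (y s)"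
  shows "half_sol m b G D y1 T z"
proof -
  have M: "momentum m b G D y1 z t = momentum m b F D y1 y t" if "t \<in> {0..T}" for t
    by (rule momentum_cong) (use that eq F in auto)
  have I: "integral {0..t} (momentum m b G D y1 z) = integral {0..t} (momentum m b F D y1 y)" if "t \<in> {0..T}" for t
    by (rule Henstock_Kurzweil_Integration.integral_cong) (use that M in auto)
  have "continuous_on {0..T} z"
    using h eq unfolding half_sol_def by (metis (no_types, lifting) continuous_on_cong)
  moreover have "z 0 = D 0" using h eq[of 0] T unfolding half_sol_def by simp
  moreover have "momentum m b G D y1 z t = 0" if "m = 0" "t \<in> {0..T}" for t
    using h M[OF that(2)] that unfolding half_sol_def by simp
  ultimately show ?thesis using h I eq unfolding half_sol_def by simp
qed

text \<open>For \<open>m = 0\<close> the equation \<open>y = D + \<integral> F y / b\<close> gives the velocity, which is then as irregular as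
\<open>d\<close>; for \<open>m > 0\<close> the velocity is continuous.\<close>

lemma half_sol_velocity:
  assumes h: "half_sol m b F D y1 T y" and F: "continuous_on UNIV F" and D: "primitive_on UNIV D d"
    and b: "b > 0" and m: "m \<ge> 0"
    and v: "v = (\<lambda>t. if m = 0 then d t + F (y t) / b else momentum m b F D y1 y t / m)"
  shows "primitive_on {0..T} y v"
    and "primitive_on {0..T} (momentum m b F D y1 y) (\<lambda>t. F (y t) - b * (v t - d t))"
    and "\<And>t. t \<in> {0..T} \<Longrightarrow> m * v t = momentum m b F D y1 y t"
proof -
  have cy: "continuous_on {0..T} y" using h by (simp add: half_sol_def)
  have cF: "continuous_on {0..T} (\<lambda>t. F (y t))" by (rule continuous_on_compose2[OF F cy]) simp
  have cD: "continuous_on UNIV D" by (rule primitive_on_UNIV_continuous[OF D])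
  have cM: "continuous_on {0..T} (momentum m b F D y1 y)" by (rule momentum_continuous[OF cy cF cD])
  have PF: "primitive_on {0..T} (\<lambda>t. m * y1 + integral {0..t} (\<lambda>s. F (y s))) (\<lambda>t. F (y t))"
    by (rule primitive_on_indefinite_integral[OF cF refl])
  have PD: "primitive_on {0..T} D d" by (rule primitive_on_subset[OF D]) simp
  show mv: "m * v t = momentum m b F D y1 y t" if "t \<in> {0..T}" for t
    using h that unfolding half_sol_def v by auto
  show Py: "primitive_on {0..T} y v"
  proof (cases "m = 0")
    case True
    have "primitive_on {0..T} (\<lambda>t. 1 * D t + (1 / b) * (m * y1 + integral {0..t} (\<lambda>s. F (y s)))) (\<lambda>t. 1 * d t + (1 / b) * F (y t))"
      by (rule primitive_on_lin[OF PD PF])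
    then show ?thesis
    proof (rule primitive_on_cong)
      show "y t = 1 * D t + (1 / b) * (m * y1 + integral {0..t} (\<lambda>s. F (y s)))" if "t \<in> {0..T}" for t
      proof -
        have "momentum m b F D y1 y t = 0" using h True that by (simp add: half_sol_def)
        then show ?thesis using b by (simp add: momentum_def field_simps)
      qed
    qed (simp add: v True)
  next
    case False
    have "continuous_on {0..T} v" unfolding v using False cM by (auto intro!: continuous_intros)
    then show ?thesis
    proof (rule primitive_on_indefinite_integral)
      show "y t = D 0 + integral {0..t} v" if "t \<in> {0..T}" for t
      proof -
        have "m * (y t - D 0) = integral {0..t} (momentum m b F D y1 y)" using h that by (simp add: half_sol_def)
        moreover have "integral {0..t} v = integral {0..t} (momentum m b F D y1 y) / m"
          using False by (simp add: v)
        ultimately have "m * (y t - D 0) = m * integral {0..t} v" using False by simp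
        then show ?thesis using False by simp
      qed
    qed
  qed
  have "primitive_on {0..T} (\<lambda>t. 1 * (m * y1 + integral {0..t} (\<lambda>s. F (y s))) + (- b) * (1 * y t + (-1) * D t))
      (\<lambda>t. 1 * F (y t) + (- b) * (1 * v t + (-1) * d t))"
    by (rule primitive_on_lin[OF PF primitive_on_lin[OF Py PD]])
  then show "primitive_on {0..T} (momentum m b F D y1 y) (\<lambda>t. F (y t) - b * (v t - d t))"
    by (rule primitive_on_cong) (simp_all add: momentum_def)
qed

text \<open>With \<open>v = y'\<close> the balance reads \<open>(m v)' = F y - b (v - d)\<close>, so the energy has derivative
\<open>- b v\<^sup>2 + b v d\<close>, which is at most \<open>b d\<^sup>2 / 4\<close>. Both parts of the energy are differentiated with the chain
rule for absolutely continuous functions; the kinetic part is written as \<open>M\<^sup>2 / (2 m)\<close> with the momentum \<open>M\<close>.\<close>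

lemma half_sol_energy:
  assumes h: "half_sol m b F D y1 T y" and T: "T \<ge> 0" and F: "continuous_on UNIV F"
    and D: "primitive_on UNIV D d" and dL: "d \<in> L2_loc"
    and b: "b > 0" and m: "m \<ge> 0" and V: "\<And>x. (V has_real_derivative - F x) (at x)"
  shows "V (y T) \<le> V (D 0) + m * y1\<^sup>2 / 2 + b / 4 * integral {0..T} (\<lambda>t. (d t)\<^sup>2)"
proof -
  define v where "v = (\<lambda>t. if m = 0 then d t + F (y t) / b else momentum m b F D y1 y t / m)"
  let ?M = "momentum m b F D y1 y"
  note hv = half_sol_velocity[OF h F D b m v_def]
  have y0: "y 0 = D 0" using h by (simp add: half_sol_def)
  have cF': "continuous_on UNIV (\<lambda>x. - F x)" by (intro continuous_intros F)
  note PV = primitive_onD[OF primitive_on_chain_rule[OF hv(1) V cF'] T subset_refl]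
  have d2: "(\<lambda>t. b / 4 * (d t)\<^sup>2) integrable_on {0..T}"
    using set_lebesgue_integral_eq_integral(1)[OF L2_locD(2)[OF dL]] by (intro integrable_on_mult_right)
  \<comment> \<open>Completing the square; the work of \<open>F\<close> cancels.\<close>
  have ineq: "v t * (F (y t) - b * (v t - d t)) + - F (y t) * v t \<le> b / 4 * (d t)\<^sup>2" for t
  proof -
    have "0 \<le> b * (v t - d t / 2)\<^sup>2" using b by simp
    then show ?thesis by (simp add: power2_eq_square algebra_simps)
  qed
  show ?thesis
  proof (cases "m = 0")
    case True
    have z: "F (y t) - b * (v t - d t) = 0" for t using True b by (simp add: v_def)
    have "V (y T) - V (y 0) = integral {0..T} (\<lambda>t. - F (y t) * v t)" using PV(3) by simp
    also have "\<dots> \<le> integral {0..T} (\<lambda>t. b / 4 * (d t)\<^sup>2)"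
      by (rule integral_le[OF PV(2) d2]) (use ineq z in simp)
    finally show ?thesis using True y0 by simp
  next
    case False
    then have mp: "m > 0" using m by simp
    have sq: "((\<lambda>x. x\<^sup>2 / (2 * m)) has_real_derivative x / m) (at x)" for x
      using mp by (auto intro!: derivative_eq_intros simp: field_simps)
    have c: "continuous_on UNIV (\<lambda>x. x / m)" using mp by (auto intro!: continuous_intros)
    note PM = primitive_onD[OF primitive_on_chain_rule[OF hv(2) sq c] T subset_refl]
    have M0: "?M 0 = m * y1" using y0 by (simp add: momentum_def)
    have "(?M T)\<^sup>2 / (2 * m) - (?M 0)\<^sup>2 / (2 * m) + (V (y T) - V (y 0))
        = integral {0..T} (\<lambda>t. ?M t / m * (F (y t) - b * (v t - d t))) + integral {0..T} (\<lambda>t. - F (y t) * v t)"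
      using PM(3) PV(3) by simp
    also have "\<dots> = integral {0..T} (\<lambda>t. ?M t / m * (F (y t) - b * (v t - d t)) + - F (y t) * v t)"
      by (rule Henstock_Kurzweil_Integration.integral_add[OF PM(2) PV(2), symmetric])
    also have "\<dots> \<le> integral {0..T} (\<lambda>t. b / 4 * (d t)\<^sup>2)"
    proof (rule integral_le[OF Henstock_Kurzweil_Integration.integrable_add[OF PM(2) PV(2)] d2])
      fix t assume "t \<in> {0..T}"
      then have "?M t / m = v t" using hv(3)[of t] mp by (simp add: field_simps)
      then show "?M t / m * (F (y t) - b * (v t - d t)) + - F (y t) * v t \<le> b / 4 * (d t)\<^sup>2" using ineq by simp
    qed
    finally have "(?M T)\<^sup>2 / (2 * m) - (?M 0)\<^sup>2 / (2 * m) + (V (y T) - V (y 0)) \<le> b / 4 * integral {0..T} (\<lambda>t. (d t)\<^sup>2)" by simp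
    moreover have "(?M T)\<^sup>2 / (2 * m) \<ge> 0" using mp by simp
    moreover have "(?M 0)\<^sup>2 / (2 * m) = m * y1\<^sup>2 / 2" using mp by (simp add: M0 power2_eq_square field_simps)
    ultimately show ?thesis using y0 by simp
  qed
qed

text \<open>The force is frozen outside \<open>{-R0..R0}\<close>, where \<open>R0\<close> exceeds every displacement
that the energy bound \<open>C\<close> allows. At the first time at which the solution of the truncated equation reached
\<open>R0\<close>, it would still be a solution of the original equation, and the energy estimate would contradict the choice of
\<open>R0\<close>.\<close>

lemma half_sol_exists_on_interval:
  assumes T: "T \<ge> 0" and F: "continuous_on UNIV F"
    and D: "primitive_on UNIV D d" and dL: "d \<in> L2_loc"
    and b: "b > 0" and m: "m \<ge> 0" and V: "\<And>x. (V has_real_derivative - F x) (at x)"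
    and conf: "filterlim V at_top at_infinity"
    and lip: "\<And>R. \<exists>\<Lambda>\<ge>0. \<forall>x\<in>{-R..R}. \<forall>y\<in>{-R..R}. \<bar>F x - F y\<bar> \<le> \<Lambda> * \<bar>x - y\<bar>"
  shows "\<exists>y. half_sol m b F D y1 T y"
proof -
  have cD: "continuous_on UNIV D" by (rule primitive_on_UNIV_continuous[OF D])
  define C where "C = V (D 0) + m * y1\<^sup>2 / 2 + b / 4 * integral {0..T} (\<lambda>t. (d t)\<^sup>2)"
  have d2: "(\<lambda>t. (d t)\<^sup>2) integrable_on {0..t}" for t
    by (rule set_lebesgue_integral_eq_integral(1)[OF L2_locD(2)[OF dL]])
  obtain R0 where R0: "\<And>x. V x \<le> C \<Longrightarrow> \<bar>x\<bar> < R0"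
  proof -
    have "eventually (\<lambda>x. C + 1 \<le> V x) at_infinity" using conf by (simp add: filterlim_at_top)
    then obtain r where r: "\<forall>x. r \<le> norm x \<longrightarrow> C + 1 \<le> V x" unfolding eventually_at_infinity by blast
    show thesis
    proof (rule that)
      show "\<bar>x\<bar> < r" if "V x \<le> C" for x
      proof (rule ccontr)
        assume "\<not> \<bar>x\<bar> < r"
        then have "C + 1 \<le> V x" using r by simp
        then show False using that by simp
      qed
    qed
  qed
  have "0 \<le> m * y1\<^sup>2 / 2" using m by simp
  moreover have "0 \<le> b / 4 * integral {0..T} (\<lambda>t. (d t)\<^sup>2)"
    using b d2 by (intro mult_nonneg_nonneg Henstock_Kurzweil_Integration.integral_nonneg) auto
  ultimately have "V (D 0) \<le> C" by (simp add: C_def)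
  then have D0: "\<bar>D 0\<bar> < R0" by (rule R0)
  then have R0p: "R0 > 0" by linarith
  \<comment> \<open>Clamping to \<open>{-R0..R0}\<close> is 1-Lipschitz, so the truncated force inherits a global Lipschitz constant.\<close>
  define cl where "cl x = max (- R0) (min R0 x)" for x
  obtain \<Lambda> where \<Lambda>: "\<Lambda> \<ge> 0" "\<forall>x\<in>{-R0..R0}. \<forall>y\<in>{-R0..R0}. \<bar>F x - F y\<bar> \<le> \<Lambda> * \<bar>x - y\<bar>" using lip[of R0] by blast
  have "\<bar>F (cl x) - F (cl y)\<bar> \<le> \<Lambda> * \<bar>x - y\<bar>" for x y
  proof -
    have "cl x \<in> {-R0..R0}" "cl y \<in> {-R0..R0}" using R0p by (auto simp: cl_def)
    then have "\<bar>F (cl x) - F (cl y)\<bar> \<le> \<Lambda> * \<bar>cl x - cl y\<bar>" using \<Lambda>(2) by blast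
    also have "\<dots> \<le> \<Lambda> * \<bar>x - y\<bar>" using \<Lambda>(1) by (intro mult_left_mono) (auto simp: cl_def max_def min_def)
    finally show ?thesis .
  qed
  then obtain y where y: "half_sol m b (\<lambda>x. F (cl x)) D y1 T y"
    using half_sol_exists_lipschitz[OF cD b m T \<Lambda>(1), of "\<lambda>x. F (cl x)" y1] by blast
  have cy: "continuous_on {0..T} y" and y0: "y 0 = D 0" using y by (auto simp: half_sol_def)
  have clid: "cl x = x" if "\<bar>x\<bar> \<le> R0" for x using that by (auto simp: cl_def)
  have bound: "\<bar>y t\<bar> < R0" if t: "t \<in> {0..T}" for t
  proof (rule ccontr)
    assume nb: "\<not> \<bar>y t\<bar> < R0"
    define S where "S = {s \<in> {0..T}. R0 \<le> \<bar>y s\<bar>}"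
    have "S = {0..T} \<inter> (\<lambda>s. \<bar>y s\<bar>) -` {R0..}" by (auto simp: S_def)
    moreover have "closed ({0..T} \<inter> (\<lambda>s. \<bar>y s\<bar>) -` {R0..})"
      by (intro continuous_closed_preimage continuous_intros cy)
    ultimately have cS: "closed S" by simp
    have tS: "t \<in> S" using t nb by (simp add: S_def)
    have bb: "bdd_below S" by (rule bdd_belowI[of _ 0]) (simp add: S_def)
    define \<tau> where "\<tau> = Inf S"
    have \<tau>S: "\<tau> \<in> S" unfolding \<tau>_def using closed_contains_Inf[OF _ bb cS] tS by blast
    have first: "\<bar>y s\<bar> < R0" if "s \<in> {0..T}" "s < \<tau>" for s
    proof (rule ccontr)
      assume "\<not> \<bar>y s\<bar> < R0"
      then have "s \<in> S" using that by (simp add: S_def)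
      then have "\<tau> \<le> s" unfolding \<tau>_def by (rule cInf_lower[OF _ bb])
      then show False using that by simp
    qed
    have \<tau>T: "\<tau> \<in> {0..T}" "R0 \<le> \<bar>y \<tau>\<bar>" using \<tau>S by (auto simp: S_def)
    \<comment> \<open>The value \<open>R0\<close> is attained up to time \<open>\<tau>\<close>, and not before \<open>\<tau>\<close>, hence at \<open>\<tau>\<close>.\<close>
    have "\<exists>s\<ge>0. s \<le> \<tau> \<and> \<bar>y s\<bar> = R0"
    proof (rule IVT')
      show "\<bar>y 0\<bar> \<le> R0" using D0 y0 by simp
      show "continuous_on {0..\<tau>} (\<lambda>s. \<bar>y s\<bar>)"
        using \<tau>T by (intro continuous_intros continuous_on_subset[OF cy]) auto
      show "R0 \<le> \<bar>y \<tau>\<bar>" "0 \<le> \<tau>" using \<tau>T by auto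
    qed
    then obtain s where s: "0 \<le> s" "s \<le> \<tau>" "\<bar>y s\<bar> = R0" by blast
    have "s = \<tau>" using first[of s] s \<tau>T by force
    then have y\<tau>: "\<bar>y \<tau>\<bar> = R0" using s by simp
    have "half_sol m b (\<lambda>x. F (cl x)) D y1 \<tau> y" by (rule half_sol_restrict[OF y]) (use \<tau>T in simp)
    then have "half_sol m b F D y1 \<tau> y"
    proof (rule half_sol_cong)
      show "F (y s) = F (cl (y s))" if "s \<in> {0..\<tau>}" for s
      proof -
        have "\<bar>y s\<bar> \<le> R0" using first[of s] y\<tau> that \<tau>T by (cases "s = \<tau>") auto
        then show ?thesis by (simp add: clid)
      qed
    qed (use \<tau>T in auto)
    from half_sol_energy[OF this _ F D dL b m V]
    have "V (y \<tau>) \<le> V (D 0) + m * y1\<^sup>2 / 2 + b / 4 * integral {0..\<tau>} (\<lambda>t. (d t)\<^sup>2)" using \<tau>T by simp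
    also have "\<dots> \<le> C"
    proof -
      have "integral {0..\<tau>} (\<lambda>t. (d t)\<^sup>2) \<le> integral {0..T} (\<lambda>t. (d t)\<^sup>2)"
        using \<tau>T by (intro integral_subset_le d2) auto
      then have "b / 4 * integral {0..\<tau>} (\<lambda>t. (d t)\<^sup>2) \<le> b / 4 * integral {0..T} (\<lambda>t. (d t)\<^sup>2)"
        using b by (intro mult_left_mono) auto
      then show ?thesis by (simp add: C_def)
    qed
    finally have "\<bar>y \<tau>\<bar> < R0" by (rule R0)
    then show False using y\<tau> by simp
  qed
  have "half_sol m b F D y1 T y"
    by (rule half_sol_cong[OF y T]) (use bound clid in \<open>auto simp: less_imp_le\<close>)
  then show ?thesis by blast
qed

text \<open>Solutions on longer intervals extend those on shorter ones by uniqueness.\<close>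

lemma half_sol_exists_global:
  assumes F: "continuous_on UNIV F"
    and D: "primitive_on UNIV D d" and dL: "d \<in> L2_loc"
    and b: "b > 0" and m: "m \<ge> 0" and V: "\<And>x. (V has_real_derivative - F x) (at x)"
    and conf: "filterlim V at_top at_infinity"
    and lip: "\<And>R. \<exists>\<Lambda>\<ge>0. \<forall>x\<in>{-R..R}. \<forall>y\<in>{-R..R}. \<bar>F x - F y\<bar> \<le> \<Lambda> * \<bar>x - y\<bar>"
  shows "\<exists>y. \<forall>T\<ge>0. half_sol m b F D y1 T y"
proof -
  have cD: "continuous_on UNIV D" by (rule primitive_on_UNIV_continuous[OF D])
  have "\<exists>y. half_sol m b F D y1 (real n) y" for n
    by (rule half_sol_exists_on_interval[OF _ F D dL b m V conf lip]) simp
  then obtain Y where Y: "\<And>n. half_sol m b F D y1 (real n) (Y n)" by metis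
  have same: "Y n t = Y k t" if "0 \<le> t" "t \<le> real n" "n \<le> k" for n k t
  proof (rule half_sol_unique[OF Y[of n] half_sol_restrict[OF Y[of k]] F cD b m lip])
    show "real n \<le> real k" using that by simp
    show "t \<in> {0..real n}" using that by simp
  qed
  \<comment> \<open>The solution on any interval \<open>{0..n}\<close> that contains \<open>t\<close> will do.\<close>
  define y where "y t = Y (nat \<lceil>t\<rceil>) t" for t
  have yY: "y t = Y n t" if "0 \<le> t" "t \<le> real n" for t n
  proof -
    have "nat \<lceil>t\<rceil> \<le> n" using that by (simp add: ceiling_le_iff nat_le_iff)
    moreover have "t \<le> real (nat \<lceil>t\<rceil>)" using that by (simp add: real_nat_ceiling_ge)
    ultimately show ?thesis unfolding y_def by (intro same that)
  qed
  have "half_sol m b F D y1 T y" if "T \<ge> 0" for T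
  proof -
    define n where "n = nat \<lceil>T\<rceil>"
    have n: "T \<le> real n" unfolding n_def by (rule real_nat_ceiling_ge)
    show ?thesis
      by (rule half_sol_cong[OF half_sol_restrict[OF Y n] that]) (use n in \<open>auto intro!: yY\<close>)
  qed
  then show ?thesis by blast
qed

lemma C1_locally_lipschitz:
  fixes F F' :: "real \<Rightarrow> real"
  assumes F: "\<And>x. (F has_real_derivative F' x) (at x)" and F': "continuous_on UNIV F'"
  shows "\<exists>\<Lambda>\<ge>0. \<forall>x\<in>{-R..R}. \<forall>y\<in>{-R..R}. \<bar>F x - F y\<bar> \<le> \<Lambda> * \<bar>x - y\<bar>"
proof -
  have "bounded (F' ` {-R..R})"
    by (intro compact_imp_bounded compact_continuous_image continuous_on_subset[OF F']) auto
  then obtain A where A: "\<forall>y\<in>F' ` {-R..R}. norm y \<le> A" unfolding bounded_iff by blast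
  have "\<bar>F x - F y\<bar> \<le> \<bar>A\<bar> * \<bar>x - y\<bar>" if "x \<in> {-R..R}" "y \<in> {-R..R}" for x y
  proof -
    have "norm (F x - F y) \<le> \<bar>A\<bar> * norm (x - y)"
    proof (rule field_differentiable_bound[where S = "{-R..R}" and f' = F'])
      show "(F has_field_derivative F' z) (at z within {-R..R})" for z by (rule DERIV_subset[OF F]) simp
      show "norm (F' z) \<le> \<bar>A\<bar>" if "z \<in> {-R..R}" for z
      proof -
        have "norm (F' z) \<le> A" using A that by blast
        then show ?thesis by simp
      qed
    qed (use that in auto)
    then show ?thesis by simp
  qed
  then show ?thesis by (intro exI[of _ "\<bar>A\<bar>"]) auto
qed

section \<open>The oscillator for all times\<close>

text \<open>Here \<open>M\<close> is the momentum \<open>m y'\<close> at all times. For negative times the roles of incoming and outgoing waves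
are exchanged, which reverses the damping force; the factor \<open>sgn t\<close> accounts for this.\<close>

definition two_sided_sol :: "real \<Rightarrow> real \<Rightarrow> (real \<Rightarrow> real) \<Rightarrow> (real \<Rightarrow> real) \<Rightarrow> real \<Rightarrow> (real \<Rightarrow> real) \<Rightarrow> bool" where
  "two_sided_sol m b F D y1 y \<longleftrightarrow> continuous_on UNIV y \<and> y 0 = D 0 \<and>
     (\<exists>\<Phi> M. primitive_on UNIV \<Phi> (\<lambda>t. F (y t)) \<and> \<Phi> 0 = 0 \<and> primitive_on UNIV (\<lambda>t. m * y t) M \<and>
        (\<forall>t. M t = m * y1 + \<Phi> t - b * (sgn t * (y t - D t))) \<and> (m = 0 \<longrightarrow> (\<forall>t. M t = 0)))"

lemma two_sided_solI:
  assumes "continuous_on UNIV y" "y 0 = D 0" "primitive_on UNIV \<Phi> (\<lambda>t. F (y t))" "\<Phi> 0 = 0"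
    "primitive_on UNIV (\<lambda>t. m * y t) M" "\<And>t. M t = m * y1 + \<Phi> t - b * (sgn t * (y t - D t))"
    "\<And>t. m = 0 \<Longrightarrow> M t = 0"
  shows "two_sided_sol m b F D y1 y"
proof -
  have "\<forall>t. M t = m * y1 + \<Phi> t - b * (sgn t * (y t - D t))" by (intro allI assms(6))
  moreover have "m = 0 \<longrightarrow> (\<forall>t. M t = 0)" by (intro allI impI assms(7))
  ultimately have "\<exists>M. primitive_on UNIV \<Phi> (\<lambda>t. F (y t)) \<and> \<Phi> 0 = 0 \<and> primitive_on UNIV (\<lambda>t. m * y t) M \<and>
        (\<forall>t. M t = m * y1 + \<Phi> t - b * (sgn t * (y t - D t))) \<and> (m = 0 \<longrightarrow> (\<forall>t. M t = 0))"
    using assms(3-5) by (intro exI[of _ M] conjI)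
  note E = this
  show ?thesis
    unfolding two_sided_sol_def by (rule conjI, rule assms(1), rule conjI, rule assms(2), rule exI, rule E)
qed

lemma two_sided_solE:
  assumes "two_sided_sol m b F D y1 y"
  obtains \<Phi> M where "continuous_on UNIV y" "y 0 = D 0" "primitive_on UNIV \<Phi> (\<lambda>t. F (y t))" "\<Phi> 0 = 0"
    "primitive_on UNIV (\<lambda>t. m * y t) M" "\<And>t. M t = m * y1 + \<Phi> t - b * (sgn t * (y t - D t))"
    "\<And>t. m = 0 \<Longrightarrow> M t = 0"
proof -
  note A = assms[unfolded two_sided_sol_def]
  obtain \<Phi> M where H: "primitive_on UNIV \<Phi> (\<lambda>t. F (y t)) \<and> \<Phi> 0 = 0 \<and> primitive_on UNIV (\<lambda>t. m * y t) M \<and>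
        (\<forall>t. M t = m * y1 + \<Phi> t - b * (sgn t * (y t - D t))) \<and> (m = 0 \<longrightarrow> (\<forall>t. M t = 0))"
    using A[THEN conjunct2, THEN conjunct2] by (elim exE)
  show thesis by (rule that[of \<Phi> M]; use A H in blast)
qed

text \<open>Time reversal changes the sign of the velocity and of \<open>sgn t\<close>, so the equation keeps its form.\<close>

lemma two_sided_sol_reflect:
  assumes "two_sided_sol m b F D y1 y"
  shows "two_sided_sol m b F (\<lambda>t. D (- t)) (- y1) (\<lambda>t. y (- t))"
proof -
  obtain \<Phi> M where h: "continuous_on UNIV y" "y 0 = D 0" "primitive_on UNIV \<Phi> (\<lambda>t. F (y t))" "\<Phi> 0 = 0"
    "primitive_on UNIV (\<lambda>t. m * y t) M" "\<And>t. M t = m * y1 + \<Phi> t - b * (sgn t * (y t - D t))"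
    "\<And>t. m = 0 \<Longrightarrow> M t = 0"
    by (rule two_sided_solE[OF assms]) (rule that)
  have "primitive_on UNIV (\<lambda>t. \<Phi> (- t)) (\<lambda>t. - F (y (- t)))" using primitive_on_reflect[OF h(3)] by simp
  from primitive_on_lin[OF this this, of "-1" 0]
  have 1: "primitive_on UNIV (\<lambda>t. - \<Phi> (- t)) (\<lambda>t. F (y (- t)))" by simp
  have 2: "primitive_on UNIV (\<lambda>t. m * y (- t)) (\<lambda>t. - M (- t))" using primitive_on_reflect[OF h(5)] by simp
  have 3: "continuous_on UNIV (\<lambda>t. y (- t))"
    by (rule continuous_on_compose2[OF h(1)]) (auto intro!: continuous_intros)
  have 4: "- M (- t) = m * (- y1) + (- \<Phi> (- t)) - b * (sgn t * (y (- t) - D (- t)))" for t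
    unfolding h(6) by (simp add: sgn_minus)
  show ?thesis
    by (rule two_sided_solI[OF 3 _ 1 _ 2 4]) (simp_all add: h(2,4,7))
qed

lemma two_sided_sol_imp_half_sol:
  assumes "two_sided_sol m b F D y1 y"
  shows "half_sol m b F D y1 T y"
proof -
  obtain \<Phi> M where h: "continuous_on UNIV y" "y 0 = D 0" "primitive_on UNIV \<Phi> (\<lambda>t. F (y t))" "\<Phi> 0 = 0"
    "primitive_on UNIV (\<lambda>t. m * y t) M" "\<And>t. M t = m * y1 + \<Phi> t - b * (sgn t * (y t - D t))"
    "\<And>t. m = 0 \<Longrightarrow> M t = 0"
    by (rule two_sided_solE[OF assms]) (rule that)
  have M: "momentum m b F D y1 y t = M t" if "0 \<le> t" for t
  proof -
    have "integral {0..t} (\<lambda>s. F (y s)) = \<Phi> t" using primitive_onD(3)[OF h(3), of 0 t] that h(4) by simp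
    moreover have "y t - D t = sgn t * (y t - D t)" using that h(2) by (cases "t = 0") auto
    ultimately show ?thesis unfolding momentum_def h(6) by simp
  qed
  have "m * (y t - D 0) = integral {0..t} (momentum m b F D y1 y)" if t: "0 \<le> t" for t
  proof -
    have "integral {0..t} (momentum m b F D y1 y) = integral {0..t} M"
      by (rule Henstock_Kurzweil_Integration.integral_cong) (simp add: M)
    then show ?thesis using primitive_onD(3)[OF h(5), of 0 t] t h(2) by (simp add: right_diff_distrib)
  qed
  then show ?thesis
    unfolding half_sol_def using h(1,2) M h(7) by (auto intro: continuous_on_subset)
qed

lemma two_sided_sol_unique:
  assumes y: "two_sided_sol m b F D y1 y" and z: "two_sided_sol m b F D y1 z"
    and F: "continuous_on UNIV F" and D: "continuous_on UNIV D" and b: "b > 0" and m: "m \<ge> 0"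
    and lip: "\<And>R. \<exists>\<Lambda>\<ge>0. \<forall>x\<in>{-R..R}. \<forall>y\<in>{-R..R}. \<bar>F x - F y\<bar> \<le> \<Lambda> * \<bar>x - y\<bar>"
  shows "y = z"
proof
  have pos: "y t = z t" if "two_sided_sol m b F D y1 y" "two_sided_sol m b F D y1 z" "continuous_on UNIV D" "0 \<le> t"
    for y z D y1 t
    by (rule half_sol_unique[OF two_sided_sol_imp_half_sol[OF that(1)] two_sided_sol_imp_half_sol[OF that(2)]
          F that(3) b m lip, of t t]) (use that in simp)
  have cD': "continuous_on UNIV (\<lambda>t. D (- t))"
    by (rule continuous_on_compose2[OF D]) (auto intro!: continuous_intros)
  fix t
  show "y t = z t"
  proof (cases "0 \<le> t")
    case True
    then show ?thesis by (rule pos[OF y z D])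
  next
    case False
    then show ?thesis
      using pos[OF two_sided_sol_reflect[OF y] two_sided_sol_reflect[OF z] cD', of "- t"] by simp
  qed
qed

lemma primitive_on_nonneg_from_intervals:
  assumes "\<And>T. T \<ge> 0 \<Longrightarrow> primitive_on {0..T} h d" shows "primitive_on {0..} h d"
proof -
  have P: "primitive_on {0..T} h d" for T
    using assms[of T] by (cases "T \<ge> 0") (auto simp: primitive_on_def)
  show ?thesis
  proof (rule primitive_onI)
    fix s t :: real assume st: "s \<le> t" "{s..t} \<subseteq> {0..}"
    then have "{s..t} \<subseteq> {0..t}" by auto
    then show "d absolutely_integrable_on {s..t}" "integral {s..t} d = h t - h s"
      using primitive_onD[OF P[of t] st(1)] by auto
  qed
qed

lemma two_sided_sol_exists:
  assumes F: "continuous_on UNIV F"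
    and D: "primitive_on UNIV D d" and dL: "d \<in> L2_loc"
    and b: "b > 0" and m: "m \<ge> 0" and V: "\<And>x. (V has_real_derivative - F x) (at x)"
    and conf: "filterlim V at_top at_infinity"
    and lip: "\<And>R. \<exists>\<Lambda>\<ge>0. \<forall>x\<in>{-R..R}. \<forall>y\<in>{-R..R}. \<bar>F x - F y\<bar> \<le> \<Lambda> * \<bar>x - y\<bar>"
  shows "\<exists>y. two_sided_sol m b F D y1 y"
proof -
  have D': "primitive_on UNIV (\<lambda>t. D (- t)) (\<lambda>t. - d (- t))" using primitive_on_reflect[OF D] by simp
  have dL': "(\<lambda>t. - d (- t)) \<in> L2_loc"
    using L2_loc_lin[OF L2_loc_affine[OF dL, of "-1" 0] L2_loc_affine[OF dL, of "-1" 0], of "-1" 0] by simp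
  obtain p where p: "\<And>T. T \<ge> 0 \<Longrightarrow> half_sol m b F D y1 T p"
    using half_sol_exists_global[OF F D dL b m V conf lip, of y1] by blast
  obtain q where q: "\<And>T. T \<ge> 0 \<Longrightarrow> half_sol m b F (\<lambda>t. D (- t)) (- y1) T q"
    using half_sol_exists_global[OF F D' dL' b m V conf lip, of "- y1"] by blast
  define y where "y t = (if 0 \<le> t then p t else q (- t))" for t
  have p0: "p 0 = D 0" and q0: "q 0 = D 0" using p[of 0] q[of 0] by (simp_all add: half_sol_def)
  have Pp: "primitive_on {0..} p (\<lambda>t. if m = 0 then d t + F (p t) / b else momentum m b F D y1 p t / m)"
    by (rule primitive_on_nonneg_from_intervals, rule half_sol_velocity(1)[OF p F D b m refl])
  have Pq: "primitive_on {0..} q (\<lambda>t. if m = 0 then - d (- t) + F (q t) / b else momentum m b F (\<lambda>t. D (- t)) (- y1) q t / m)"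
    by (rule primitive_on_nonneg_from_intervals, rule half_sol_velocity(1)[OF q F D' b m refl])
  have neg: "{x::real. - x \<in> {0..}} = {..0}" by auto
  have "primitive_on UNIV y (\<lambda>x. if 0 \<le> x
      then (if m = 0 then d x + F (p x) / b else momentum m b F D y1 p x / m)
      else - (if m = 0 then - d (- (- x)) + F (q (- x)) / b else momentum m b F (\<lambda>t. D (- t)) (- y1) q (- x) / m))"
    unfolding y_def using primitive_on_reflect[OF Pq, unfolded neg] by (intro primitive_on_glue Pp) (simp_all add: p0 q0)
  then have cy: "continuous_on UNIV y" by (rule primitive_on_UNIV_continuous)
  have yp: "y t = p t" if "0 \<le> t" for t using that by (simp add: y_def)
  have yq: "y (- t) = q t" if "0 \<le> t" for t using that p0 q0 by (cases "t = 0") (auto simp: y_def)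
  have cFy: "continuous_on UNIV (\<lambda>t. F (y t))" by (rule continuous_on_compose2[OF F cy]) simp
  obtain \<Phi> where \<Phi>: "primitive_on UNIV \<Phi> (\<lambda>t. F (y t))" "\<Phi> 0 = 0"
    using primitive_of_L2_exists[OF L2_loc_continuous[OF cFy]] by blast
  define M where "M t = m * y1 + \<Phi> t - b * (sgn t * (y t - D t))" for t
  have Mp: "momentum m b F D y1 p t = M t" if "0 \<le> t" for t
  proof -
    have "integral {0..t} (\<lambda>s. F (p s)) = integral {0..t} (\<lambda>s. F (y s))"
      by (rule Henstock_Kurzweil_Integration.integral_cong) (simp add: yp)
    also have "\<dots> = \<Phi> t" using primitive_onD(3)[OF \<Phi>(1), of 0 t] that \<Phi>(2) by simp
    finally have "integral {0..t} (\<lambda>s. F (p s)) = \<Phi> t" .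
    moreover have "p t - D t = sgn t * (y t - D t)" using that p0 by (cases "t = 0") (auto simp: yp)
    ultimately show ?thesis by (simp add: momentum_def M_def)
  qed
  have Mq: "momentum m b F (\<lambda>t. D (- t)) (- y1) q t = - M (- t)" if "0 \<le> t" for t
  proof -
    have "integral {0..t} (\<lambda>s. F (q s)) = integral {0..t} (\<lambda>s. F (y (- s)))"
      by (rule Henstock_Kurzweil_Integration.integral_cong) (simp add: yq)
    also have "\<dots> = integral {-t..0} (\<lambda>s. F (y s))"
      using Henstock_Kurzweil_Integration.integral_reflect_real[of 0 "-t" "\<lambda>s. F (y s)"] by simp
    also have "\<dots> = - \<Phi> (- t)" using primitive_onD(3)[OF \<Phi>(1), of "-t" 0] that \<Phi>(2) by simp
    finally have "integral {0..t} (\<lambda>s. F (q s)) = - \<Phi> (- t)" .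
    moreover have "q t - D (- t) = - (sgn (- t) * (y (- t) - D (- t)))"
      using that q0 by (cases "t = 0") (auto simp: yq)
    ultimately show ?thesis by (simp add: momentum_def M_def)
  qed
  have "primitive_on {0..} (\<lambda>t. m * y t) M"
  proof (rule primitive_on_nonneg_from_intervals)
    fix T :: real assume T: "T \<ge> 0"
    have cM: "continuous_on {0..T} (momentum m b F D y1 p)"
      using p[OF T] primitive_on_UNIV_continuous[OF D] continuous_on_compose2[OF F, of "{0..T}" p]
      by (intro momentum_continuous) (auto simp: half_sol_def)
    have "primitive_on {0..T} (\<lambda>t. m * p t) (momentum m b F D y1 p)"
      by (rule primitive_on_indefinite_integral[OF cM, of _ "m * D 0"])
         (use p[OF T] in \<open>auto simp: half_sol_def algebra_simps\<close>)
    then show "primitive_on {0..T} (\<lambda>t. m * y t) M" by (rule primitive_on_cong) (auto simp: yp Mp)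
  qed
  moreover have "primitive_on {..0} (\<lambda>t. m * y t) M"
  proof -
    have "primitive_on {0..} (\<lambda>t. m * q t) (\<lambda>t. - M (- t))"
    proof (rule primitive_on_nonneg_from_intervals)
      fix T :: real assume T: "T \<ge> 0"
      have cM: "continuous_on {0..T} (momentum m b F (\<lambda>t. D (- t)) (- y1) q)"
        using q[OF T] primitive_on_UNIV_continuous[OF D'] continuous_on_compose2[OF F, of "{0..T}" q]
        by (intro momentum_continuous) (auto simp: half_sol_def)
      have "primitive_on {0..T} (\<lambda>t. m * q t) (momentum m b F (\<lambda>t. D (- t)) (- y1) q)"
        by (rule primitive_on_indefinite_integral[OF cM, of _ "m * D 0"])
           (use q[OF T] in \<open>auto simp: half_sol_def algebra_simps\<close>)
      then show "primitive_on {0..T} (\<lambda>t. m * q t) (\<lambda>t. - M (- t))" by (rule primitive_on_cong) (auto simp: Mq)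
    qed
    from primitive_on_reflect[OF this, unfolded neg]
    show ?thesis
    proof (rule primitive_on_cong)
      show "m * y x = m * q (- x)" if "x \<in> {..0}" for x using yq[of "- x"] that by simp
    qed simp
  qed
  ultimately have PM: "primitive_on UNIV (\<lambda>t. m * y t) M" by (rule primitive_on_halves)
  have M0: "M t = 0" if "m = 0" for t
  proof (cases "0 \<le> t")
    case True
    then show ?thesis using p[of t] that Mp[OF True] by (simp add: half_sol_def)
  next
    case False
    then show ?thesis using q[of "- t"] that Mq[of "- t"] by (simp add: half_sol_def)
  qed
  have "two_sided_sol m b F D y1 y"
    by (rule two_sided_solI[OF cy _ \<Phi> PM M_def M0]) (simp add: p0 y_def)
  then show ?thesis by blast
qed

text \<open>For \<open>m = 0\<close> the relation \<open>M = 0\<close> is solved for \<open>y\<close>; for \<open>m > 0\<close> the velocity is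
\<open>M / m\<close>. The factor \<open>sgn t\<close> causes no jump of \<open>M\<close>, since \<open>y 0 = D 0\<close>.\<close>

lemma two_sided_sol_velocity:
  assumes y: "two_sided_sol m b F D y1 y" and F: "continuous_on UNIV F"
    and D: "primitive_on UNIV D d" and dL: "d \<in> L2_loc" and b: "b > 0"
  shows "\<exists>v\<in>L2_loc. primitive_on UNIV y v"
proof -
  obtain \<Phi> M where h: "continuous_on UNIV y" "y 0 = D 0" "primitive_on UNIV \<Phi> (\<lambda>t. F (y t))" "\<Phi> 0 = 0"
    "primitive_on UNIV (\<lambda>t. m * y t) M" "\<And>t. M t = m * y1 + \<Phi> t - b * (sgn t * (y t - D t))"
    "\<And>t. m = 0 \<Longrightarrow> M t = 0"
    by (rule two_sided_solE[OF y]) (rule that)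
  have cD: "continuous_on A D" for A using primitive_on_UNIV_continuous[OF D] continuous_on_subset by blast
  have c\<Phi>: "continuous_on A \<Phi>" for A using primitive_on_UNIV_continuous[OF h(3)] continuous_on_subset by blast
  have cy: "continuous_on A y" for A using h(1) continuous_on_subset by blast
  show ?thesis
  proof (cases "m = 0")
    case True
    have cFy: "continuous_on UNIV (\<lambda>t. F (y t))" by (rule continuous_on_compose2[OF F h(1)]) simp
    note FL = L2_loc_continuous[OF cFy]
    have P: "primitive_on UNIV (\<lambda>t. 1 * D t + s * \<Phi> t) (\<lambda>t. 1 * d t + s * F (y t))" for s
      by (rule primitive_on_lin[OF D h(3)])
    have "primitive_on UNIV (\<lambda>t. if 0 \<le> t then 1 * D t + (1 / b) * \<Phi> t else 1 * D t + (- 1 / b) * \<Phi> t)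
       (\<lambda>t. if 0 \<le> t then 1 * d t + (1 / b) * F (y t) else 1 * d t + (- 1 / b) * F (y t))"
      by (intro primitive_on_glue primitive_on_subset[OF P]) (simp_all add: h(4))
    note PP = this
    have eq: "y t = (if 0 \<le> t then 1 * D t + (1 / b) * \<Phi> t else 1 * D t + (- 1 / b) * \<Phi> t)" for t
    proof -
      have "\<Phi> t = b * (sgn t * (y t - D t))" using h(6)[of t] h(7)[OF True, of t] True by simp
      then show ?thesis using b h(2) by (cases "t = 0") (auto simp: sgn_if)
    qed
    have "primitive_on UNIV y (\<lambda>t. if 0 \<le> t then 1 * d t + (1 / b) * F (y t) else 1 * d t + (- 1 / b) * F (y t))"
      by (rule primitive_on_cong[OF PP eq refl])
    moreover have "(\<lambda>t. if 0 \<le> t then 1 * d t + (1 / b) * F (y t) else 1 * d t + (- 1 / b) * F (y t)) \<in> L2_loc"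
      by (intro L2_loc_glue L2_loc_lin dL FL)
    ultimately show ?thesis by blast
  next
    case False
    have "continuous_on UNIV (\<lambda>t. if t \<le> 0 then m * y1 + \<Phi> t + b * (y t - D t) else m * y1 + \<Phi> t - b * (y t - D t))"
      by (rule continuous_on_cases_le) (auto intro!: continuous_intros c\<Phi> cy cD simp: h(2))
    moreover have "(\<lambda>t. if t \<le> 0 then m * y1 + \<Phi> t + b * (y t - D t) else m * y1 + \<Phi> t - b * (y t - D t)) = M"
      by (rule ext) (auto simp: h(6) h(2) sgn_if algebra_simps)
    ultimately have "continuous_on UNIV M" by (simp only:)
    then have "M \<in> L2_loc" by (rule L2_loc_continuous)
    then have "(\<lambda>t. (1 / m) * M t + 0 * M t) \<in> L2_loc" by (intro L2_loc_lin)
    moreover have "primitive_on UNIV (\<lambda>t. (1 / m) * (m * y t) + 0 * (m * y t)) (\<lambda>t. (1 / m) * M t + 0 * M t)"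
      by (rule primitive_on_lin[OF h(5) h(5)])
    then have "primitive_on UNIV y (\<lambda>t. (1 / m) * M t + 0 * M t)"
      by (rule primitive_on_cong) (use False in auto)
    ultimately show ?thesis by blast
  qed
qed

section \<open>From waves to the oscillator\<close>

lemma one_sided_limit_eq:
  fixes h k :: "real \<Rightarrow> real"
  assumes "continuous_on UNIV k"
  shows "(h \<longlongrightarrow> L) (at_right 0) \<Longrightarrow> (\<And>x. 0 < x \<Longrightarrow> h x = k x) \<Longrightarrow> L = k 0"
    and "(h \<longlongrightarrow> L) (at_left 0) \<Longrightarrow> (\<And>x. x < 0 \<Longrightarrow> h x = k x) \<Longrightarrow> L = k 0"
proof -
  have k: "(k \<longlongrightarrow> k 0) (at 0)" using assms by (simp add: continuous_on_def)
  show "L = k 0" if h: "(h \<longlongrightarrow> L) (at_right 0)" and eq: "\<And>x. 0 < x \<Longrightarrow> h x = k x"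
  proof -
    have "(k \<longlongrightarrow> k 0) (at_right 0)" using k by (rule tendsto_within_subset) simp
    then have "(h \<longlongrightarrow> k 0) (at_right 0)"
      by (rule Lim_transform_eventually) (auto simp: eventually_at_right_field eq intro: exI[of _ 1])
    with h show ?thesis by (rule tendsto_unique[rotated]) simp
  qed
  show "L = k 0" if h: "(h \<longlongrightarrow> L) (at_left 0)" and eq: "\<And>x. x < 0 \<Longrightarrow> h x = k x"
  proof -
    have "(k \<longlongrightarrow> k 0) (at_left 0)" using k by (rule tendsto_within_subset) simp
    then have "(h \<longlongrightarrow> k 0) (at_left 0)"
      by (rule Lim_transform_eventually) (auto simp: eventually_at_left_field eq intro: exI[of _ "-1"])
    with h show ?thesis by (rule tendsto_unique[rotated]) simp
  qed
qed

text \<open>The two waves into which d'Alembert's formula splits the data; their velocities add up to \<open>u1\<close>.\<close>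

lemma dAlembert_waves_primitive:
  assumes u0: "primitive_on UNIV u0 w" "w \<in> L2_loc" and U: "primitive_on UNIV U u1" "u1 \<in> L2_loc" and a: "a > 0"
  obtains dal dbe where "primitive_on UNIV (\<lambda>x. (u0 x - U x / a) / 2) dal" "dal \<in> L2_loc"
    "primitive_on UNIV (\<lambda>x. (u0 x + U x / a) / 2) dbe" "dbe \<in> L2_loc" "\<And>x. - a * dal x + a * dbe x = u1 x"
proof -
  have P: "primitive_on UNIV (\<lambda>x. 1 / 2 * u0 x + c * U x) (\<lambda>x. 1 / 2 * w x + c * u1 x)"
    "(\<lambda>x. 1 / 2 * w x + c * u1 x) \<in> L2_loc" for c
    by (rule primitive_on_lin[OF u0(1) U(1)], rule L2_loc_lin[OF u0(2) U(2)])
  show thesis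
  proof (rule that)
    show "primitive_on UNIV (\<lambda>x. (u0 x - U x / a) / 2) (\<lambda>x. 1 / 2 * w x + - 1 / (2 * a) * u1 x)"
      by (rule primitive_on_cong[OF P(1)[of "- 1 / (2 * a)"]]) (simp_all add: diff_divide_distrib)
    show "primitive_on UNIV (\<lambda>x. (u0 x + U x / a) / 2) (\<lambda>x. 1 / 2 * w x + 1 / (2 * a) * u1 x)"
      by (rule primitive_on_cong[OF P(1)[of "1 / (2 * a)"]]) (simp_all add: add_divide_distrib)
    show "- a * (1 / 2 * w x + - 1 / (2 * a) * u1 x) + a * (1 / 2 * w x + 1 / (2 * a) * u1 x) = u1 x" for x
      using a by (simp add: field_simps)
  qed (rule P(2))+
qed

text \<open>The displacement of the origin if the string were not loaded there. It drives the oscillator.\<close>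

lemma free_displacement_primitive:
  assumes "primitive_on UNIV al dal" "dal \<in> L2_loc" "primitive_on UNIV be dbe" "dbe \<in> L2_loc" and a: "a > 0"
  shows "\<exists>d\<in>L2_loc. primitive_on UNIV (\<lambda>t. be (a * t) + al (- a * t)) d"
proof
  show "(\<lambda>t. 1 * (a * dbe (0 + a * t)) + 1 * ((- a) * dal (0 + (- a) * t))) \<in> L2_loc"
    using a by (intro L2_loc_lin L2_loc_cmult L2_loc_affine assms) auto
  show "primitive_on UNIV (\<lambda>t. be (a * t) + al (- a * t)) (\<lambda>t. 1 * (a * dbe (0 + a * t)) + 1 * ((- a) * dal (0 + (- a) * t)))"
    by (rule primitive_on_cong[OF primitive_on_lin[OF primitive_on_affine[OF assms(3), of 0 a]
          primitive_on_affine[OF assms(1), of 0 "- a"], of 1 1]]) simp_all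
qed

text \<open>The sum and the difference of the two waves are prescribed, the latter through its derivative and hence up
to one constant. Used with \<open>S\<close> a closed half-line.\<close>

lemma initial_data_determine_dAlembert:
  assumes f: "primitive_on UNIV f df" and g: "primitive_on UNIV g dg" and U: "primitive_on UNIV U u1"
    and S: "0 \<in> S" "\<And>s t. s \<in> S \<Longrightarrow> t \<in> S \<Longrightarrow> {s..t} \<subseteq> S" and a: "a > 0"
    and sum: "\<And>x. x \<in> S \<Longrightarrow> f x + g x = u0 x"
    and vel: "AE x in lebesgue. x \<in> S \<longrightarrow> - a * df x + a * dg x = u1 x"
  shows "\<exists>k. \<forall>x\<in>S. f x = (u0 x - U x / a) / 2 - k \<and> g x = (u0 x + U x / a) / 2 + k"
proof -
  define W where "W x = (- a) * f x + a * g x" for x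
  have "primitive_on UNIV W (\<lambda>x. (- a) * df x + a * dg x)"
    unfolding W_def by (rule primitive_on_lin[OF f g])
  then have "primitive_on UNIV W (\<lambda>x. if x \<in> S then u1 x else (- a) * df x + a * dg x)"
  proof (rule primitive_on_AE_cong)
    show "AE x in lebesgue. (if x \<in> S then u1 x else (- a) * df x + a * dg x) = (- a) * df x + a * dg x"
      using vel by eventually_elim auto
  qed
  from primitive_on_subset[OF this subset_UNIV, of S]
  have W: "primitive_on S W u1" by (rule primitive_on_cong) auto
  have const: "W x - U x = W 0 - U 0" if x: "x \<in> S" for x
  proof (cases "0 \<le> x")
    case True
    then show ?thesis
      using primitive_onD(3)[OF W True S(2)[OF S(1) x]] primitive_onD(3)[OF U True] by simp
  next
    case False
    then have "x \<le> 0" by simp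
    then show ?thesis
      using primitive_onD(3)[OF W _ S(2)[OF x S(1)]] primitive_onD(3)[OF U, of x 0] by simp
  qed
  show ?thesis
  proof (intro exI[of _ "(W 0 - U 0) / (2 * a)"] ballI conjI)
    fix x assume x: "x \<in> S"
    have "a * (g x - f x) = U x + (W 0 - U 0)" using const[OF x] by (simp add: W_def algebra_simps)
    define r where "r = U x / a"
    \<comment> \<open>The constant of integration left undetermined by the velocity.\<close>
    define c where "c = (W 0 - U 0) / (2 * a)"
    have "2 * c = (W 0 - U 0) / a" unfolding c_def using a by (simp add: field_simps)
    then have "(U x + (W 0 - U 0)) / a = U x / a + 2 * c" by (simp only: add_divide_distrib)
    moreover have "g x - f x = (U x + (W 0 - U 0)) / a"
      using a \<open>a * (g x - f x) = U x + (W 0 - U 0)\<close> by (metis nonzero_mult_div_cancel_left less_irrefl)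
    ultimately have d: "g x - f x = U x / a + 2 * c" by simp
    show "f x = (u0 x - U x / a) / 2 - (W 0 - U 0) / (2 * a)" using d sum[OF x] unfolding c_def[symmetric] r_def[symmetric] by (simp add: field_simps)
    show "g x = (u0 x + U x / a) / 2 + (W 0 - U 0) / (2 * a)" using d sum[OF x] unfolding c_def[symmetric] r_def[symmetric] by (simp add: field_simps)
  qed
qed

text \<open>The function \<open>Q\<close> is an antiderivative of the boundary force \<open>\<kappa> (u'(0+, t) - u'(0-, t))\<close>. For positive times the
outgoing waves \<open>fp\<close> and \<open>gm\<close> are eliminated through \<open>y\<close>, for negative times \<open>gp\<close> and
\<open>fm\<close>; what remains are the known waves, whose sum is the free solution \<open>be (a t) + al (- a t)\<close> at the origin. The
constants \<open>k\<close> and \<open>k'\<close> express the freedom in the d'Alembert decomposition and cancel.\<close>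

lemma boundary_flux:
  fixes fp gp fm gm al be y :: "real \<Rightarrow> real" and a b k k' \<kappa> :: real
  assumes a: "a > 0" and b: "b = 2 * \<kappa> / a"
    and yp: "\<And>t. y t = fp (- a * t) + gp (a * t)" and ym: "\<And>t. y t = fm (- a * t) + gm (a * t)"
    and p: "\<And>x. 0 \<le> x \<Longrightarrow> fp x = al x - k \<and> gp x = be x + k"
    and q: "\<And>x. x \<le> 0 \<Longrightarrow> fm x = al x - k' \<and> gm x = be x + k'"
  defines "Q \<equiv> \<lambda>t. \<kappa> / a * (- fp (- a * t) + gp (a * t) + fm (- a * t) - gm (a * t))"
  shows "Q t - Q 0 = - b * (sgn t * (y t - (be (a * t) + al (- a * t))))"
proof -
  have bk: "\<kappa> / a = b / 2" using b by simp
  have y0: "y 0 = al 0 + be 0" using yp[of 0] p[of 0] by simp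
  have Q0: "Q 0 = b * (k - k')"
  proof -
    have "fp 0 = al 0 - k" "gp 0 = be 0 + k" "fm 0 = al 0 - k'" "gm 0 = be 0 + k'" using p[of 0] q[of 0] by auto
    then have "Q 0 = b / 2 * (2 * (k - k'))" unfolding Q_def bk by simp
    then show ?thesis by (simp add: algebra_simps)
  qed
  consider "t > 0" | "t = 0" | "t < 0" by linarith
  then show ?thesis
  proof cases
    case 1
    have g: "gp (a * t) = be (a * t) + k" using p[of "a * t"] 1 a by simp
    have f: "fm (- a * t) = al (- a * t) - k'" using q[of "- a * t"] 1 a by (simp add: mult_nonneg_nonneg)
    have "fp (- a * t) = y t - gp (a * t)" "gm (a * t) = y t - fm (- a * t)" using yp[of t] ym[of t] by auto
    then have "- fp (- a * t) + gp (a * t) + fm (- a * t) - gm (a * t)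
        = 2 * (be (a * t) + al (- a * t) - y t + (k - k'))" using g f by (simp add: algebra_simps)
    then have "Q t = b / 2 * (2 * (be (a * t) + al (- a * t) - y t + (k - k')))" by (simp only: Q_def bk)
    then show ?thesis using 1 Q0 by (simp add: algebra_simps)
  next
    case 2
    then show ?thesis by simp
  next
    case 3
    then have at: "a * t \<le> 0" using a by (simp add: mult_nonneg_nonpos)
    have f: "fp (- a * t) = al (- a * t) - k" using p[of "- a * t"] at by simp
    have g: "gm (a * t) = be (a * t) + k'" using q[of "a * t"] at by simp
    have "gp (a * t) = y t - fp (- a * t)" "fm (- a * t) = y t - gm (a * t)" using yp[of t] ym[of t] by auto
    then have "- fp (- a * t) + gp (a * t) + fm (- a * t) - gm (a * t)
        = 2 * (y t - (be (a * t) + al (- a * t)) + (k - k'))" using g f by (simp add: algebra_simps)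
    then have "Q t = b / 2 * (2 * (y t - (be (a * t) + al (- a * t)) + (k - k')))" by (simp only: Q_def bk)
    then show ?thesis using 3 Q0 by (simp add: algebra_simps)
  qed
qed

lemma boundary_flux_primitive:
  fixes fp gp fm gm dfp dgp dfm dgm :: "real \<Rightarrow> real" and a \<kappa> :: real
  assumes P: "primitive_on UNIV fp dfp" "primitive_on UNIV gp dgp" "primitive_on UNIV fm dfm" "primitive_on UNIV gm dgm"
    and a: "a > 0"
  shows "primitive_on UNIV (\<lambda>t. \<kappa> / a * (- fp (- a * t) + gp (a * t) + fm (- a * t) - gm (a * t)))
     (\<lambda>t. \<kappa> * ((dfp (- a * t) + dgp (a * t)) - (dfm (- a * t) + dgm (a * t))))"
proof -
  have A: "primitive_on UNIV (\<lambda>t. f (0 + (- a) * t)) (\<lambda>t. (- a) * df (0 + (- a) * t))"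
    if "primitive_on UNIV f df" for f df by (rule primitive_on_affine[OF that])
  have B: "primitive_on UNIV (\<lambda>t. f (0 + a * t)) (\<lambda>t. a * df (0 + a * t))"
    if "primitive_on UNIV f df" for f df by (rule primitive_on_affine[OF that])
  note L1 = primitive_on_lin[OF A[OF P(1)] B[OF P(2)], of "- \<kappa> / a" "\<kappa> / a"]
  note L2 = primitive_on_lin[OF A[OF P(3)] B[OF P(4)], of "\<kappa> / a" "- \<kappa> / a"]
  show ?thesis
    by (rule primitive_on_cong[OF primitive_on_lin[OF L1 L2, of 1 1]]) (use a in \<open>simp_all add: field_simps\<close>)
qed

text \<open>If \<open>\<N>\<close> is a second antiderivative of the force \<open>G\<close>, then \<open>m y - \<N>\<close> has weak second derivative zero.
For \<open>m = 0\<close> this still carries information: then \<open>\<N>\<close> itself is affine.\<close>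

lemma weak_second_order_imp_integrated:
  fixes y G N \<N> :: "real \<Rightarrow> real"
  assumes y: "continuous_on UNIV y" and N: "primitive_on UNIV N G" and \<N>: "primitive_on UNIV \<N> N"
    and w: "\<And>\<phi>. \<phi> \<in> test_functions UNIV \<Longrightarrow>
      m * (\<integral>t. y t * dir_deriv 1 (dir_deriv 1 \<phi>) t \<partial>lebesgue) = (\<integral>t. G t * \<phi> t \<partial>lebesgue)"
  shows "\<exists>A B. \<forall>t. m * y t - \<N> t = A + B * t"
proof -
  have c\<N>: "continuous_on UNIV \<N>" by (rule primitive_on_UNIV_continuous[OF \<N>])
  obtain A B where "\<And>t. m * y t - \<N> t = A + B * t"
  proof (rule weak_second_deriv_zero_imp_affine[of "\<lambda>t. m * y t - \<N> t"])
    show "continuous_on UNIV (\<lambda>t. m * y t - \<N> t)" by (intro continuous_intros y c\<N>)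
    fix \<phi> :: "real \<Rightarrow> real" assume \<phi>: "\<phi> \<in> test_functions UNIV"
    let ?\<phi>2 = "dir_deriv 1 (dir_deriv 1 \<phi>)"
    have \<phi>1: "dir_deriv 1 \<phi> \<in> test_functions UNIV" by (rule dir_deriv_test_function[OF \<phi>]) simp
    have \<phi>2: "?\<phi>2 \<in> test_functions UNIV" by (rule dir_deriv_test_function[OF \<phi>1]) simp
    obtain R where R: "\<forall>x. R \<le> norm x \<longrightarrow> ?\<phi>2 x = 0" using test_function_bounded_support[OF \<phi>2] by blast
    have i: "integrable lebesgue (\<lambda>t. h t * ?\<phi>2 t)" if "continuous_on UNIV h" for h :: "real \<Rightarrow> real"
      by (rule L2_loc_mult_test_integrable[OF L2_loc_continuous[OF that] test_function_real(2)[OF \<phi>1], of R])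
         (use R in blast)
    have "(\<integral>t. G t * \<phi> t \<partial>lebesgue) = - (\<integral>t. N t * dir_deriv 1 \<phi> t \<partial>lebesgue)"
      using primitive_imp_weak_deriv[OF N] \<phi> by (simp add: has_weak_deriv_def)
    also have "\<dots> = (\<integral>t. \<N> t * ?\<phi>2 t \<partial>lebesgue)"
      using primitive_imp_weak_deriv[OF \<N>] \<phi>1 by (simp add: has_weak_deriv_def)
    finally have "m * (\<integral>t. y t * ?\<phi>2 t \<partial>lebesgue) = (\<integral>t. \<N> t * ?\<phi>2 t \<partial>lebesgue)" using w[OF \<phi>] by simp
    moreover have "(\<integral>t. (m * y t - \<N> t) * ?\<phi>2 t \<partial>lebesgue)
        = (\<integral>t. m * (y t * ?\<phi>2 t) - \<N> t * ?\<phi>2 t \<partial>lebesgue)" by (simp add: algebra_simps)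
    moreover have "\<dots> = m * (\<integral>t. y t * ?\<phi>2 t \<partial>lebesgue) - (\<integral>t. \<N> t * ?\<phi>2 t \<partial>lebesgue)"
      using i[OF y] i[OF c\<N>] by simp
    ultimately show "(\<integral>t. (m * y t - \<N> t) * ?\<phi>2 t \<partial>lebesgue) = 0" by simp
  qed blast
  then show ?thesis by blast
qed

text \<open>The solution in terms of \<open>y\<close> and the waves \<open>al\<close> and \<open>be\<close> given by the data. Each wave equals
\<open>al\<close> or \<open>be\<close> on the half-line where the data determine it; elsewhere it is recovered from the condition that the two waves
add up to \<open>y\<close> at the origin.\<close>

definition lamb_wave :: "real \<Rightarrow> (real \<Rightarrow> real) \<Rightarrow> (real \<Rightarrow> real) \<Rightarrow> (real \<Rightarrow> real) \<Rightarrow> real \<times> real \<Rightarrow> real" where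
  "lamb_wave a al be y p = (let x = fst p; t = snd p;
     refl_f = (\<lambda>z. y (- z / a) - be (- z)); refl_g = (\<lambda>z. y (z / a) - al (- z)) in
     if 0 \<le> x then (if 0 \<le> x - a * t then al (x - a * t) else refl_f (x - a * t))
                   + (if 0 \<le> x + a * t then be (x + a * t) else refl_g (x + a * t))
     else (if 0 \<le> x - a * t then refl_f (x - a * t) else al (x - a * t))
                   + (if 0 \<le> x + a * t then refl_g (x + a * t) else be (x + a * t)))"

text \<open>Uniqueness half of the reduction: the decomposition of \<open>u\<close> is determined by the data and \<open>y\<close> up
to constants that cancel in \<open>u\<close>, and \<open>y\<close> satisfies the integrated oscillator equation. The two integration
constants of the oscillator equation come from \<open>y 0 = u0 0\<close> and from \<open>y' 0 = y1\<close>; for \<open>m = 0\<close> the slope vanishes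
because \<open>\<N>\<close> has derivative zero at the origin.\<close>

lemma lamb_solution_imp_two_sided_sol:
  fixes m \<mu> \<kappa> y1 :: real and F u0 u1 U y :: "real \<Rightarrow> real"
  assumes \<mu>: "\<mu> > 0" and \<kappa>: "\<kappa> > 0" and F: "continuous_on UNIV F"
    and u0: "continuous_on UNIV u0" and U: "primitive_on UNIV U u1"
    and uE: "continuous_on UNIV u" and sol: "lamb_solution m \<mu> \<kappa> F u0 u1 y1 u y"
  defines "a \<equiv> sqrt (\<kappa> / \<mu>)"
  defines "al \<equiv> \<lambda>x. (u0 x - U x / a) / 2" and "be \<equiv> \<lambda>x. (u0 x + U x / a) / 2"
  shows "two_sided_sol m (2 * \<kappa> / a) F (\<lambda>t. be (a * t) + al (- a * t)) y1 y"
    and "u = lamb_wave a al be y"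
proof -
  have a: "a > 0" using \<mu> \<kappa> by (simp add: a_def)
  note sol' = sol[unfolded lamb_solution_def Let_def, folded a_def]
  have lim: "((\<lambda>x. u (x, t)) \<longlongrightarrow> y t) (at_left 0)" "((\<lambda>x. u (x, t)) \<longlongrightarrow> y t) (at_right 0)" for t
    using sol' by blast+
  have y1: "m \<noteq> 0 \<Longrightarrow> (y has_real_derivative y1) (at 0)" using sol' by blast
  obtain fp gp dfp dgp fm gm dfm dgm where
    dp: "dAlembert a {0<..} u fp gp dfp dgp" and dm: "dAlembert a {..<0} u fm gm dfm dgm"
    and osc: "oscillator_eq m \<kappa> F y (\<lambda>t. dfp (- a * t) + dgp (a * t)) (\<lambda>t. dfm (- a * t) + dgm (a * t))"
    and i0: "\<forall>x>0. fp x + gp x = u0 x" "\<forall>x<0. fm x + gm x = u0 x"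
    and i1: "AE x in lebesgue. x > 0 \<longrightarrow> - a * dfp x + a * dgp x = u1 x"
       "AE x in lebesgue. x < 0 \<longrightarrow> - a * dfm x + a * dgm x = u1 x"
    using sol' by blast
  have P: "primitive_on UNIV fp dfp" "primitive_on UNIV gp dgp" "primitive_on UNIV fm dfm" "primitive_on UNIV gm dgm"
    using dp dm weak_deriv_imp_primitive unfolding dAlembert_def by blast+
  have c: "continuous_on UNIV fp" "continuous_on UNIV gp" "continuous_on UNIV fm" "continuous_on UNIV gm"
    using dp dm unfolding dAlembert_def by blast+
  have cs: "continuous_on UNIV (\<lambda>x. h (x + s))" if "continuous_on UNIV h" for h :: "real \<Rightarrow> real" and s
    by (rule continuous_on_compose2[OF that]) (auto intro!: continuous_intros)
  have cs': "continuous_on UNIV (\<lambda>x. h (x - s))" if "continuous_on UNIV h" for h :: "real \<Rightarrow> real" and s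
    by (rule continuous_on_compose2[OF that]) (auto intro!: continuous_intros)
  have up: "u (x, t) = fp (x - a * t) + gp (x + a * t)" if "x > 0" for x t
    using dp that unfolding dAlembert_def by auto
  have um: "u (x, t) = fm (x - a * t) + gm (x + a * t)" if "x < 0" for x t
    using dm that unfolding dAlembert_def by auto
  have yp: "y t = fp (- a * t) + gp (a * t)" for t
  proof -
    have "continuous_on UNIV (\<lambda>x. fp (x - a * t) + gp (x + a * t))" by (intro continuous_on_add cs cs' c)
    from one_sided_limit_eq(1)[OF this lim(2)[of t] up] show ?thesis by simp
  qed
  have ym: "y t = fm (- a * t) + gm (a * t)" for t
  proof -
    have "continuous_on UNIV (\<lambda>x. fm (x - a * t) + gm (x + a * t))" by (intro continuous_on_add cs cs' c)
    from one_sided_limit_eq(2)[OF this lim(1)[of t] um] show ?thesis by simp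
  qed
  have u0t: "u (0, t) = y t" for t
  proof -
    have "continuous_on UNIV (\<lambda>x. u (x, t))"
      by (rule continuous_on_compose2[OF uE]) (auto intro!: continuous_intros)
    from one_sided_limit_eq(1)[OF this lim(2)[of t]] show ?thesis by simp
  qed
  have cu0: "(u0 \<longlongrightarrow> u0 0) (at 0)" using u0 by (simp add: continuous_on_def)
  have s0: "fp 0 + gp 0 = u0 0"
  proof -
    have "(u0 \<longlongrightarrow> u0 0) (at_right 0)" using cu0 by (rule tendsto_within_subset) simp
    from one_sided_limit_eq(1)[OF continuous_on_add[OF c(1,2)] this] show ?thesis using i0 by simp
  qed
  have s0': "fm 0 + gm 0 = u0 0"
  proof -
    have "(u0 \<longlongrightarrow> u0 0) (at_left 0)" using cu0 by (rule tendsto_within_subset) simp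
    from one_sided_limit_eq(2)[OF continuous_on_add[OF c(3,4)] this] show ?thesis using i0 by simp
  qed
  have null0: "AE x in lebesgue. x \<noteq> (0::real)"
    by (rule AE_I'[of "{0}"]) (auto simp flip: negligible_iff_null_sets)
  have "\<exists>k. \<forall>x\<in>{0..}. fp x = (u0 x - U x / a) / 2 - k \<and> gp x = (u0 x + U x / a) / 2 + k"
  proof (rule initial_data_determine_dAlembert[OF P(1,2) U _ _ a])
    show "fp x + gp x = u0 x" if "x \<in> {0..}" for x using that i0 s0 by (cases "x = 0") auto
    show "AE x in lebesgue. x \<in> {0..} \<longrightarrow> - a * dfp x + a * dgp x = u1 x"
      using i1(1) null0 by eventually_elim auto
  qed auto
  then obtain k where k: "fp x = al x - k \<and> gp x = be x + k" if "0 \<le> x" for x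
    unfolding al_def be_def by auto
  have "\<exists>k. \<forall>x\<in>{..0}. fm x = (u0 x - U x / a) / 2 - k \<and> gm x = (u0 x + U x / a) / 2 + k"
  proof (rule initial_data_determine_dAlembert[OF P(3,4) U _ _ a])
    show "fm x + gm x = u0 x" if "x \<in> {..0}" for x using that i0 s0' by (cases "x = 0") auto
    show "AE x in lebesgue. x \<in> {..0} \<longrightarrow> - a * dfm x + a * dgm x = u1 x"
      using i1(2) null0 by eventually_elim auto
  qed auto
  then obtain k' where k': "fm x = al x - k' \<and> gm x = be x + k'" if "x \<le> 0" for x
    unfolding al_def be_def by auto
  define Q where "Q t = \<kappa> / a * (- fp (- a * t) + gp (a * t) + fm (- a * t) - gm (a * t))" for t
  have flux: "Q t - Q 0 = - (2 * \<kappa> / a) * (sgn t * (y t - (be (a * t) + al (- a * t))))" for t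
    unfolding Q_def by (rule boundary_flux[OF a refl yp ym k k'])
  have PQ: "primitive_on UNIV Q (\<lambda>t. \<kappa> * ((dfp (- a * t) + dgp (a * t)) - (dfm (- a * t) + dgm (a * t))))"
    unfolding Q_def by (rule boundary_flux_primitive[OF P a])
  have cy: "continuous_on UNIV y"
  proof -
    have "continuous_on UNIV (\<lambda>t. fp (- a * t) + gp (a * t))"
      by (intro continuous_on_add continuous_on_compose2[OF c(1)] continuous_on_compose2[OF c(2)])
         (auto intro!: continuous_intros)
    moreover have "(\<lambda>t. fp (- a * t) + gp (a * t)) = y" by (rule ext) (rule yp[symmetric])
    ultimately show ?thesis by (simp only:)
  qed
  have cFy: "continuous_on UNIV (\<lambda>t. F (y t))" by (rule continuous_on_compose2[OF F cy]) simp
  obtain \<Phi> where \<Phi>: "primitive_on UNIV \<Phi> (\<lambda>t. F (y t))" "\<Phi> 0 = 0"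
    using primitive_of_L2_exists[OF L2_loc_continuous[OF cFy]] by blast
  define N where "N t = \<Phi> t + (Q t - Q 0)" for t
  define G where "G t = F (y t) + \<kappa> * ((dfp (- a * t) + dgp (a * t)) - (dfm (- a * t) + dgm (a * t)))" for t
  have PN: "primitive_on UNIV N G"
  proof -
    note L = primitive_on_lin[OF \<Phi>(1) PQ, of 1 1]
    show ?thesis unfolding primitive_on_def N_def G_def
      using L unfolding primitive_on_def by simp
  qed
  have cN: "continuous_on UNIV N" by (rule primitive_on_UNIV_continuous[OF PN])
  obtain \<N> where \<N>: "primitive_on UNIV \<N> N" "\<N> 0 = 0"
    using primitive_of_L2_exists[OF L2_loc_continuous[OF cN]] by blast
  have D\<N>: "(\<N> has_real_derivative N t) (at t)" for t by (rule primitive_on_DERIV[OF \<N>(1) cN])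
  have N0: "N 0 = 0" using \<Phi>(2) by (simp add: N_def)
  have "\<exists>A B. \<forall>t. m * y t - \<N> t = A + B * t"
    by (rule weak_second_order_imp_integrated[OF cy PN \<N>(1)])
       (use osc in \<open>simp add: oscillator_eq_def G_def\<close>)
  then obtain A B where AB: "\<And>t. m * y t = A + B * t + \<N> t" by (metis diff_eq_eq)
  have DAB: "((\<lambda>t. A + B * t + \<N> t) has_real_derivative (B + N t)) (at t)" for t
    by (auto intro!: derivative_eq_intros D\<N>)
  then have DmY: "((\<lambda>t. m * y t) has_real_derivative (B + N t)) (at t)" for t
    using AB by (simp only:)
  \<comment> \<open>The slope is read off from the derivative of \<open>m y\<close> at the origin.\<close>
  have B: "B = m * y1"
  proof (cases "m = 0")
    case True
    have "((\<lambda>t. m * y t) has_real_derivative 0) (at 0)" using True by simp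
    then have "B + N 0 = 0" using DmY[of 0] DERIV_unique by blast
    then show ?thesis using N0 True by simp
  next
    case False
    have "((\<lambda>t. m * y t) has_real_derivative m * y1) (at 0)" by (rule DERIV_cmult[OF y1[OF False]])
    then have "B + N 0 = m * y1" using DmY[of 0] DERIV_unique by blast
    then show ?thesis using N0 by simp
  qed
  define M where "M t = m * y1 + N t" for t
  have M0: "M t = 0" if "m = 0" for t
  proof -
    have "((\<lambda>t. m * y t) has_real_derivative 0) (at t)" using that by simp
    then have "B + N t = 0" using DmY[of t] DERIV_unique by blast
    then show ?thesis using B by (simp add: M_def)
  qed
  have cM: "continuous_on UNIV M" unfolding M_def by (intro continuous_intros cN)
  have PM: "primitive_on UNIV (\<lambda>t. m * y t) M"
    by (rule primitive_on_C1) (use DmY cM in \<open>simp_all add: B M_def\<close>)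
  have y0: "y 0 = be (a * 0) + al (- a * 0)" using yp[of 0] k[of 0] by simp
  have MF: "M t = m * y1 + \<Phi> t - 2 * \<kappa> / a * (sgn t * (y t - (be (a * t) + al (- a * t))))" for t
    using flux[of t] by (simp add: M_def N_def)
  show "two_sided_sol m (2 * \<kappa> / a) F (\<lambda>t. be (a * t) + al (- a * t)) y1 y"
    by (rule two_sided_solI[OF cy y0 \<Phi> PM MF M0])
  have fpn: "fp x = (if 0 \<le> x then al x else y (- x / a) - be (- x)) - k" for x
  proof (cases "0 \<le> x")
    case False
    have "y (- x / a) = fp x + gp (- x)" using yp[of "- x / a"] a by simp
    then show ?thesis using k[of "- x"] False by simp
  qed (use k in simp)
  have gpn: "gp x = (if 0 \<le> x then be x else y (x / a) - al (- x)) + k" for x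
  proof (cases "0 \<le> x")
    case False
    have "y (x / a) = fp (- x) + gp x" using yp[of "x / a"] a by simp
    then show ?thesis using k[of "- x"] False by simp
  qed (use k in simp)
  have fmn: "fm x = (if 0 \<le> x then y (- x / a) - be (- x) else al x) - k'" for x
  proof (cases "0 \<le> x")
    case True
    have "y (- x / a) = fm x + gm (- x)" using ym[of "- x / a"] a by simp
    then show ?thesis using k'[of "- x"] True by simp
  qed (use k' in simp)
  have gmn: "gm x = (if 0 \<le> x then y (x / a) - al (- x) else be x) + k'" for x
  proof (cases "0 \<le> x")
    case True
    have "y (x / a) = fm (- x) + gm x" using ym[of "x / a"] a by simp
    then show ?thesis using k'[of "- x"] True by simp
  qed (use k' in simp)
  show "u = lamb_wave a al be y"
  proof
    fix p :: "real \<times> real"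
    obtain x t where p: "p = (x, t)" by (cases p)
    show "u p = lamb_wave a al be y p"
    proof (cases "0 \<le> x")
      case True
      have "u (x, t) = fp (x - a * t) + gp (x + a * t)"
        using up[of x t] yp[of t] u0t[of t] True by (cases "x = 0") auto
      then show ?thesis unfolding p lamb_wave_def fpn gpn Let_def using True by simp
    next
      case False
      have "u (x, t) = fm (x - a * t) + gm (x + a * t)" using um[of x t] False by simp
      then show ?thesis unfolding p lamb_wave_def fmn gmn Let_def using False by simp
    qed
  qed
qed

section \<open>From the oscillator to waves\<close>

text \<open>Existence half of the reduction. On each half-line the wave that the data do not determine is defined
by the condition that the two waves add up to \<open>y\<close> at the origin; the velocity of \<open>y\<close> is locally square integrable, so
all four waves have locally square integrable derivatives.\<close>

lemma two_sided_sol_imp_lamb_solution: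
  fixes m \<mu> \<kappa> y1 :: real and F u0 u1 U w y :: "real \<Rightarrow> real"
  assumes \<mu>: "\<mu> > 0" and \<kappa>: "\<kappa> > 0" and F: "continuous_on UNIV F"
    and u0: "primitive_on UNIV u0 w" "w \<in> L2_loc" and U: "primitive_on UNIV U u1" "u1 \<in> L2_loc"
  defines "a \<equiv> sqrt (\<kappa> / \<mu>)"
  defines "al \<equiv> \<lambda>x. (u0 x - U x / a) / 2" and "be \<equiv> \<lambda>x. (u0 x + U x / a) / 2"
  assumes y: "two_sided_sol m (2 * \<kappa> / a) F (\<lambda>t. be (a * t) + al (- a * t)) y1 y"
  shows "lamb_wave a al be y \<in> class_E" and "lamb_solution m \<mu> \<kappa> F u0 u1 y1 (lamb_wave a al be y) y"
proof -
  have a: "a > 0" using \<mu> \<kappa> by (simp add: a_def)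
  have \<kappa>a: "\<kappa> = \<mu> * a\<^sup>2" using \<mu> \<kappa> by (simp add: a_def)
  have b: "2 * \<kappa> / a > 0" using \<kappa> a by simp
  obtain dal dbe where Pal: "primitive_on UNIV al dal" and Lal: "dal \<in> L2_loc"
    and Pbe: "primitive_on UNIV be dbe" and Lbe: "dbe \<in> L2_loc" and d: "\<And>x. - a * dal x + a * dbe x = u1 x"
    by (rule dAlembert_waves_primitive[OF u0 U a, folded al_def be_def]) (rule that)
  let ?D = "\<lambda>t. be (a * t) + al (- a * t)"
  obtain dD where dD: "dD \<in> L2_loc" "primitive_on UNIV ?D dD"
    using free_displacement_primitive[OF Pal Lal Pbe Lbe a] by blast
  obtain v where v: "v \<in> L2_loc" "primitive_on UNIV y v"
    using two_sided_sol_velocity[OF y F dD(2,1) b] by blast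
  obtain \<Phi> M where h: "continuous_on UNIV y" "y 0 = ?D 0" "primitive_on UNIV \<Phi> (\<lambda>t. F (y t))" "\<Phi> 0 = 0"
    "primitive_on UNIV (\<lambda>t. m * y t) M" "\<And>t. M t = m * y1 + \<Phi> t - 2 * \<kappa> / a * (sgn t * (y t - ?D t))"
    "\<And>t. m = 0 \<Longrightarrow> M t = 0"
    by (rule two_sided_solE[OF y]) (rule that)
  have y0: "y 0 = be 0 + al 0" using h(2) by simp
  \<comment> \<open>The waves that the data leave undetermined, prescribed by \<open>y\<close>, and their derivatives.\<close>
  define rf drf where "rf = (\<lambda>x. y (- x / a) - be (- x))" and "drf = (\<lambda>x. 1 * (- (1 / a) * v (0 + - (1 / a) * x)) + (- 1) * (- 1 * dbe (0 + - 1 * x)))"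
  define rg drg where "rg = (\<lambda>x. y (x / a) - al (- x))" and "drg = (\<lambda>x. 1 * (1 / a * v (0 + 1 / a * x)) + (- 1) * (- 1 * dal (0 + - 1 * x)))"
  have Prf: "primitive_on UNIV rf drf" unfolding drf_def
    by (rule primitive_on_cong[OF primitive_on_lin[OF primitive_on_affine[OF v(2), of 0 "- (1 / a)"] primitive_on_affine[OF Pbe, of 0 "-1"], of 1 "-1"]])
       (simp_all add: rf_def)
  have Prg: "primitive_on UNIV rg drg" unfolding drg_def
    by (rule primitive_on_cong[OF primitive_on_lin[OF primitive_on_affine[OF v(2), of 0 "1 / a"] primitive_on_affine[OF Pal, of 0 "-1"], of 1 "-1"]])
       (simp_all add: rg_def)
  have Lrf: "drf \<in> L2_loc" unfolding drf_def using a by (intro L2_loc_lin L2_loc_cmult L2_loc_affine v Lbe) auto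
  have Lrg: "drg \<in> L2_loc" unfolding drg_def using a by (intro L2_loc_lin L2_loc_cmult L2_loc_affine v Lal) auto
  have rf0: "al 0 = rf 0" and rg0: "be 0 = rg 0" using y0 by (simp_all add: rf_def rg_def)
  define fp dfp where "fp = (\<lambda>x. if 0 \<le> x then al x else rf x)" and "dfp = (\<lambda>x. if 0 \<le> x then dal x else drf x)"
  define gp dgp where "gp = (\<lambda>x. if 0 \<le> x then be x else rg x)" and "dgp = (\<lambda>x. if 0 \<le> x then dbe x else drg x)"
  define fm dfm where "fm = (\<lambda>x. if 0 \<le> x then rf x else al x)" and "dfm = (\<lambda>x. if 0 \<le> x then drf x else dal x)"
  define gm dgm where "gm = (\<lambda>x. if 0 \<le> x then rg x else be x)" and "dgm = (\<lambda>x. if 0 \<le> x then drg x else dbe x)"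
  have glue: "primitive_on UNIV (\<lambda>x. if 0 \<le> x then h1 x else h2 x) (\<lambda>x. if 0 \<le> x then d1 x else d2 x)"
    if "primitive_on UNIV h1 d1" "primitive_on UNIV h2 d2" "h1 0 = h2 0" for h1 h2 d1 d2
    using that by (intro primitive_on_glue primitive_on_subset[OF that(1)] primitive_on_subset[OF that(2)]) auto
  have P: "primitive_on UNIV fp dfp" "primitive_on UNIV gp dgp" "primitive_on UNIV fm dfm" "primitive_on UNIV gm dgm"
    unfolding fp_def dfp_def gp_def dgp_def fm_def dfm_def gm_def dgm_def
    by (intro glue Pal Pbe Prf Prg rf0 rg0 rf0[symmetric] rg0[symmetric])+
  have L: "dfp \<in> L2_loc" "dgp \<in> L2_loc" "dfm \<in> L2_loc" "dgm \<in> L2_loc"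
    unfolding dfp_def dgp_def dfm_def dgm_def by (intro L2_loc_glue Lal Lbe Lrf Lrg)+
  have yp: "y t = fp (- a * t) + gp (a * t)" for t
  proof -
    consider "t > 0" | "t = 0" | "t < 0" by linarith
    then show ?thesis
    proof cases
      case 1
      then have "0 < a * t" using a by simp
      then show ?thesis using a by (simp add: fp_def gp_def rf_def)
    next
      case 2
      then show ?thesis using y0 by (simp add: fp_def gp_def)
    next
      case 3
      then have "a * t < 0" using a by (simp add: mult_pos_neg)
      then show ?thesis using a by (simp add: fp_def gp_def rg_def)
    qed
  qed
  have ym: "y t = fm (- a * t) + gm (a * t)" for t
  proof -
    consider "t > 0" | "t = 0" | "t < 0" by linarith
    then show ?thesis
    proof cases
      case 1
      then have "0 < a * t" using a by simp
      then show ?thesis using a by (simp add: fm_def gm_def rg_def)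
    next
      case 2
      then show ?thesis using y0 rf0 rg0 by (simp add: fm_def gm_def)
    next
      case 3
      then have "a * t < 0" using a by (simp add: mult_pos_neg)
      then show ?thesis using a by (simp add: fm_def gm_def rf_def)
    qed
  qed
  define u where "u = lamb_wave a al be y"
  have ueq: "u = (\<lambda>p. if 0 \<le> fst p then fp (fst p - a * snd p) + gp (fst p + a * snd p)
                   else fm (fst p - a * snd p) + gm (fst p + a * snd p))"
    by (rule ext) (simp add: u_def lamb_wave_def Let_def fp_def gp_def fm_def gm_def rf_def rg_def)
  have match: "fp (- a * t) + gp (a * t) = fm (- a * t) + gm (a * t)" for t using yp[of t] ym[of t] by linarith
  note DG = dAlembert_glued[OF P L match \<kappa>a, folded ueq]
  show "lamb_wave a al be y \<in> class_E" using DG(1) by (simp add: u_def)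
  have cu: "continuous_on UNIV u" using DG(1) by (simp add: class_E_def)
  have u0t: "u (0, t) = y t" for t using yp[of t] by (simp add: ueq)
  have lim: "((\<lambda>x. u (x, t)) \<longlongrightarrow> y t) (at 0)" for t
  proof -
    have "continuous_on UNIV (\<lambda>x. u (x, t))"
      by (rule continuous_on_compose2[OF cu]) (auto intro!: continuous_intros)
    then show ?thesis using u0t[of t] by (simp add: continuous_on_def) metis
  qed
  have dA: "dAlembert a {0<..} u fp gp dfp dgp" "dAlembert a {..<0} u fm gm dfm dgm"
    unfolding dAlembert_def
    using P L primitive_on_UNIV_continuous[OF P(1)] primitive_on_UNIV_continuous[OF P(2)]
      primitive_on_UNIV_continuous[OF P(3)] primitive_on_UNIV_continuous[OF P(4)]
      primitive_imp_weak_deriv[OF P(1)] primitive_imp_weak_deriv[OF P(2)]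
      primitive_imp_weak_deriv[OF P(3)] primitive_imp_weak_deriv[OF P(4)] by (simp_all add: ueq)
  define Q where "Q t = \<kappa> / a * (- fp (- a * t) + gp (a * t) + fm (- a * t) - gm (a * t))" for t
  have flux: "Q t - Q 0 = - (2 * \<kappa> / a) * (sgn t * (y t - ?D t))" for t
    unfolding Q_def
    by (rule boundary_flux[where k = 0 and k' = 0 and al = al and be = be and fp = fp and gp = gp
          and fm = fm and gm = gm and y = y, OF a refl yp ym])
       (use rf0 rg0 in \<open>auto simp: fp_def gp_def fm_def gm_def\<close>)
  define G where "G t = F (y t) + \<kappa> * ((dfp (- a * t) + dgp (a * t)) - (dfm (- a * t) + dgm (a * t)))" for t
  have "primitive_on UNIV (\<lambda>t. 1 * \<Phi> t + 1 * Q t) (\<lambda>t. 1 * F (y t) + 1 * (\<kappa> * ((dfp (- a * t) + dgp (a * t)) - (dfm (- a * t) + dgm (a * t)))))"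
    unfolding Q_def by (rule primitive_on_lin[OF h(3) boundary_flux_primitive[OF P a]])
  moreover have "M t = (1 * \<Phi> t + 1 * Q t) + (m * y1 - Q 0)" for t using flux[of t] h(6)[of t] by simp
  ultimately have PM: "primitive_on UNIV M G" unfolding primitive_on_def G_def by simp
  have osc: "oscillator_eq m \<kappa> F y (\<lambda>t. dfp (- a * t) + dgp (a * t)) (\<lambda>t. dfm (- a * t) + dgm (a * t))"
    unfolding oscillator_eq_def
  proof
    fix \<phi> :: "real \<Rightarrow> real" assume \<phi>: "\<phi> \<in> test_functions UNIV"
    have \<phi>1: "dir_deriv 1 \<phi> \<in> test_functions UNIV" by (rule dir_deriv_test_function[OF \<phi>]) simp
    have "m * (\<integral>t. y t * dir_deriv 1 (dir_deriv 1 \<phi>) t \<partial>lebesgue)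
        = (\<integral>t. (m * y t) * dir_deriv 1 (dir_deriv 1 \<phi>) t \<partial>lebesgue)" by (simp add: mult.assoc)
    also have "\<dots> = - (\<integral>t. M t * dir_deriv 1 \<phi> t \<partial>lebesgue)"
      using primitive_imp_weak_deriv[OF h(5)] \<phi>1 unfolding has_weak_deriv_def by blast
    also have "\<dots> = (\<integral>t. G t * \<phi> t \<partial>lebesgue)"
      using primitive_imp_weak_deriv[OF PM] \<phi> unfolding has_weak_deriv_def by simp
    finally show "m * (\<integral>t. y t * dir_deriv 1 (dir_deriv 1 \<phi>) t \<partial>lebesgue) =
        (\<integral>t. (F (y t) + \<kappa> * ((dfp (- a * t) + dgp (a * t)) - (dfm (- a * t) + dgm (a * t)))) * \<phi> t \<partial>lebesgue)"
      by (simp add: G_def)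
  qed
  have vel: "(y has_real_derivative y1) (at 0)" if "m \<noteq> 0"
  proof -
    have "((\<lambda>t. m * y t) has_real_derivative M 0) (at 0)"
      by (rule primitive_on_DERIV[OF h(5) primitive_on_UNIV_continuous[OF PM]])
    then have "((\<lambda>t. (1 / m) * (m * y t)) has_real_derivative (1 / m) * M 0) (at 0)" by (rule DERIV_cmult)
    then show ?thesis using that h(6)[of 0] h(4) by simp
  qed
  have s: "al x + be x = u0 x" for x by (simp add: al_def be_def field_simps)
  show "lamb_solution m \<mu> \<kappa> F u0 u1 y1 (lamb_wave a al be y) y"
    unfolding lamb_solution_def Let_def a_def[symmetric] u_def[symmetric]
  proof (intro conjI allI)
    show "wave_eq \<mu> \<kappa> u" by (rule DG(2))
    show "((\<lambda>x. u (x, t)) \<longlongrightarrow> y t) (at_left 0)" "((\<lambda>x. u (x, t)) \<longlongrightarrow> y t) (at_right 0)" for t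
      using lim[of t] by (rule tendsto_within_subset; simp)+
    show "\<exists>f_plus g_plus df_plus dg_plus f_minus g_minus df_minus dg_minus.
         dAlembert a {0<..} u f_plus g_plus df_plus dg_plus \<and>
         dAlembert a {..<0} u f_minus g_minus df_minus dg_minus \<and>
         oscillator_eq m \<kappa> F y
           (\<lambda>t. df_plus (- a * t) + dg_plus (a * t))
           (\<lambda>t. df_minus (- a * t) + dg_minus (a * t)) \<and>
         (\<forall>x>0. f_plus x + g_plus x = u0 x) \<and>
         (\<forall>x<0. f_minus x + g_minus x = u0 x) \<and>
         (AE x in lebesgue. x > 0 \<longrightarrow> - a * df_plus x + a * dg_plus x = u1 x) \<and>
         (AE x in lebesgue. x < 0 \<longrightarrow> - a * df_minus x + a * dg_minus x = u1 x)"
    proof (rule exI[of _ fp], rule exI[of _ gp], rule exI[of _ dfp], rule exI[of _ dgp],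
        rule exI[of _ fm], rule exI[of _ gm], rule exI[of _ dfm], rule exI[of _ dgm], intro conjI dA osc)
      show "\<forall>x>0. fp x + gp x = u0 x" "\<forall>x<0. fm x + gm x = u0 x"
        using s by (simp_all add: fp_def gp_def fm_def gm_def)
      show "AE x in lebesgue. x > 0 \<longrightarrow> - a * dfp x + a * dgp x = u1 x"
        "AE x in lebesgue. x < 0 \<longrightarrow> - a * dfm x + a * dgm x = u1 x"
        using d by (simp_all add: dfp_def dgp_def dfm_def dgm_def)
    qed
    show "m \<noteq> 0 \<longrightarrow> (y has_real_derivative y1) (at 0)" using vel by blast
  qed
qed

theorem proposition1p3:
  fixes m \<mu> \<kappa> y1 :: real and V F u0 u1 :: "real \<Rightarrow> real"
  assumes "m \<ge> 0" and "\<mu> > 0" and "\<kappa> > 0"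
    and "Ck 2 V"
    and "filterlim V at_top at_infinity"
    and "F = (\<lambda>y. - deriv V y)"
    and "(u0, u1) \<in> class_H"
  shows "\<exists>!u. u \<in> class_E \<and> (\<exists>y. lamb_solution m \<mu> \<kappa> F u0 u1 y1 u y)"
proof -
  have V2: "Ck (Suc (Suc 0)) V" using assms(4) by (simp add: numeral_2_eq_2)
  have DV: "(V has_real_derivative dir_deriv 1 V x) (at x)" for x by (rule Ck_SucD_real(1)[OF V2])
  have V1: "Ck (Suc 0) (dir_deriv 1 V)" by (rule Ck_SucD_real(2)[OF V2])
  have DDV: "(dir_deriv 1 V has_real_derivative dir_deriv 1 (dir_deriv 1 V) x) (at x)" for x
    by (rule Ck_SucD_real(1)[OF V1])
  have cDDV: "continuous_on UNIV (dir_deriv 1 (dir_deriv 1 V))" using Ck_SucD_real(2)[OF V1] by simp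
  have F: "F = (\<lambda>x. - dir_deriv 1 V x)"
    unfolding assms(6) using DERIV_imp_deriv[OF DV] by simp
  have VF: "(V has_real_derivative - F x) (at x)" for x using DV by (simp add: F)
  have DF: "(F has_real_derivative - dir_deriv 1 (dir_deriv 1 V) x) (at x)" for x
    unfolding F by (rule DERIV_minus[OF DDV])
  have cF: "continuous_on UNIV F" using DF by (auto intro!: continuous_at_imp_continuous_on DERIV_isCont)
  have lip: "\<exists>\<Lambda>\<ge>0. \<forall>x\<in>{-R..R}. \<forall>y\<in>{-R..R}. \<bar>F x - F y\<bar> \<le> \<Lambda> * \<bar>x - y\<bar>" for R
    by (rule C1_locally_lipschitz[OF DF]) (intro continuous_intros cDDV)
  obtain w where w: "w \<in> L2_loc" "has_weak_deriv 1 u0 w" and cu0: "continuous_on UNIV u0" and u1: "u1 \<in> L2_loc"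
    using assms(7) by (auto simp: class_H_def)
  have Pu0: "primitive_on UNIV u0 w" by (rule weak_deriv_imp_primitive[OF cu0 w])
  obtain U where U: "primitive_on UNIV U u1" using primitive_of_L2_exists[OF u1] by blast
  define a where "a = sqrt (\<kappa> / \<mu>)"
  define al where "al = (\<lambda>x. (u0 x - U x / a) / 2)"
  define be where "be = (\<lambda>x. (u0 x + U x / a) / 2)"
  define D where "D = (\<lambda>t. be (a * t) + al (- a * t))"
  have a: "a > 0" using assms by (simp add: a_def)
  have b: "2 * \<kappa> / a > 0" using a assms by simp
  obtain dal dbe where P: "primitive_on UNIV al dal" "dal \<in> L2_loc" "primitive_on UNIV be dbe" "dbe \<in> L2_loc"
      "\<And>x. - a * dal x + a * dbe x = u1 x"
    by (rule dAlembert_waves_primitive[OF Pu0 w(1) U u1 a, folded al_def be_def]) (rule that)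
  have "\<exists>d\<in>L2_loc. primitive_on UNIV D d" unfolding D_def by (rule free_displacement_primitive[OF P(1-4) a])
  then obtain d where d: "primitive_on UNIV D d" "d \<in> L2_loc" by blast
  obtain y where y: "two_sided_sol m (2 * \<kappa> / a) F D y1 y"
    using two_sided_sol_exists[OF cF d b assms(1) VF assms(5) lip, of y1] by blast
  note E = two_sided_sol_imp_lamb_solution[OF assms(2,3) cF Pu0 w(1) U u1, folded a_def,
      OF y[unfolded D_def al_def be_def], folded al_def be_def]
  have uniq: "u = lamb_wave a al be y"
    if u: "u \<in> class_E" and z: "lamb_solution m \<mu> \<kappa> F u0 u1 y1 u z" for u z
  proof -
    have cu: "continuous_on UNIV u" using u by (simp add: class_E_def)
    note X = lamb_solution_imp_two_sided_sol[OF assms(2,3) cF cu0 U cu z, folded a_def]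
    have "two_sided_sol m (2 * \<kappa> / a) F D y1 z" using X(1) unfolding D_def al_def be_def .
    then have "z = y"
      by (rule two_sided_sol_unique[OF _ y cF primitive_on_UNIV_continuous[OF d(1)] b assms(1) lip])
    then show ?thesis using X(2) unfolding al_def be_def by simp
  qed
  show ?thesis
    by (rule ex1I[of _ "lamb_wave a al be y"]) (use E uniq in blast)+
qed

end
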